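(* In the cell-probe model with word size $w=\Theta(\log n)$, there is a static membership data structure storing a set of $n$ keys from a universe $[U]$ with $U\in[2n,\operatorname{poly} n]$, using $\log\binom{U}{n}+\operatorname{poly}\log n$ bits of space, which answers membership queries (given $x\in[U]$, decide whether $x$ is in the set) in worst-case constant time.
   Context: In the cell-probe model, memory consists of $w$-bit words, and only the number of memory words accessed by the query algorithm is counted; computation is free, and objects that do not depend on the stored input (such as fixed tables or a fixed family of hash functions) may be used for free. *)

theory Defs
  imports Complex_Main "HOL-Library.Landau_Symbols"
begin

text \<open>
  A memory is a list of cells; a cell of \<open>w\<close> bits is a natural number below \<open>2 ^ w\<close>.
  A query algorithm is an adaptive decision tree: the next address may depend arbitrarily
  on the contents read so far. Computation between probes, and every table
  that does not depend on the stored set, is thereby free.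
\<close>

datatype 'r probe_alg = Return 'r | Probe nat "nat \<Rightarrow> 'r probe_alg"

primrec result :: "'r probe_alg \<Rightarrow> nat list \<Rightarrow> 'r" where
  "result (Return r) M = r"
| "result (Probe a k) M = result (k (M ! a)) M"

primrec probes :: "'r probe_alg \<Rightarrow> nat list \<Rightarrow> nat list" where
  "probes (Return r) M = []"
| "probes (Probe a k) M = a # probes (k (M ! a)) M"

definition memories :: "nat \<Rightarrow> nat \<Rightarrow> nat list set" where
  "memories w m = {M. length M = m \<and> set M \<subseteq> {..<2 ^ w}}"

record membership_ds =
  cells :: nat
  store :: "nat set \<Rightarrow> nat list"
  qry :: "nat \<Rightarrow> bool probe_alg"

definition space_bits :: "nat \<Rightarrow> membership_ds \<Rightarrow> nat" where
  "space_bits w D = w * cells D"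

definition key_sets :: "nat \<Rightarrow> nat \<Rightarrow> nat set set" where
  "key_sets U n = {S. S \<subseteq> {..<U} \<and> card S = n}"

definition correct_membership_ds :: "nat \<Rightarrow> nat \<Rightarrow> nat \<Rightarrow> membership_ds \<Rightarrow> bool" where
  "correct_membership_ds w U n D \<longleftrightarrow>
     (\<forall>S \<in> key_sets U n.
        store D S \<in> memories w (cells D) \<and>
        (\<forall>x < U.
           set (probes (qry D x) (store D S)) \<subseteq> {..<cells D} \<and>
           (result (qry D x) (store D S) \<longleftrightarrow> x \<in> S)))"

definition query_time_le :: "nat \<Rightarrow> nat \<Rightarrow> membership_ds \<Rightarrow> nat \<Rightarrow> bool" where
  "query_time_le U n D t \<longleftrightarrow>
     (\<forall>S \<in> key_sets U n. \<forall>x < U. length (probes (qry D x) (store D S)) \<le> t)"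

end

theory Submission
  imports Defs "HOL-Analysis.Analysis" "HOL-Library.Nat_Bijection" "HOL-Combinatorics.Permutations"
    "HOL-Real_Asymp.Real_Asymp"
begin

text \<open>
  The universe is permuted at random and cut into blocks of polylogarithmically many expected keys.
  A key set costs \<open>s * log (1/x) + Y * log (1 + x)\<close> bits in a block of \<open>Y\<close> elements holding \<open>s\<close> of
  the keys, where \<open>x = n / (U - n)\<close>; the total does not depend on the key set and equals
  \<open>log (U choose n) + O(log U)\<close>. So it suffices to store every block at its own cost.

  Inside a block the sets are split into polylogarithmically many classes, each of which has a number of
  members that is a power of two: the shape of a trie that separates the keys of a cell leaves a whole
  number of free bits, and a count of descriptors with the same number of keys is split along its binary
  digits. Merging \<open>sqrt (log n)\<close> blocks at a time reaches polylogarithmic size after constantly many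
  rounds, and a query reads one word per round.

  What is left is to store, for every block, a class of non-uniform probability \<open>p\<close> at cost
  \<open>log (1/p)\<close>, and a number of extra bits that depends on the class. These few items are kept in a
  separate memory of \<open>N\<close> words: each potential item is a random function, with the prescribed
  distribution, of four random words. The second moment method shows that a suitable memory exists with at
  least inverse polynomial probability even if the memory has no slack at all, so polynomially many choices of
  the random objects serve all key sets, and the choice is named in a header of \<open>O(log n)\<close> bits.
\<close>

subsection \<open>Adaptive bit-window access\<close>

text \<open>The obstacle is rounding. There are about \<open>n / polylog n\<close> blocks but only
  \<open>polylog n\<close> spare bits, so losing a constant fraction of a bit per block is already
  too much; this is why classes get fractional costs and why the shared memory may have no slack.
  The second moment survives without slack for two reasons. Two memories that agree in a fraction
  \<gamma> of their words save that fraction of the entropy of a memory, whereas an item read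
  through four words correlates them only with probability \<open>\<gamma>^4\<close>, and
  \<open>1 + \<gamma>^4 <= 2 powr (\<gamma>^2)\<close> charges at most a fraction
  \<open>\<gamma>^2\<close> of the demand. The gap \<open>\<gamma> * (1 - \<gamma>)\<close> pays for
  the binomial coefficients and the class laws. Moreover the second moment is bounded only on
  average over key sets, and the random permutation turns every key set into an average one.
  Averages are computed with weights \<open>x ^ card A\<close>, for which blocks are independent;
  since \<open>n\<close> is the most likely cardinality, returning to sets of size \<open>n\<close>
  costs only a factor of about the universe size.\<close>

text \<open>A bit string is represented by the set of positions of its ones.\<close>

definition window :: "nat \<Rightarrow> nat \<Rightarrow> nat set \<Rightarrow> nat set" where
  "window b a f = {i. i < b \<and> a + i \<in> f}"

text \<open>A semantic form of decision trees: \<open>G v\<close> may still depend on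
  \<open>f\<close>, but only through \<open>t\<close> further reads. Being a property of functions,
  it is stable under a change of the bit string, which is how one structure is simulated inside
  another.\<close>

inductive qlocal :: "nat \<Rightarrow> nat \<Rightarrow> (nat set \<Rightarrow> 'r) \<Rightarrow> bool" for b where
  const: "qlocal b t (\<lambda>f. r)"
| read: "(\<And>v. qlocal b t (G v)) \<Longrightarrow> qlocal b (Suc t) (\<lambda>f. G (window b a f) f)"

lemma qlocal_mono: "qlocal b t Q \<Longrightarrow> t \<le> t' \<Longrightarrow> qlocal b t' Q"
proof (induction arbitrary: t' rule: qlocal.induct)
  case (const t r)
  show ?case by (rule qlocal.const)
next
  case (read t G a)
  then obtain u where u: "t' = Suc u" "t \<le> u" by (cases t') auto
  show ?case unfolding u(1) by (rule qlocal.read) (use read.IH u in auto)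
qed

lemma qlocal_bind:
  "qlocal b t Q \<Longrightarrow> (\<And>r. qlocal b t' (H r)) \<Longrightarrow> qlocal b (t + t') (\<lambda>f. H (Q f) f)"
proof (induction rule: qlocal.induct)
  case (const t r)
  then show ?case by (auto intro: qlocal_mono[of b t'])
next
  case (read t G a)
  have "qlocal b (Suc (t + t')) (\<lambda>f. (\<lambda>v f. H (G v f) f) (window b a f) f)"
    by (rule qlocal.read) (use read in auto)
  then show ?case by simp
qed

text \<open>Simulation: \<open>f\<close> is seen only through the view \<open>tr f\<close>, and
  every window of that view costs \<open>s\<close> reads of the true memory, so costs
  multiply.\<close>

lemma qlocal_subst:
  assumes "\<And>a. qlocal b s (\<lambda>f. window b' a (tr f))"
  shows "qlocal b' t Q \<Longrightarrow> qlocal b (t * s) (\<lambda>f. Q (tr f))"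
proof (induction rule: qlocal.induct)
  case (const t r)
  show ?case by (rule qlocal.const)
next
  case (read t G a)
  have "qlocal b (s + t * s) (\<lambda>f. (\<lambda>v f. G v (tr f)) (window b' a (tr f)) f)"
    by (rule qlocal_bind[OF assms]) (use read in auto)
  then show ?case by simp
qed

lemma qlocal_win:
  assumes "b' \<le> b" shows "qlocal b (Suc 0) (\<lambda>f. g (window b' a f))"
proof -
  have "qlocal b (Suc 0) (\<lambda>f. (\<lambda>v f. g (v \<inter> {..<b'})) (window b a f) f)"
    by (rule qlocal.read) (rule qlocal.const)
  moreover have "window b a f \<inter> {..<b'} = window b' a f" for f
    using assms by (auto simp: window_def)
  ultimately show ?thesis by simp
qed

lemma qlocal_map: "qlocal b t Q \<Longrightarrow> qlocal b t (\<lambda>f. g (Q f))"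
  using qlocal_bind[of b t Q 0 "\<lambda>r f. g r"] by (simp add: qlocal.const)

lemma qlocal_shift: "qlocal b t Q \<Longrightarrow> qlocal b t (\<lambda>f. Q {a. c + a \<in> f})"
proof -
  assume Q: "qlocal b t Q"
  have "qlocal b (Suc 0) (\<lambda>f. window b a {a. c + a \<in> f})" for a
  proof -
    have "window b a {a. c + a \<in> f} = window b (c + a) f" for f
      by (auto simp: window_def add_ac)
    then show ?thesis using qlocal_win[of b b "\<lambda>v. v" "c + a"] by simp
  qed
  from qlocal_subst[OF this Q] show ?thesis by simp
qed

section \<open>Simulating bit windows by word probes\<close>

primrec bind_alg :: "'a probe_alg \<Rightarrow> ('a \<Rightarrow> 'b probe_alg) \<Rightarrow> 'b probe_alg" where
  "bind_alg (Return r) h = h r"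
| "bind_alg (Probe a k) h = Probe a (\<lambda>v. bind_alg (k v) h)"

lemma result_bind_alg: "result (bind_alg p h) M = result (h (result p M)) M"
  by (induction p) auto

lemma probes_bind_alg: "probes (bind_alg p h) M = probes p M @ probes (h (result p M)) M"
  by (induction p) auto

definition cell_bits :: "nat \<Rightarrow> nat list \<Rightarrow> nat set" where
  "cell_bits w M = {i. i div w < length M \<and> i mod w \<in> set_decode (M ! (i div w))}"

definition implements ::
    "nat \<Rightarrow> nat \<Rightarrow> nat \<Rightarrow> (nat set \<Rightarrow> 'r) \<Rightarrow> 'r probe_alg \<Rightarrow> bool" where
  "implements w m t Q p \<longleftrightarrow> (\<forall>M. length M = m \<longrightarrow>
     result p M = Q (cell_bits w M) \<and> set (probes p M) \<subseteq> {..<m} \<and> length (probes p M) \<le> t)"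

lemma implements_bind:
  assumes "implements w m t Q p" and "\<And>r. implements w m t' (H r) (h r)"
  shows "implements w m (t + t') (\<lambda>f. H (Q f) f) (bind_alg p h)"
  using assms unfolding implements_def
  by (auto simp: result_bind_alg probes_bind_alg intro!: add_mono)

lemma implements_cell:
  "\<exists>p. implements w m 1 (\<lambda>f. {i. i < w \<and> c * w + i \<in> f}) p"
proof (cases "c < m")
  case True
  have "implements w m 1 (\<lambda>f. {i. i < w \<and> c * w + i \<in> f})
      (Probe c (\<lambda>v. Return {i. i < w \<and> i \<in> set_decode v}))"
    unfolding implements_def using True by (auto simp: cell_bits_def)
  then show ?thesis by blast
next
  \<comment> \<open>Bits beyond the last cell count as 0 and are answered without a probe, so a
    window that overruns the memory never probes an illegal address.\<close>
  case False
  have "implements w m 1 (\<lambda>f. {i. i < w \<and> c * w + i \<in> f}) (Return {})"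
    unfolding implements_def using False by (auto simp: cell_bits_def)
  then show ?thesis by blast
qed

lemma implements_cells:
  assumes w: "w > 0"
  shows "\<exists>p. implements w m r (\<lambda>f. {i. i < r * w \<and> c * w + i \<in> f}) p"
proof (induction r)
  case 0
  have "implements w m 0 (\<lambda>f. {i. i < 0 * w \<and> c * w + i \<in> f}) (Return {})"
    by (auto simp: implements_def)
  then show ?case by blast
next
  case (Suc r)
  from Suc obtain p where p: "implements w m r (\<lambda>f. {i. i < r * w \<and> c * w + i \<in> f}) p" by blast
  obtain q where q: "implements w m 1 (\<lambda>f. {i. i < w \<and> (c + r) * w + i \<in> f}) q"
    using implements_cell by blast
  let ?H = "\<lambda>A B. A \<union> (+) (r * w) ` B"
  have "implements w m (1 + 0) (\<lambda>f. (\<lambda>B f. ?H A B) {i. i < w \<and> (c + r) * w + i \<in> f} f)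
      (bind_alg q (\<lambda>B. Return (?H A B)))" for A
    by (rule implements_bind[OF q]) (auto simp: implements_def)
  from implements_bind[OF p, OF this]
  have "implements w m (r + (1 + 0)) (\<lambda>f. ?H {i. i < r * w \<and> c * w + i \<in> f} {i. i < w \<and> (c + r) * w + i \<in> f})
      (bind_alg p (\<lambda>A. bind_alg q (\<lambda>B. Return (?H A B))))" by simp
  moreover have "?H {i. i < r * w \<and> c * w + i \<in> f} {i. i < w \<and> (c + r) * w + i \<in> f}
      = {i. i < Suc r * w \<and> c * w + i \<in> f}" for f
  proof (rule set_eqI)
    fix i
    show "i \<in> ?H {i. i < r * w \<and> c * w + i \<in> f} {i. i < w \<and> (c + r) * w + i \<in> f}
        \<longleftrightarrow> i \<in> {i. i < Suc r * w \<and> c * w + i \<in> f}"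
    proof (cases "i < r * w")
      case True then show ?thesis by (auto simp: image_iff)
    next
      case False
      then obtain j where "i = r * w + j" by (metis add.commute le_Suc_ex not_less)
      then show ?thesis by (auto simp: image_iff algebra_simps)
    qed
  qed
  ultimately show ?case by auto
qed

text \<open>A window starts fewer than \<open>w\<close> bits into its first cell, so it ends within
  the first \<open>w + b\<close> bits, and \<open>b div w + 2\<close> cells cover these. For
  \<open>b\<close> of order \<open>w\<close> this is a constant.\<close>

lemma implements_win:
  assumes w: "w > 0"
  shows "\<exists>p. implements w m (b div w + 2) (\<lambda>f. window b a f) p"
proof -
  let ?r = "b div w + 2" and ?c = "a div w"
  obtain p where p: "implements w m ?r (\<lambda>f. {i. i < ?r * w \<and> ?c * w + i \<in> f}) p"
    using implements_cells[OF w] by blast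
  have "implements w m (?r + 0)
      (\<lambda>f. (\<lambda>A f. {i. i < b \<and> a mod w + i \<in> A}) {i. i < ?r * w \<and> ?c * w + i \<in> f} f)
      (bind_alg p (\<lambda>A. Return {i. i < b \<and> a mod w + i \<in> A}))"
    by (rule implements_bind[OF p]) (auto simp: implements_def)
  moreover have "{i. i < b \<and> a mod w + i \<in> {i. i < ?r * w \<and> ?c * w + i \<in> f}} = window b a f" for f
  proof -
    have "a mod w + i < ?r * w" if "i < b" for i
    proof -
      have "a mod w < w" "b < (b div w + 1) * w"
        using w by (auto simp: dividend_less_div_times)
      then show ?thesis using that by (simp add: algebra_simps)
    qed
    moreover have "?c * w + (a mod w + i) = a + i" for i by simp
    ultimately show ?thesis unfolding window_def by auto
  qed
  ultimately show ?thesis by auto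
qed

lemma qlocal_implements:
  assumes w: "w > 0"
  shows "qlocal b t Q \<Longrightarrow> \<exists>p. implements w m (t * (b div w + 2)) Q p"
proof (induction rule: qlocal.induct)
  case (const t r)
  have "implements w m (t * (b div w + 2)) (\<lambda>f. r) (Return r)" by (auto simp: implements_def)
  then show ?case by blast
next
  case (read t G a)
  then obtain h where h: "\<And>v. implements w m (t * (b div w + 2)) (G v) (h v)" by metis
  obtain p where p: "implements w m (b div w + 2) (\<lambda>f. window b a f) p"
    using implements_win[OF w] by blast
  have "implements w m ((b div w + 2) + t * (b div w + 2)) (\<lambda>f. G (window b a f) f) (bind_alg p h)"
    by (rule implements_bind[OF p h])
  then show ?case by (metis mult_Suc)
qed

lemma set_encode_less: "A \<subseteq> {..<w} \<Longrightarrow> set_encode A < 2 ^ w"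
proof -
  assume A: "A \<subseteq> {..<w}"
  have "set_encode A \<le> (\<Sum>i<w. 2 ^ i)"
    unfolding set_encode_def using A by (simp add: sum_mono2 finite_subset)
  also have "\<dots> < 2 ^ w" by (induction w) auto
  finally show ?thesis .
qed

lemma cell_bits_surj:
  assumes w: "w > 0" and f: "f \<subseteq> {..<m * w}"
  shows "\<exists>M \<in> memories w m. cell_bits w M = f"
proof -
  define M where "M = map (\<lambda>c. set_encode {i. i < w \<and> c * w + i \<in> f}) [0..<m]"
  have "M \<in> memories w m"
    unfolding memories_def M_def by (auto intro!: set_encode_less)
  moreover have "cell_bits w M = f"
  proof (rule set_eqI)
    fix i
    have "i \<in> f \<Longrightarrow> i div w < m"
      using f w by (auto simp: div_less_iff_less_mult)
    then show "i \<in> cell_bits w M \<longleftrightarrow> i \<in> f"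
      unfolding cell_bits_def M_def using w by auto
  qed
  ultimately show ?thesis by blast
qed

text \<open>Rounding up to whole cells costs at most one word.\<close>

lemma membership_ds_of_qlocal:
  assumes w: "w > 0"
    and loc: "\<And>x. qlocal b t (Q x)"
    and ex: "\<And>S. S \<in> key_sets U n \<Longrightarrow> \<exists>f \<subseteq> {..<L}. \<forall>x<U. Q x f \<longleftrightarrow> x \<in> S"
  shows "\<exists>D. correct_membership_ds w U n D \<and> query_time_le U n D (t * (b div w + 2)) \<and>
           space_bits w D \<le> L + w"
proof -
  define m where "m = L div w + 1"
  have Lm: "L \<le> m * w" "m * w \<le> L + w"
    using w dividend_less_div_times[OF w, of L] by (auto simp: m_def algebra_simps)
  obtain p where p: "\<And>x. implements w m (t * (b div w + 2)) (Q x) (p x)"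
    using qlocal_implements[OF w loc] by metis
  have "\<exists>M \<in> memories w m. \<forall>x<U. Q x (cell_bits w M) \<longleftrightarrow> x \<in> S" if S: "S \<in> key_sets U n" for S
  proof -
    obtain f where f: "f \<subseteq> {..<L}" "\<forall>x<U. Q x f \<longleftrightarrow> x \<in> S" using ex[OF S] by blast
    have "f \<subseteq> {..<m * w}" using f(1) Lm by auto
    then show ?thesis using cell_bits_surj[OF w, of f m] f by metis
  qed
  then obtain st where st: "\<And>S. S \<in> key_sets U n \<Longrightarrow> st S \<in> memories w m"
    "\<And>S x. S \<in> key_sets U n \<Longrightarrow> x < U \<Longrightarrow> Q x (cell_bits w (st S)) \<longleftrightarrow> x \<in> S" by metis
  define D where "D = \<lparr>cells = m, store = st, qry = p\<rparr>"
  have len: "length (st S) = m" if "S \<in> key_sets U n" for S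
    using st(1)[OF that] by (auto simp: memories_def)
  have "correct_membership_ds w U n D"
    unfolding correct_membership_ds_def D_def
    using p len st unfolding implements_def by simp
  moreover have "query_time_le U n D (t * (b div w + 2))"
    unfolding query_time_le_def D_def using p len unfolding implements_def by simp
  moreover have "space_bits w D \<le> L + w"
    unfolding space_bits_def D_def using Lm by (simp add: mult.commute)
  ultimately show ?thesis by blast
qed

subsection \<open>Descriptors, payloads and dyadic classes\<close>

text \<open>The payload \<open>P\<close> is binding on its first \<open>\<mu>\<close> bits only: the
  query must succeed whatever follows them. Hence payloads need no end mark and can be concatenated,
  provided that the descriptor is known from elsewhere.\<close>

definition desc_scheme ::
    "nat \<Rightarrow> nat \<Rightarrow> nat \<Rightarrow> (nat set \<Rightarrow> bool) \<Rightarrow> 'd set \<Rightarrow> ('d \<Rightarrow> nat) \<Rightarrow> ('d \<Rightarrow> nat) \<Rightarrow>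
     (nat set \<Rightarrow> 'd) \<Rightarrow> ('d \<Rightarrow> nat \<Rightarrow> nat set \<Rightarrow> bool) \<Rightarrow> bool" where
  "desc_scheme b t Y Gd V \<mu> leaves de qr \<longleftrightarrow>
     finite V \<and> (\<forall>d y. qlocal b t (qr d y)) \<and>
     (\<forall>A. A \<subseteq> {..<Y} \<and> Gd A \<longrightarrow> de A \<in> V \<and> leaves (de A) = card A \<and>
        (\<exists>P. \<forall>f. (\<forall>a < \<mu> (de A). a \<in> f \<longleftrightarrow> a \<in> P) \<longrightarrow> (\<forall>y<Y. qr (de A) y f \<longleftrightarrow> y \<in> A)))"

text \<open>Given the descriptor, the payload determines the set, so a class has no more members
  than there are payloads.\<close>

lemma desc_scheme_card_le:
  assumes "desc_scheme b t Y Gd V \<mu> leaves de qr"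
  shows "card {A. A \<subseteq> {..<Y} \<and> Gd A \<and> de A = d} \<le> 2 ^ \<mu> d"
proof -
  let ?X = "{A. A \<subseteq> {..<Y} \<and> Gd A \<and> de A = d}"
  have "\<forall>A\<in>?X. \<exists>P. \<forall>f. (\<forall>a < \<mu> d. a \<in> f \<longleftrightarrow> a \<in> P) \<longrightarrow> (\<forall>y<Y. qr d y f \<longleftrightarrow> y \<in> A)"
    using assms unfolding desc_scheme_def by blast
  then obtain P where P: "\<And>A f y. A \<in> ?X \<Longrightarrow> (\<forall>a < \<mu> d. a \<in> f \<longleftrightarrow> a \<in> P A) \<Longrightarrow> y < Y
      \<Longrightarrow> (qr d y f \<longleftrightarrow> y \<in> A)"
    unfolding bchoice_iff by metis
  have "inj_on (\<lambda>A. P A \<inter> {..<\<mu> d}) ?X"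
  proof (rule inj_onI)
    fix A B assume A: "A \<in> ?X" and B: "B \<in> ?X" and eq: "P A \<inter> {..<\<mu> d} = P B \<inter> {..<\<mu> d}"
    have "y \<in> A \<longleftrightarrow> y \<in> B" if "y < Y" for y
      using P[OF A, of "P A" y] P[OF B, of "P A" y] eq that by blast
    then show "A = B" using A B by blast
  qed
  then have "card ?X \<le> card (Pow {..<\<mu> d})"
    by (rule card_inj_on_le) auto
  then show ?thesis by (simp add: card_Pow)
qed

text \<open>Turns weights of sets into weights of descriptors, on which all later counting is
  done.\<close>

lemma desc_scheme_sum_le:
  fixes x :: real
  assumes D: "desc_scheme b t Y Gd V \<mu> leaves de qr" and x: "0 \<le> x"
    and G: "\<And>d. d \<in> V \<Longrightarrow> 0 \<le> G d"
  shows "(\<Sum>A | A \<subseteq> {..<Y} \<and> Gd A. x ^ card A * G (de A)) \<le> (\<Sum>d\<in>V. 2 ^ \<mu> d * x ^ leaves d * G d)"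
proof -
  let ?X = "{A. A \<subseteq> {..<Y} \<and> Gd A}"
  have fin: "finite ?X" by (rule finite_subset[of _ "Pow {..<Y}"]) auto
  have V: "finite V" and im: "de ` ?X \<subseteq> V" and leaves: "\<And>A. A \<in> ?X \<Longrightarrow> leaves (de A) = card A"
    using D unfolding desc_scheme_def by auto
  have "(\<Sum>A\<in>?X. x ^ card A * G (de A)) = (\<Sum>d\<in>V. \<Sum>A | A \<in> ?X \<and> de A = d. x ^ card A * G (de A))"
    by (rule sum.group[OF fin V im, symmetric])
  also have "\<dots> = (\<Sum>d\<in>V. real (card {A. A \<in> ?X \<and> de A = d}) * (x ^ leaves d * G d))"
  proof (intro sum.cong refl)
    fix d
    have "(\<Sum>A | A \<in> ?X \<and> de A = d. x ^ card A * G (de A)) = (\<Sum>A | A \<in> ?X \<and> de A = d. x ^ leaves d * G d)"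
      using leaves by (intro sum.cong) auto
    then show "(\<Sum>A | A \<in> ?X \<and> de A = d. x ^ card A * G (de A)) =
        real (card {A. A \<in> ?X \<and> de A = d}) * (x ^ leaves d * G d)" by simp
  qed
  also have "\<dots> \<le> (\<Sum>d\<in>V. 2 ^ \<mu> d * (x ^ leaves d * G d))"
  proof (rule sum_mono)
    fix d assume d: "d \<in> V"
    have "real (card {A. A \<in> ?X \<and> de A = d}) \<le> real (2 ^ \<mu> d)"
      using desc_scheme_card_le[OF D, of d] by (intro of_nat_mono) (simp add: conj_assoc)
    then show "real (card {A. A \<in> ?X \<and> de A = d}) * (x ^ leaves d * G d) \<le> 2 ^ \<mu> d * (x ^ leaves d * G d)"
      using G[OF d] x by (intro mult_right_mono) auto
  qed
  finally show ?thesis by (simp add: mult.assoc)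
qed

text \<open>The binary digits of \<open>N\<close> split \<open>{..<N}\<close> into intervals whose lengths are distinct powers of two.\<close>

lemma dyadic_interval: "i < N \<Longrightarrow> \<exists>e \<in> set_decode N. i div 2 ^ e + 1 = N div 2 ^ e"
proof (induction N arbitrary: i rule: less_induct)
  case (less N)
  show ?case
  proof (cases "i div 2 < N div 2")
    case True
    have "N div 2 < N" using less.prems by auto
    from less.IH[OF this True] obtain e where "e \<in> set_decode (N div 2)"
      "i div 2 div 2 ^ e + 1 = N div 2 div 2 ^ e" by blast
    then have "Suc e \<in> set_decode N" "i div 2 ^ Suc e + 1 = N div 2 ^ Suc e"
      by (auto simp: div_mult2_eq)
    then show ?thesis by blast
  next
    case False
    then have "N = i + 1" "odd N" using less.prems by presburger+
    then show ?thesis by (intro bexI[of _ 0]) auto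
  qed
qed

lemma set_decode_power_le: "e \<in> set_decode N \<Longrightarrow> 2 ^ e \<le> N"
  by (metis div_less even_zero not_less set_decode_def mem_Collect_eq)

lemma sum_power_set_decode: "(\<Sum>e\<in>set_decode N. 2 ^ e) = N"
  using set_decode_inverse[of N] by (simp add: set_encode_def)

lemma set_decode_mod_subset: "set_decode (i mod 2 ^ e) \<subseteq> {..<e}"
proof
  fix a assume "a \<in> set_decode (i mod 2 ^ e)"
  then have "2 ^ a \<le> i mod 2 ^ e" by (rule set_decode_power_le)
  also have "\<dots> < 2 ^ e" by simp
  finally show "a \<in> {..<e}" by simp
qed

text \<open>The view of an old payload after regrouping: its first \<open>ex\<close> bits are known
  from the descriptor, the rest lies in memory behind \<open>e\<close> index bits. A window across
  the border only has to read the part beyond it, hence still one read.\<close>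

lemma qlocal_splice:
  assumes Q: "qlocal b t Q"
  shows "qlocal b t (\<lambda>f. Q ({a. a < ex \<and> a \<in> u} \<union> {a. ex \<le> a \<and> e + (a - ex) \<in> f}))"
proof -
  let ?tr = "\<lambda>f. {a. a < ex \<and> a \<in> u} \<union> {a. ex \<le> a \<and> e + (a - ex) \<in> f}"
  have "qlocal b (Suc 0) (\<lambda>f. window b a (?tr f))" for a
  proof (cases "ex \<le> a")
    case True
    then have "window b a (?tr f) = window b (e + (a - ex)) f" for f
      by (auto simp: window_def add.assoc)
    then show ?thesis using qlocal_win[of b b "\<lambda>v. v"] by simp
  next
    case False
    have "window b a (?tr f) =
        {i. i < b \<and> (a + i < ex \<and> a + i \<in> u \<or> ex \<le> a + i \<and> a + i - ex \<in> window b e f)}" for f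
      using False by (auto simp: window_def)
    then show ?thesis
      using qlocal_win[of b b "\<lambda>v. {i. i < b \<and> (a + i < ex \<and> a + i \<in> u \<or> ex \<le> a + i \<and> a + i - ex \<in> v)}"]
      by simp
  qed
  from qlocal_subst[OF this Q] show ?thesis by simp
qed

text \<open>Within one key count \<open>s\<close>, the payload bits beyond a common threshold \<open>M0 s\<close> move into the
  index of the descriptor, so that all remaining payloads have the same length; the threshold is low
  enough for the padding of shorter payloads to be negligible and high enough for the index to fit into a
  word.\<close>

lemma desc_scheme_regroup:
  fixes x Z L :: real
  assumes D: "desc_scheme b t Y Gd V \<mu> leaves de qr"
    and leaves: "\<And>d. d \<in> V \<Longrightarrow> leaves d \<le> smax"
    and x: "0 < x" and Z: "0 < Z" and L: "1 \<le> L"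
    and sumV: "(\<Sum>d\<in>V. 2 ^ \<mu> d * x ^ leaves d) \<le> Z"
    and K: "4 * (real (card V + 1) * real (smax + 1) * L) \<le> 2 ^ K" and Kb: "K \<le> b"
  shows "\<exists>T M de' qr'. desc_scheme b (Suc t) Y Gd T M fst de' qr' \<and> T \<subseteq> {..smax} \<times> {..K} \<and>
     (\<Sum>c\<in>T. 2 ^ M c * x ^ fst c) \<le> Z * (1 + 1 / L) \<and>
     (\<forall>c\<in>T. Z * (1 + 1 / L) \<le> 2 ^ K * 2 ^ M c * x ^ fst c)"
proof -
  define C where "C = real (card V + 1) * real (smax + 1) * L"
  have C: "1 \<le> C"
  proof -
    have "1 * 1 * 1 \<le> real (card V + 1) * real (smax + 1) * L" using L by (intro mult_mono) auto
    then show ?thesis by (simp add: C_def)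
  qed
  \<comment> \<open>The threshold makes \<open>2 ^ M0 s * x ^ s\<close> close to
    \<open>Z / C\<close>. Padding at most \<open>card V\<close> payloads for each of
    \<open>smax + 1\<close> key counts then adds at most \<open>Z / L\<close>. If the logarithm is
    negative, \<open>M0 s\<close> is 0 and nothing is padded.\<close>
  define M0 where "M0 s = nat \<lfloor>log 2 (Z / (x ^ s * C))\<rfloor>" for s
  have pos: "0 < Z / (x ^ s * C)" for s using x Z C by simp
  have M0_gt: "Z < 2 * 2 ^ M0 s * (x ^ s * C)" for s
  proof -
    have "log 2 (Z / (x ^ s * C)) < real (M0 s) + 1" unfolding M0_def by linarith
    then have "Z / (x ^ s * C) < 2 powr (real (M0 s) + 1)"
      using pos[of s] by (simp add: log_less_iff)
    also have "\<dots> = 2 * 2 ^ M0 s" by (simp add: powr_add powr_realpow)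
    finally show ?thesis using x C by (simp add: pos_divide_less_eq)
  qed
  have M0_le: "2 ^ M0 s * (x ^ s * C) \<le> Z" if "0 < M0 s" for s
  proof -
    have "real (M0 s) \<le> log 2 (Z / (x ^ s * C))" using that unfolding M0_def by linarith
    then have "2 powr real (M0 s) \<le> Z / (x ^ s * C)" using pos[of s] by (simp add: le_log_iff)
    then have "2 ^ M0 s \<le> Z / (x ^ s * C)" by (simp add: powr_realpow)
    then show ?thesis using x C by (simp add: pos_le_divide_eq)
  qed
  define Vs where "Vs s = {d \<in> V. leaves d = s}" for s
  define ex where "ex s d = \<mu> d - M0 s" for s d
  \<comment> \<open>The new index is the old descriptor together with its first \<open>ex\<close>
    payload bits; what remains is padded to exactly \<open>M0 s\<close> bits.\<close>
  define Idx where "Idx s = Sigma (Vs s) (\<lambda>d. Pow {..<ex s d})" for s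
  define N where "N s = card (Idx s)" for s
  have V: "finite V" using D unfolding desc_scheme_def by blast
  then have Vs: "finite (Vs s)" for s unfolding Vs_def by simp
  have finIdx: "finite (Idx s)" for s unfolding Idx_def using Vs by auto
  have "\<exists>h. bij_betw h {..<N s} (Idx s)" for s
    using ex_bij_betw_nat_finite[OF finIdx[of s]] by (simp add: N_def atLeast0LessThan)
  then obtain en where en: "\<And>s. bij_betw (en s) {..<N s} (Idx s)" by metis
  have NM: "real (N s) * 2 ^ M0 s * x ^ s \<le> (\<Sum>d\<in>Vs s. 2 ^ \<mu> d * x ^ s) + Z / (real (smax + 1) * L)" for s
  proof -
    have N: "real (N s) = (\<Sum>d\<in>Vs s. 2 ^ ex s d)"
      unfolding N_def Idx_def using Vs by (simp add: card_SigmaI card_Pow)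
    show ?thesis
    proof (cases "M0 s = 0")
      case True
      then have "real (N s) * 2 ^ M0 s * x ^ s = (\<Sum>d\<in>Vs s. 2 ^ \<mu> d * x ^ s)"
        unfolding N ex_def by (simp add: sum_distrib_right)
      then show ?thesis using Z L by simp
    next
      case False
      have "real (N s) * 2 ^ M0 s * x ^ s = (\<Sum>d\<in>Vs s. 2 ^ (ex s d + M0 s) * x ^ s)"
        unfolding N by (simp add: sum_distrib_right power_add)
      also have "\<dots> \<le> (\<Sum>d\<in>Vs s. 2 ^ \<mu> d * x ^ s + 2 ^ M0 s * x ^ s)"
      proof (rule sum_mono)
        fix d
        have "(2::real) ^ (ex s d + M0 s) \<le> 2 ^ \<mu> d + 2 ^ M0 s"
          by (cases "M0 s \<le> \<mu> d") (auto simp: ex_def)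
        then show "2 ^ (ex s d + M0 s) * x ^ s \<le> 2 ^ \<mu> d * x ^ s + 2 ^ M0 s * x ^ s"
          using x by (simp flip: distrib_right)
      qed
      also have "\<dots> = (\<Sum>d\<in>Vs s. 2 ^ \<mu> d * x ^ s) + real (card (Vs s)) * (2 ^ M0 s * x ^ s)"
        by (simp add: sum.distrib)
      also have "real (card (Vs s)) * (2 ^ M0 s * x ^ s) \<le> Z / (real (smax + 1) * L)"
      proof -
        have "card (Vs s) \<le> card V + 1" using card_mono[OF V, of "Vs s"] by (auto simp: Vs_def)
        then have "real (card (Vs s)) * (2 ^ M0 s * x ^ s) \<le> real (card V + 1) * (2 ^ M0 s * x ^ s)"
          using x by (intro mult_right_mono of_nat_mono) auto
        also have "\<dots> * (real (smax + 1) * L) = 2 ^ M0 s * (x ^ s * C)"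
          unfolding C_def by (simp only: mult_ac)
        finally have "real (card (Vs s)) * (2 ^ M0 s * x ^ s) * (real (smax + 1) * L) \<le> 2 ^ M0 s * (x ^ s * C)"
          using L by (simp add: mult_right_mono)
        also have "\<dots> \<le> Z" using M0_le False by simp
        finally show ?thesis using L by (simp add: pos_le_divide_eq)
      qed
      finally show ?thesis by simp
    qed
  qed
  \<comment> \<open>Class \<open>(s, e)\<close> is the interval of \<open>2 ^ e\<close> indices that
    belongs to digit \<open>e\<close> of \<open>N s\<close>; with the \<open>M0 s\<close> remaining
    bits it has \<open>2 ^ (e + M0 s)\<close> payloads.\<close>
  define T where "T = Sigma {..smax} (\<lambda>s. set_decode (N s))"
  define M where "M = (\<lambda>(s, e). e + M0 s)"
  have sum_split: "(\<Sum>s\<le>smax. \<Sum>d\<in>Vs s. 2 ^ \<mu> d * x ^ s) = (\<Sum>d\<in>V. 2 ^ \<mu> d * x ^ leaves d)"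
  proof -
    have "(\<Sum>d\<in>V. 2 ^ \<mu> d * x ^ leaves d) = (\<Sum>s\<le>smax. \<Sum>d | d \<in> V \<and> leaves d = s. 2 ^ \<mu> d * x ^ leaves d)"
      by (rule sum.group[symmetric]) (use V leaves in auto)
    also have "\<dots> = (\<Sum>s\<le>smax. \<Sum>d\<in>Vs s. 2 ^ \<mu> d * x ^ s)"
      unfolding Vs_def by (intro sum.cong) auto
    finally show ?thesis by simp
  qed
  have sumT: "(\<Sum>c\<in>T. 2 ^ M c * x ^ fst c) \<le> Z * (1 + 1 / L)"
  proof -
    have "(\<Sum>c\<in>T. 2 ^ M c * x ^ fst c) = (\<Sum>s\<le>smax. \<Sum>e\<in>set_decode (N s). 2 ^ (e + M0 s) * x ^ s)"
      unfolding T_def M_def by (subst sum.Sigma) (auto intro!: sum.cong)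
    also have "\<dots> = (\<Sum>s\<le>smax. (\<Sum>e\<in>set_decode (N s). 2 ^ e) * 2 ^ M0 s * x ^ s)"
      by (simp add: power_add sum_distrib_right)
    also have "\<dots> = (\<Sum>s\<le>smax. real (N s) * 2 ^ M0 s * x ^ s)"
    proof (intro sum.cong refl arg_cong2[where f="(*)"])
      fix s
      have "(\<Sum>e\<in>set_decode (N s). (2::real) ^ e) = real (\<Sum>e\<in>set_decode (N s). 2 ^ e)" by simp
      then show "(\<Sum>e\<in>set_decode (N s). (2::real) ^ e) = real (N s)"
        by (simp only: sum_power_set_decode)
    qed
    also have "\<dots> \<le> (\<Sum>s\<le>smax. (\<Sum>d\<in>Vs s. 2 ^ \<mu> d * x ^ s) + Z / (real (smax + 1) * L))"
      by (intro sum_mono NM)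
    also have "\<dots> = (\<Sum>d\<in>V. 2 ^ \<mu> d * x ^ leaves d) + Z / L"
    proof -
      have "real (smax + 1) * (Z / (real (smax + 1) * L)) = Z / L" by (simp del: of_nat_add)
      then show ?thesis unfolding sum.distrib sum_split by (simp add: add.commute)
    qed
    also have "\<dots> \<le> Z * (1 + 1 / L)" using sumV by (simp add: field_simps)
    finally show ?thesis .
  qed
  have ZL: "Z * (1 + 1 / L) \<le> 2 * Z" using Z L by (simp add: field_simps)
  have "\<forall>A. A \<subseteq> {..<Y} \<and> Gd A \<longrightarrow>
      (\<exists>P. \<forall>f. (\<forall>a < \<mu> (de A). a \<in> f \<longleftrightarrow> a \<in> P) \<longrightarrow> (\<forall>y<Y. qr (de A) y f \<longleftrightarrow> y \<in> A))"
    using D unfolding desc_scheme_def by blast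
  then obtain P where P: "\<And>A f y. A \<subseteq> {..<Y} \<Longrightarrow> Gd A \<Longrightarrow> (\<forall>a < \<mu> (de A). a \<in> f \<longleftrightarrow> a \<in> P A)
      \<Longrightarrow> y < Y \<Longrightarrow> (qr (de A) y f \<longleftrightarrow> y \<in> A)"
    by metis
  define pr where "pr A = (de A, P A \<inter> {..<ex (card A) (de A)})" for A
  have "\<exists>i e. i < N (card A) \<and> en (card A) i = pr A \<and> e \<in> set_decode (N (card A)) \<and>
      i div 2 ^ e + 1 = N (card A) div 2 ^ e" if "A \<subseteq> {..<Y}" "Gd A" for A
  proof -
    have "pr A \<in> Idx (card A)"
      using D that unfolding pr_def Idx_def Vs_def desc_scheme_def by auto
    then obtain i where "i < N (card A)" "en (card A) i = pr A"
      using en[of "card A"] unfolding bij_betw_def by (metis imageE lessThan_iff)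
    then show ?thesis using dyadic_interval by blast
  qed
  then obtain ii ee where ie: "\<And>A. A \<subseteq> {..<Y} \<Longrightarrow> Gd A \<Longrightarrow> ii A < N (card A) \<and> en (card A) (ii A) = pr A \<and>
      ee A \<in> set_decode (N (card A)) \<and> ii A div 2 ^ ee A + 1 = N (card A) div 2 ^ ee A"
    by metis
  define de' where "de' A = (card A, ee A)" for A :: "nat set"
  \<comment> \<open>The interval of digit \<open>e\<close> starts at
    \<open>(N div 2 ^ e - 1) * 2 ^ e\<close>; the first \<open>e\<close> payload bits are the offset
    inside it.\<close>
  define qi where "qi c (v::nat set) = en (fst c) ((N (fst c) div 2 ^ snd c - 1) * 2 ^ snd c + set_encode v)" for c v
  define qt where "qt c p y f = qr (fst p) y ({a. a < ex (fst c) (fst p) \<and> a \<in> snd p} \<union>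
       {a. ex (fst c) (fst p) \<le> a \<and> snd c + (a - ex (fst c) (fst p)) \<in> f})" for c y f
       and p :: "'a \<times> nat set"
  \<comment> \<open>Classes that occur satisfy \<open>e \<le> K \<le> b\<close>, so one window reads
    the index; the default \<open>False\<close> keeps the query local for all others.\<close>
  define qr' where "qr' c y f = (if snd c \<le> b then qt c (qi c (window (snd c) 0 f)) y f else False)" for c y f
  have loc: "qlocal b (Suc t) (qr' c y)" for c y
  proof (cases "snd c \<le> b")
    case True
    have "qlocal b (Suc 0 + t) (\<lambda>f. (\<lambda>p f. qt c p y f) (qi c (window (snd c) 0 f)) f)"
      unfolding qt_def
      by (rule qlocal_bind[OF qlocal_win[OF True]], rule qlocal_splice)
        (use D in \<open>auto simp: desc_scheme_def\<close>)
    then show ?thesis unfolding qr'_def using True by simp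
  next
    case False
    then have "qr' c y = (\<lambda>f. False)" by (simp add: qr'_def fun_eq_iff)
    then show ?thesis using qlocal.const by metis
  qed
  \<comment> \<open>The indices of one key count have total weight at most \<open>2 * Z\<close>, and
    each accounts for more than \<open>Z / (2 * C)\<close>, so there are at most
    \<open>4 * C\<close> of them.\<close>
  have NK: "N s \<le> 2 ^ K" if "s \<le> smax" for s
  proof -
    have "(\<Sum>d\<in>Vs s. 2 ^ \<mu> d * x ^ s) \<le> (\<Sum>s\<le>smax. \<Sum>d\<in>Vs s. 2 ^ \<mu> d * x ^ s)"
      using that x by (intro member_le_sum) (auto intro!: sum_nonneg)
    also have "\<dots> \<le> Z" using sum_split sumV by simp
    finally have "real (N s) * 2 ^ M0 s * x ^ s \<le> Z + Z / (real (smax + 1) * L)"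
      using NM[of s] by linarith
    also have "Z / (real (smax + 1) * L) \<le> Z"
    proof -
      have "1 * 1 \<le> real (smax + 1) * L" using L by (intro mult_mono) auto
      then show ?thesis using Z by (simp add: pos_divide_le_eq mult_le_cancel_left1 mult_ge1_I)
    qed
    finally have "real (N s) * (2 ^ M0 s * x ^ s) \<le> 2 * Z" by (simp add: mult.assoc)
    also have "\<dots> \<le> (4 * C) * (2 ^ M0 s * x ^ s)" using M0_gt[of s] by (simp add: mult_ac)
    finally have "real (N s) \<le> 4 * C" using x by (simp add: mult_le_cancel_right_pos)
    also have "\<dots> \<le> 2 ^ K" using K by (simp add: C_def)
    finally show ?thesis by (metis numeral_power_eq_of_nat_cancel_iff of_nat_le_iff of_nat_numeral of_nat_power)
  qed
  have TK: "T \<subseteq> {..smax} \<times> {..K}"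
  proof
    fix c assume "c \<in> T"
    then obtain s e where c: "c = (s, e)" "s \<le> smax" "e \<in> set_decode (N s)" unfolding T_def by auto
    have "2 ^ e \<le> (2::nat) ^ K" using set_decode_power_le[OF c(3)] NK[OF c(2)] by linarith
    then show "c \<in> {..smax} \<times> {..K}" using c by simp
  qed
  have low: "Z * (1 + 1 / L) \<le> 2 ^ K * 2 ^ M c * x ^ fst c" if "c \<in> T" for c
  proof -
    obtain s e where c: "c = (s, e)" by (cases c)
    have "Z * (1 + 1 / L) \<le> 2 * Z" by (rule ZL)
    also have "\<dots> \<le> 4 * C * (2 ^ M0 s * x ^ s)" using M0_gt[of s] by (simp add: mult_ac)
    also have "\<dots> \<le> 2 ^ K * (2 ^ M c * x ^ s)"
      using K x unfolding C_def[symmetric] by (intro mult_mono) (auto simp: c M_def power_add)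
    finally show ?thesis by (simp add: c mult.assoc)
  qed
  have "desc_scheme b (Suc t) Y Gd T M fst de' qr'"
    unfolding desc_scheme_def
  proof (intro conjI allI impI)
    show "finite T" unfolding T_def by auto
    show "qlocal b (Suc t) (qr' d y)" for d y by (rule loc)
  next
    fix A assume "A \<subseteq> {..<Y} \<and> Gd A"
    then have A: "A \<subseteq> {..<Y}" "Gd A" by auto
    define d s e i where dsei: "d = de A" "s = card A" "e = ee A" "i = ii A"
    have i: "i < N s" "en s i = (d, P A \<inter> {..<ex s d})" "e \<in> set_decode (N s)" "i div 2 ^ e + 1 = N s div 2 ^ e"
      using ie[OF A] unfolding dsei pr_def by auto
    have dV: "d \<in> V" "leaves d = s" using D A unfolding desc_scheme_def dsei by auto
    then have s: "s \<le> smax" using leaves by auto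
    show inT: "de' A \<in> T" unfolding de'_def T_def using i s dsei by auto
    show "fst (de' A) = card A" by (simp add: de'_def)
    have eb: "e \<le> b" using inT TK Kb unfolding de'_def dsei by auto
    define P' where "P' = set_decode (i mod 2 ^ e) \<union> {a. e \<le> a \<and> ex s d + (a - e) \<in> P A}"
    show "\<exists>P. \<forall>f. (\<forall>a<M (de' A). a \<in> f \<longleftrightarrow> a \<in> P) \<longrightarrow> (\<forall>y<Y. qr' (de' A) y f \<longleftrightarrow> y \<in> A)"
    proof (intro exI[of _ P'] allI impI)
      fix f y assume f: "\<forall>a<M (de' A). a \<in> f \<longleftrightarrow> a \<in> P'" and y: "y < Y"
      have M: "M (de' A) = e + M0 s" unfolding M_def de'_def dsei by simp
      have "window e 0 f = set_decode (i mod 2 ^ e)"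
        using f set_decode_mod_subset[of i e] unfolding M window_def P'_def by auto
      then have "qi (s, e) (window e 0 f) = en s ((N s div 2 ^ e - 1) * 2 ^ e + i mod 2 ^ e)"
        unfolding qi_def by simp
      also have "N s div 2 ^ e - 1 = i div 2 ^ e" using i(4) by simp
      finally have qi: "qi (s, e) (window e 0 f) = (d, P A \<inter> {..<ex s d})"
        using i(2) by (simp only: div_mult_mod_eq)
      have "qr' (de' A) y f = qr d y ({a. a < ex s d \<and> a \<in> P A \<inter> {..<ex s d}} \<union> {a. ex s d \<le> a \<and> e + (a - ex s d) \<in> f})"
        unfolding qr'_def de'_def dsei(2,3)[symmetric] using eb qi by (simp add: qt_def)
      also have "\<dots> \<longleftrightarrow> y \<in> A"
        unfolding dsei(1)
      proof (rule P[OF A _ y], intro allI impI)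
        fix a assume a: "a < \<mu> (de A)"
        show "a \<in> {a. a < ex s (de A) \<and> a \<in> P A \<inter> {..<ex s (de A)}} \<union>
            {a. ex s (de A) \<le> a \<and> e + (a - ex s (de A)) \<in> f} \<longleftrightarrow> a \<in> P A"
        proof (cases "a < ex s (de A)")
          case False
          then have "e + (a - ex s (de A)) < e + M0 s" using a unfolding ex_def by auto
          then show ?thesis
            using False f set_decode_mod_subset[of i e] unfolding M P'_def dsei(1) by auto
        qed auto
      qed
      finally show "qr' (de' A) y f \<longleftrightarrow> y \<in> A" .
    qed
  qed
  then show ?thesis using TK sumT low by blast
qed

subsection \<open>Trie shapes of sparse sets\<close>

datatype shape = Empty | One | Node shape shape

primrec leaves :: "shape \<Rightarrow> nat" where
  "leaves Empty = 0"
| "leaves One = 1"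
| "leaves (Node l r) = leaves l + leaves r"

primrec nodes :: "shape \<Rightarrow> nat" where
  "nodes Empty = 0"
| "nodes One = 0"
| "nodes (Node l r) = Suc (nodes l + nodes r)"

text \<open>\<open>v\<close> is the height of the cell. A lone key in a cell of \<open>2 ^ v\<close>
  elements is stored by its \<open>v\<close> remaining address bits, so the payload length depends
  on the shape alone.\<close>

primrec shape_bits :: "shape \<Rightarrow> nat \<Rightarrow> nat" where
  "shape_bits Empty v = 0"
| "shape_bits One v = v"
| "shape_bits (Node l r) v = shape_bits l (v - 1) + shape_bits r (v - 1)"

primrec shapes :: "nat \<Rightarrow> shape set" where
  "shapes 0 = {Empty, One}"
| "shapes (Suc v) = {Empty, One} \<union> (\<lambda>(l, r). Node l r) ` {(l, r) \<in> shapes v \<times> shapes v. 2 \<le> leaves l + leaves r}"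

primrec shape_of :: "nat \<Rightarrow> nat set \<Rightarrow> shape" where
  "shape_of 0 A = (if A = {} then Empty else One)"
| "shape_of (Suc v) A = (if A = {} then Empty else if card A = 1 then One
     else Node (shape_of v (A \<inter> {..<2 ^ v})) (shape_of v {y. 2 ^ v + y \<in> A}))"

primrec shape_query :: "shape \<Rightarrow> nat \<Rightarrow> nat \<Rightarrow> nat set \<Rightarrow> bool" where
  "shape_query Empty v y f = False"
| "shape_query One v y f = (window v 0 f = set_decode y)"
| "shape_query (Node l r) v y f = (if y < 2 ^ (v - 1) then shape_query l (v - 1) y f
     else shape_query r (v - 1) (y - 2 ^ (v - 1)) {a. shape_bits l (v - 1) + a \<in> f})"

lemma finite_shapes: "finite (shapes v)"
proof (induction v)
  case (Suc v)
  have "finite {(l, r) \<in> shapes v \<times> shapes v. 2 \<le> leaves l + leaves r}"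
    by (rule finite_subset[of _ "shapes v \<times> shapes v"]) (use Suc in auto)
  then show ?case by simp
qed simp

lemma qlocal_shape_query: "v \<le> b \<Longrightarrow> qlocal b 1 (shape_query s v y)"
proof (induction s arbitrary: v y)
  case Empty
  then show ?case by (simp add: qlocal.const)
next
  case One
  then show ?case using qlocal_win[of v b "\<lambda>w. w = set_decode y" 0] by simp
next
  case (Node l r)
  show ?case
  proof (cases "y < 2 ^ (v - 1)")
    case True
    then show ?thesis using Node.IH(1)[of "v - 1"] Node.prems by simp
  next
    case False
    then show ?thesis
      using qlocal_shift[OF Node.IH(2)[of "v - 1"]] Node.prems by simp
  qed
qed

lemma card_split_pow2:
  fixes A :: "nat set"
  assumes "A \<subseteq> {..<2 ^ Suc v}"
  shows "card A = card (A \<inter> {..<2 ^ v}) + card {y. 2 ^ v + y \<in> A}"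
proof -
  have fin: "finite A" using assms finite_subset by blast
  have A: "A = (A \<inter> {..<2 ^ v}) \<union> (+) (2 ^ v) ` {y. 2 ^ v + y \<in> A}"
  proof -
    have "\<exists>z. y = 2 ^ v + z" if "\<not> y < 2 ^ v" for y :: nat
      using that le_Suc_ex not_less by blast
    then show ?thesis by (auto simp: image_iff)
  qed
  have "card A = card (A \<inter> {..<2 ^ v}) + card ((+) (2 ^ v) ` {y. 2 ^ v + y \<in> A})"
    by (subst A, rule card_Un_disjoint) (use fin in \<open>auto intro: finite_subset[of _ A]\<close>)
  then show ?thesis by (simp add: card_image)
qed

lemma shape_of_correct:
  assumes "A \<subseteq> {..<2 ^ v}"
  shows "shape_of v A \<in> shapes v \<and> leaves (shape_of v A) = card A \<and>
    (\<exists>P. \<forall>f. (\<forall>a < shape_bits (shape_of v A) v. a \<in> f \<longleftrightarrow> a \<in> P) \<longrightarrow>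
       (\<forall>y<2 ^ v. shape_query (shape_of v A) v y f \<longleftrightarrow> y \<in> A))"
  using assms
proof (induction v arbitrary: A)
  case 0
  then have "A = {} \<or> A = {0}" by auto
  then show ?case by (auto simp: window_def)
next
  case (Suc v)
  consider "A = {}" | "card A = 1" | "2 \<le> card A"
  proof -
    have "card A = 0 \<longleftrightarrow> A = {}" using Suc.prems finite_subset by fastforce
    then show ?thesis using that by linarith
  qed
  then show ?case
  proof cases
    case 1
    then show ?thesis by simp
  next
    case 2
    then obtain z where A: "A = {z}" by (auto simp: card_1_singleton_iff)
    have z: "set_decode z \<subseteq> {..<Suc v}"
      using A Suc.prems set_decode_mod_subset[of z "Suc v"] by simp
    have "shape_query One (Suc v) y f \<longleftrightarrow> y \<in> A"
      if "\<forall>a < Suc v. a \<in> f \<longleftrightarrow> a \<in> set_decode z" for f y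
    proof -
      have "window (Suc v) 0 f = set_decode z" using that z by (auto simp: window_def)
      then show ?thesis unfolding A by (simp, metis set_decode_inverse)
    qed
    then have "\<exists>P. \<forall>f. (\<forall>a < Suc v. a \<in> f \<longleftrightarrow> a \<in> P) \<longrightarrow> (\<forall>y<2 ^ Suc v. shape_query One (Suc v) y f \<longleftrightarrow> y \<in> A)"
      by blast
    moreover have "shape_of (Suc v) A = One" using A by simp
    ultimately show ?thesis using 2 by simp
  next
    case 3
    define Al Ar where "Al = A \<inter> {..<2 ^ v}" and "Ar = {y. 2 ^ v + y \<in> A}"
    have l: "Al \<subseteq> {..<2 ^ v}" and r: "Ar \<subseteq> {..<2 ^ v}" using Suc.prems by (auto simp: Al_def Ar_def)
    define sl sr where "sl = shape_of v Al" and "sr = shape_of v Ar"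
    have ne: "A \<noteq> {}" "card A \<noteq> 1" using 3 by auto
    have sh: "shape_of (Suc v) A = Node sl sr"
      using ne by (simp add: sl_def sr_def Al_def Ar_def)
    have c: "card A = card Al + card Ar" unfolding Al_def Ar_def by (rule card_split_pow2[OF Suc.prems])
    obtain Pl where Pl: "\<And>f y. (\<forall>a < shape_bits sl v. a \<in> f \<longleftrightarrow> a \<in> Pl) \<Longrightarrow> y<2 ^ v \<Longrightarrow> shape_query sl v y f \<longleftrightarrow> y \<in> Al"
      and sl: "sl \<in> shapes v" "leaves sl = card Al"
      using Suc.IH[OF l] unfolding sl_def by metis
    obtain Pr where Pr: "\<And>f y. (\<forall>a < shape_bits sr v. a \<in> f \<longleftrightarrow> a \<in> Pr) \<Longrightarrow> y<2 ^ v \<Longrightarrow> shape_query sr v y f \<longleftrightarrow> y \<in> Ar"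
      and sr: "sr \<in> shapes v" "leaves sr = card Ar"
      using Suc.IH[OF r] unfolding sr_def by metis
    define k P where "k = shape_bits sl v" and "P = (Pl \<inter> {..<k}) \<union> (+) k ` Pr"
    have "shape_query (Node sl sr) (Suc v) y f \<longleftrightarrow> y \<in> A"
      if f: "\<forall>a < shape_bits (Node sl sr) (Suc v). a \<in> f \<longleftrightarrow> a \<in> P" and y: "y < 2 ^ Suc v" for f y
    proof (cases "y < 2 ^ v")
      case True
      have "\<forall>a < shape_bits sl v. a \<in> f \<longleftrightarrow> a \<in> Pl"
        using f by (auto simp: P_def k_def)
      from Pl[OF this True] show ?thesis using True by (simp add: Al_def)
    next
      case False
      have "\<forall>a < shape_bits sr v. a \<in> {a. k + a \<in> f} \<longleftrightarrow> a \<in> Pr"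
        using f by (auto simp: P_def k_def)
      from Pr[OF this, of "y - 2 ^ v"] show ?thesis using False y by (simp add: Ar_def k_def)
    qed
    then have "\<exists>P. \<forall>f. (\<forall>a < shape_bits (Node sl sr) (Suc v). a \<in> f \<longleftrightarrow> a \<in> P) \<longrightarrow>
        (\<forall>y<2 ^ Suc v. shape_query (Node sl sr) (Suc v) y f \<longleftrightarrow> y \<in> A)"
      by blast
    moreover have "Node sl sr \<in> shapes (Suc v)" "leaves (Node sl sr) = card A"
      using sl sr c 3 by auto
    ultimately show ?thesis unfolding sh by blast
  qed
qed

lemma shapes_desc_scheme:
  assumes v: "v \<le> b" and Gd: "\<And>A. Gd A \<Longrightarrow> q (shape_of v A)"
  shows "desc_scheme b 1 (2 ^ v) Gd {s \<in> shapes v. q s} (\<lambda>s. shape_bits s v) leaves (shape_of v) (\<lambda>s. shape_query s v)"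
  unfolding desc_scheme_def
  using finite_shapes[of v] qlocal_shape_query[OF v] shape_of_correct[of _ v] Gd by simp

text \<open>The weights below are multiplicative along \<open>Node\<close>, which turns a sum over \<open>shapes\<close> into a
  quadratic recursion.\<close>

lemma sum_shapes_Suc:
  fixes h :: "shape \<Rightarrow> real"
  shows "(\<Sum>s\<in>shapes (Suc v). h s) = h Empty + h One +
     (\<Sum>(l, r) | (l, r) \<in> shapes v \<times> shapes v \<and> 2 \<le> leaves l + leaves r. h (Node l r))"
proof -
  let ?X = "{(l, r). (l, r) \<in> shapes v \<times> shapes v \<and> 2 \<le> leaves l + leaves r}"
  have fin: "finite ?X"
    by (rule finite_subset[of _ "shapes v \<times> shapes v"]) (use finite_shapes in auto)
  have inj: "inj_on (\<lambda>(l, r). Node l r) ?X" by (auto simp: inj_on_def)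
  have "(\<Sum>s\<in>shapes (Suc v). h s) = (\<Sum>s\<in>{Empty, One}. h s) + (\<Sum>s\<in>(\<lambda>(l, r). Node l r) ` ?X. h s)"
    unfolding shapes.simps by (rule sum.union_disjoint) (use fin in auto)
  also have "(\<Sum>s\<in>(\<lambda>(l, r). Node l r) ` ?X. h s) = (\<Sum>(l, r)\<in>?X. h (Node l r))"
    by (subst sum.reindex[OF inj]) (simp add: case_prod_beta comp_def)
  finally show ?thesis by simp
qed

lemma leaves_shapes_0: "s \<in> shapes v \<Longrightarrow> leaves s = 0 \<longleftrightarrow> s = Empty"
  by (cases v; cases s) auto

lemma leaves_shapes_1: "s \<in> shapes v \<Longrightarrow> leaves s = 1 \<longleftrightarrow> s = One"
  by (cases v; cases s) auto

lemma Empty_One_in_shapes: "Empty \<in> shapes v" "One \<in> shapes v"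
  by (cases v; simp)+

text \<open>The first two factors weigh the sets of this shape, and \<open>q\<close> marks inner
  nodes: \<open>q = 1\<close> counts exactly, \<open>q = 3/2\<close> gives an exponential moment of
  the number of nodes.\<close>

definition shape_weight :: "real \<Rightarrow> real \<Rightarrow> nat \<Rightarrow> shape \<Rightarrow> real" where
  "shape_weight x q v s = 2 ^ shape_bits s v * x ^ leaves s * q ^ nodes s"

text \<open>The three pairs with fewer than two leaves do not form a node. Their total weight
  \<open>1 + 2 ^ Suc v * x\<close> is that of \<open>Empty\<close> and \<open>One\<close> one level
  up, where it appears without the factor \<open>q\<close>; this is the correction term.\<close>

lemma sum_shape_weight_Suc:
  "(\<Sum>s\<in>shapes (Suc v). shape_weight x q (Suc v) s) =
     q * (\<Sum>s\<in>shapes v. shape_weight x q v s)\<^sup>2 - (q - 1) * (1 + 2 ^ Suc v * x)"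
proof -
  let ?w = "shape_weight x q v"
  let ?X = "{(l, r). (l, r) \<in> shapes v \<times> shapes v \<and> 2 \<le> leaves l + leaves r}"
  let ?R = "{(Empty, Empty), (Empty, One), (One, Empty)}"
  have S: "shapes v \<times> shapes v = ?X \<union> ?R"
  proof -
    have "(l, r) \<in> ?R" if "l \<in> shapes v" "r \<in> shapes v" "\<not> 2 \<le> leaves l + leaves r" for l r
    proof -
      have "leaves l + leaves r < 2" using that by simp
      then consider "leaves l = 0" "leaves r = 0" | "leaves l = 0" "leaves r = 1" | "leaves l = 1" "leaves r = 0" by linarith
      then show ?thesis using that leaves_shapes_0 leaves_shapes_1 by cases auto
    qed
    then show ?thesis using Empty_One_in_shapes[of v] by auto
  qed
  have fin: "finite ?X"
    by (rule finite_subset[of _ "shapes v \<times> shapes v"]) (use finite_shapes in auto)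
  have "(\<Sum>s\<in>shapes v. ?w s)\<^sup>2 = (\<Sum>(l, r)\<in>shapes v \<times> shapes v. ?w l * ?w r)"
    unfolding power2_eq_square sum_product sum.cartesian_product ..
  also have "\<dots> = (\<Sum>(l, r)\<in>?X \<union> ?R. ?w l * ?w r)" by (rule sum.cong[OF S]) simp
  also have "\<dots> = (\<Sum>(l, r)\<in>?X. ?w l * ?w r) + (\<Sum>(l, r)\<in>?R. ?w l * ?w r)"
    by (rule sum.union_disjoint) (use fin in auto)
  also have "(\<Sum>(l, r)\<in>?R. ?w l * ?w r) = 1 + 2 ^ Suc v * x"
    by (simp add: shape_weight_def)
  finally have sq: "(\<Sum>s\<in>shapes v. ?w s)\<^sup>2 = (\<Sum>(l, r)\<in>?X. ?w l * ?w r) + (1 + 2 ^ Suc v * x)" .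
  have "(\<Sum>(l, r)\<in>?X. shape_weight x q (Suc v) (Node l r)) = q * (\<Sum>(l, r)\<in>?X. ?w l * ?w r)"
    unfolding sum_distrib_left
    by (intro sum.cong) (auto simp: shape_weight_def power_add)
  then show ?thesis
    unfolding sum_shapes_Suc sq by (simp add: shape_weight_def algebra_simps)
qed

text \<open>The right-hand side is the generating function of all subsets of \<open>2 ^ v\<close>
  points: shapes and payloads together waste nothing.\<close>

lemma sum_shape_weight_1: "(\<Sum>s\<in>shapes v. shape_weight x 1 v s) = (1 + x) ^ 2 ^ v"
proof (induction v)
  case 0
  show ?case by (simp add: shape_weight_def)
next
  case (Suc v)
  then show ?case unfolding sum_shape_weight_Suc by (simp add: power_mult[symmetric] mult.commute)
qed

text \<open>The bound is chosen to be stable under the recursion. With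
  \<open>lam = 2 ^ Suc v * x\<close>, squaring the bound for \<open>lam / 2\<close> gives
  \<open>exp (lam + lam^2 / 2)\<close>, and the remaining factor \<open>exp (lam^2 / 2)\<close>
  absorbs \<open>q\<close> once the correction term is used.\<close>

lemma sum_shape_weight_tail:
  assumes x: "0 \<le> x"
  shows "(\<Sum>s\<in>shapes v. shape_weight x (3/2) v s) \<le> exp (2 ^ v * x + (2 ^ v * x)\<^sup>2)"
proof (induction v)
  case 0
  have "1 + x \<le> exp x" by simp
  also have "\<dots> \<le> exp (x + x\<^sup>2)" by simp
  finally show ?case by (simp add: shape_weight_def)
next
  case (Suc v)
  define lam where "lam = 2 ^ Suc v * x"
  define y where "y = exp (lam\<^sup>2 / 2)"
  have lam: "0 \<le> lam" using x by (simp add: lam_def)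
  let ?F = "\<Sum>s\<in>shapes v. shape_weight x (3/2) v s"
  have F0: "0 \<le> ?F" using x by (intro sum_nonneg) (auto simp: shape_weight_def)
  have half: "2 ^ v * x = lam / 2" by (simp add: lam_def)
  have "?F\<^sup>2 \<le> (exp (lam / 2 + (lam / 2)\<^sup>2))\<^sup>2"
    using Suc F0 unfolding half by (intro power_mono) auto
  also have "\<dots> = exp lam * y"
    unfolding y_def power2_eq_square by (simp add: exp_add[symmetric])
  finally have sq: "?F\<^sup>2 \<le> exp lam * y" .
  \<comment> \<open>The correction term is worth \<open>exp lam\<close> up to second order; without
    it the factor 3/2 would accumulate over the levels.\<close>
  have e: "exp lam * (1 - lam\<^sup>2 / 2) \<le> 1 + lam"
  proof -
    have "(1 + lam) \<ge> exp lam * (1 - lam\<^sup>2 / 2)" if "0 \<le> lam" for lam :: real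
    proof (cases "1 - lam\<^sup>2 / 2 \<le> 0")
      case True
      have "exp lam * (1 - lam\<^sup>2 / 2) \<le> 0" using True by (simp add: mult_nonneg_nonpos)
      then show ?thesis using that by linarith
    next
      case False
      define f where "f z = (1 + z) * exp (- z) - (1 - z\<^sup>2 / 2)" for z :: real
      have "f 0 \<le> f lam"
      proof (rule DERIV_nonneg_imp_nondecreasing[OF that])
        fix z :: real assume z: "0 \<le> z" "z \<le> lam"
        have "(f has_real_derivative (exp (- z) - (1 + z) * exp (- z) + z)) (at z)"
          unfolding f_def by (auto intro!: derivative_eq_intros)
        moreover have "0 \<le> exp (- z) - (1 + z) * exp (- z) + z"
        proof -
          have "exp (- z) - (1 + z) * exp (- z) + z = z * (1 - exp (- z))" by (simp add: algebra_simps)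
          also have "\<dots> \<ge> 0" using z by (intro mult_nonneg_nonneg) auto
          finally show ?thesis .
        qed
        ultimately show "\<exists>y. (f has_real_derivative y) (at z) \<and> 0 \<le> y" by blast
      qed
      then have "1 - lam\<^sup>2 / 2 \<le> (1 + lam) * exp (- lam)" by (simp add: f_def)
      then have "exp lam * (1 - lam\<^sup>2 / 2) \<le> exp lam * ((1 + lam) * exp (- lam))" by (intro mult_left_mono) auto
      also have "\<dots> = 1 + lam" by (simp add: exp_minus field_simps)
      finally show ?thesis .
    qed
    then show ?thesis using lam by blast
  qed
  have y1: "1 + lam\<^sup>2 / 2 \<le> y" unfolding y_def by (rule exp_ge_add_one_self)
  have "(\<Sum>s\<in>shapes (Suc v). shape_weight x (3/2) (Suc v) s) = 3/2 * ?F\<^sup>2 - 1/2 * (1 + lam)"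
    unfolding sum_shape_weight_Suc lam_def by simp
  also have "\<dots> \<le> 3/2 * (exp lam * y) - 1/2 * (exp lam * (1 - lam\<^sup>2 / 2))"
    by (intro diff_mono mult_left_mono sq e) auto
  also have "\<dots> = exp lam * (3/2 * y - 1/2 + lam\<^sup>2 / 4)" by (simp add: algebra_simps)
  also have "\<dots> \<le> exp lam * (y * y)"
  proof -
    have "lam\<^sup>2 / 2 * (1/2) \<le> (y - 1) * (y - 1/2)"
    proof (rule mult_mono)
      show "lam\<^sup>2 / 2 \<le> y - 1" using y1 by simp
      have "0 \<le> lam\<^sup>2 / 2" by simp
      then show "1 / 2 \<le> y - 1/2" "0 \<le> y - 1" using y1 by linarith+
    qed auto
    moreover have "(y - 1) * (y - 1/2) = y * y - 3/2 * y + 1/2" by (simp add: field_simps)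
    ultimately have "3/2 * y - 1/2 + lam\<^sup>2 / 4 \<le> y * y" by linarith
    then show ?thesis by simp
  qed
  also have "\<dots> = exp (lam + lam\<^sup>2)" unfolding y_def by (simp add: exp_add[symmetric])
  finally show ?case unfolding lam_def .
qed

text \<open>With weight 1/9 per node the total obeys \<open>S \<le> 2 + S^2 / 9\<close>, and 3 is a
  fixed point of the right-hand side; Markov's inequality then yields the count.\<close>

lemma card_shapes_le: "real (card {s \<in> shapes v. nodes s \<le> h}) \<le> 3 * 9 ^ h"
proof -
  have S: "(\<Sum>s\<in>shapes v. (1/9) ^ nodes s) \<le> (3::real)"
  proof (induction v)
    case (Suc v)
    let ?w = "\<lambda>s. (1/9 :: real) ^ nodes s"
    let ?X = "{(l, r). (l, r) \<in> shapes v \<times> shapes v \<and> 2 \<le> leaves l + leaves r}"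
    have "(\<Sum>(l, r)\<in>?X. ?w (Node l r)) \<le> (\<Sum>(l, r)\<in>shapes v \<times> shapes v. ?w (Node l r))"
      by (rule sum_mono2) (use finite_shapes in auto)
    also have "\<dots> = 1/9 * (\<Sum>s\<in>shapes v. ?w s)\<^sup>2"
    proof -
      have "(\<Sum>s\<in>shapes v. ?w s)\<^sup>2 = (\<Sum>(l, r)\<in>shapes v \<times> shapes v. ?w l * ?w r)"
        unfolding power2_eq_square sum_product sum.cartesian_product ..
      then show ?thesis
        by (simp only: sum_distrib_left) (intro sum.cong, auto simp: power_add)
    qed
    also have "\<dots> \<le> 1/9 * 3\<^sup>2"
      using Suc by (intro mult_left_mono power_mono sum_nonneg) auto
    finally show ?case unfolding sum_shapes_Suc by simp
  qed simp
  let ?X = "{s \<in> shapes v. nodes s \<le> h}"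
  have "real (card ?X) * (1/9) ^ h = (\<Sum>s\<in>?X. (1/9) ^ h)" by simp
  also have "\<dots> \<le> (\<Sum>s\<in>?X. (1/9) ^ nodes s)"
    by (intro sum_mono power_decreasing) auto
  also have "\<dots> \<le> (\<Sum>s\<in>shapes v. (1/9) ^ nodes s)"
    by (rule sum_mono2) (use finite_shapes in auto)
  also note S
  finally show ?thesis by (simp add: power_one_over field_simps)
qed

text \<open>Markov's inequality for the exponential moment with factor 3/2 per node.\<close>

lemma shape_tail_sets:
  fixes x :: real
  assumes x: "0 \<le> x"
  shows "(\<Sum>A | A \<subseteq> {..<2 ^ v} \<and> h < nodes (shape_of v A). x ^ card A)
     \<le> (2/3) ^ h * exp (2 ^ v * x + (2 ^ v * x)\<^sup>2)"
proof -
  let ?Gd = "\<lambda>A. h < nodes (shape_of v A)"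
  let ?V = "{s \<in> shapes v. h < nodes s}"
  have D: "desc_scheme v 1 (2 ^ v) ?Gd ?V (\<lambda>s. shape_bits s v) leaves (shape_of v) (\<lambda>s. shape_query s v)"
    by (rule shapes_desc_scheme) auto
  have "(\<Sum>A | A \<subseteq> {..<2 ^ v} \<and> ?Gd A. x ^ card A * 1) \<le> (\<Sum>s\<in>?V. 2 ^ shape_bits s v * x ^ leaves s * 1)"
    by (rule desc_scheme_sum_le[OF D x]) auto
  also have "\<dots> \<le> (\<Sum>s\<in>?V. (2/3) ^ h * shape_weight x (3/2) v s)"
  proof (rule sum_mono)
    fix s assume s: "s \<in> ?V"
    have "(1::real) \<le> (2/3) ^ h * (3/2) ^ nodes s"
    proof -
      have "(1::real) = (2/3) ^ h * (3/2) ^ h" by (simp add: power_mult_distrib[symmetric])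
      also have "\<dots> \<le> (2/3) ^ h * (3/2) ^ nodes s"
        using s by (intro mult_left_mono power_increasing) auto
      finally show ?thesis .
    qed
    then have "2 ^ shape_bits s v * x ^ leaves s * 1 \<le> 2 ^ shape_bits s v * x ^ leaves s * ((2/3) ^ h * (3/2) ^ nodes s)"
      using x by (intro mult_left_mono) auto
    then show "2 ^ shape_bits s v * x ^ leaves s * 1 \<le> (2/3) ^ h * shape_weight x (3/2) v s"
      by (simp add: shape_weight_def mult_ac)
  qed
  also have "\<dots> \<le> (\<Sum>s\<in>shapes v. (2/3) ^ h * shape_weight x (3/2) v s)"
    by (rule sum_mono2) (use finite_shapes x in \<open>auto simp: shape_weight_def\<close>)
  also have "\<dots> = (2/3) ^ h * (\<Sum>s\<in>shapes v. shape_weight x (3/2) v s)" by (simp add: sum_distrib_left)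
  also have "\<dots> \<le> (2/3) ^ h * exp (2 ^ v * x + (2 ^ v * x)\<^sup>2)"
    by (intro mult_left_mono sum_shape_weight_tail x) auto
  finally show ?thesis by simp
qed

subsection \<open>Merging blocks\<close>

definition part :: "nat \<Rightarrow> nat \<Rightarrow> nat set \<Rightarrow> nat set" where
  "part Y i A = {y. y < Y \<and> i * Y + y \<in> A}"

lemma part_subset: "part Y i A \<subseteq> {..<Y}"
  by (auto simp: part_def)

lemma mem_part: "Y > 0 \<Longrightarrow> z \<in> A \<longleftrightarrow> z mod Y \<in> part Y (z div Y) A"
  by (simp add: part_def)

lemma mult_add_less: "i < m \<Longrightarrow> y < (Y::nat) \<Longrightarrow> i * Y + y < m * Y"
  by (metis add.commute add_less_cancel_left less_le_trans mult.commute mult_Suc_right mult_le_mono2 Suc_leI)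

lemma sum_Pow_parts:
  fixes G :: "(nat \<Rightarrow> nat set) \<Rightarrow> 'a :: comm_monoid_add"
  assumes Y: "Y > 0"
  shows "(\<Sum>A\<in>Pow {..<m * Y}. G (\<lambda>i\<in>{..<m}. part Y i A)) = (\<Sum>c\<in>PiE {..<m} (\<lambda>_. Pow {..<Y}). G c)"
proof (rule sum.reindex_bij_witness[of _ "\<lambda>c. {z. z < m * Y \<and> z mod Y \<in> c (z div Y)}" "\<lambda>A. \<lambda>i\<in>{..<m}. part Y i A"])
  fix A assume A: "A \<in> Pow {..<m * Y}"
  show "{z. z < m * Y \<and> z mod Y \<in> (\<lambda>i\<in>{..<m}. part Y i A) (z div Y)} = A"
    using A Y mem_part[OF Y] by (auto simp: div_less_iff_less_mult)
  show "(\<lambda>i\<in>{..<m}. part Y i A) \<in> PiE {..<m} (\<lambda>_. Pow {..<Y})"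
    using part_subset by auto
next
  fix c assume c: "c \<in> PiE {..<m} (\<lambda>_. Pow {..<Y})"
  show "{z. z < m * Y \<and> z mod Y \<in> c (z div Y)} \<in> Pow {..<m * Y}" by auto
  show "(\<lambda>i\<in>{..<m}. part Y i {z. z < m * Y \<and> z mod Y \<in> c (z div Y)}) = c"
  proof
    fix i
    show "(\<lambda>i\<in>{..<m}. part Y i {z. z < m * Y \<and> z mod Y \<in> c (z div Y)}) i = c i"
    proof (cases "i < m")
      case True
      then have "c i \<subseteq> {..<Y}" using c by (auto simp: PiE_def Pi_def)
      then show ?thesis using True Y mult_add_less by (auto simp: part_def)
    next
      case False
      then show ?thesis using c by (auto simp: PiE_def extensional_def)
    qed
  qed
qed auto

lemma card_parts:
  assumes Y: "Y > 0" and A: "A \<subseteq> {..<m * Y}"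
  shows "card A = (\<Sum>i<m. card (part Y i A))"
proof -
  have fin: "finite (part Y i A)" for i by (rule finite_subset[OF part_subset]) auto
  have "bij_betw (\<lambda>(i, y). i * Y + y) (Sigma {..<m} (\<lambda>i. part Y i A)) A"
  proof (rule bij_betwI[where g = "\<lambda>z. (z div Y, z mod Y)"])
    show "(\<lambda>(i, y). i * Y + y) \<in> (SIGMA i:{..<m}. part Y i A) \<rightarrow> A" by (auto simp: part_def)
    show "(\<lambda>z. (z div Y, z mod Y)) \<in> A \<rightarrow> (SIGMA i:{..<m}. part Y i A)"
      using A Y by (auto simp: part_def div_less_iff_less_mult)
  qed (auto simp: part_def)
  then have "card A = card (Sigma {..<m} (\<lambda>i. part Y i A))" by (simp add: bij_betw_same_card)
  then show ?thesis using fin by simp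
qed

text \<open>Under the weight \<open>x ^ card A\<close> the blocks of \<open>A\<close> are
  independent, which a fixed cardinality would not allow; all averages below are computed in this
  product measure.\<close>

lemma sum_Pow_prod_parts:
  fixes x :: real
  assumes Y: "Y > 0"
  shows "(\<Sum>A\<in>Pow {..<m * Y}. x ^ card A * (\<Prod>i<m. G i (part Y i A))) =
     (\<Prod>i<m. \<Sum>B\<in>Pow {..<Y}. x ^ card B * G i B)"
proof -
  have "(\<Sum>A\<in>Pow {..<m * Y}. x ^ card A * (\<Prod>i<m. G i (part Y i A))) =
      (\<Sum>A\<in>Pow {..<m * Y}. (\<lambda>c. \<Prod>i<m. x ^ card (c i) * G i (c i)) (\<lambda>i\<in>{..<m}. part Y i A))"
    using card_parts[OF Y] by (intro sum.cong) (auto simp: power_sum prod.distrib)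
  also have "\<dots> = (\<Sum>c\<in>PiE {..<m} (\<lambda>_. Pow {..<Y}). \<Prod>i<m. x ^ card (c i) * G i (c i))"
    by (rule sum_Pow_parts[OF Y])
  also have "\<dots> = (\<Prod>i<m. \<Sum>B\<in>Pow {..<Y}. x ^ card B * G i B)"
    by (rule prod_sum_PiE[symmetric]) auto
  finally show ?thesis .
qed

lemma sum_Pow_power_card:
  fixes x :: real
  assumes "finite A" shows "(\<Sum>B\<in>Pow A. x ^ card B) = (1 + x) ^ card A"
  using assms
proof (induction A rule: finite_induct)
  case (insert a A)
  have inj: "inj_on (insert a) (Pow A)" using insert.hyps by (auto simp: inj_on_def)
  have "(\<Sum>B\<in>Pow (insert a A). x ^ card B) = (\<Sum>B\<in>Pow A. x ^ card B) + (\<Sum>B\<in>insert a ` Pow A. x ^ card B)"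
    unfolding Pow_insert by (rule sum.union_disjoint) (use insert.hyps in auto)
  also have "(\<Sum>B\<in>insert a ` Pow A. x ^ card B) = (\<Sum>B\<in>Pow A. x ^ card (insert a B))"
    by (subst sum.reindex[OF inj]) simp
  also have "\<dots> = (\<Sum>B\<in>Pow A. x * x ^ card B)"
  proof (rule sum.cong[OF refl])
    fix B assume "B \<in> Pow A"
    then have "finite B" "a \<notin> B" using insert.hyps finite_subset by auto
    then show "x ^ card (insert a B) = x * x ^ card B" by simp
  qed
  finally show ?case using insert by (simp add: sum_distrib_left[symmetric] algebra_simps)
qed simp

text \<open>The marginal law of one block, written without dividing by the total weights
  \<open>(1 + x) ^ Y\<close> and \<open>(1 + x) ^ (m * Y)\<close>.\<close>

lemma sum_Pow_one_part_le:
  fixes x :: real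
  assumes Y: "Y > 0" and x: "0 \<le> x" and i: "i < m"
  shows "(\<Sum>A | A \<subseteq> {..<m * Y} \<and> q (part Y i A). x ^ card A) * (1 + x) ^ Y =
     (1 + x) ^ (m * Y) * (\<Sum>B | B \<subseteq> {..<Y} \<and> q B. x ^ card B)"
proof -
  let ?G = "\<lambda>j B. if j = i then (if q B then 1 else 0) else (1::real)"
  have "(\<Sum>A | A \<subseteq> {..<m * Y} \<and> q (part Y i A). x ^ card A) =
      (\<Sum>A\<in>Pow {..<m * Y}. x ^ card A * (if q (part Y i A) then 1 else 0))"
    by (rule sum.mono_neutral_cong_left) auto
  also have "\<dots> = (\<Sum>A\<in>Pow {..<m * Y}. x ^ card A * (\<Prod>j<m. ?G j (part Y j A)))"
  proof (rule sum.cong[OF refl])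
    fix A
    have "(\<Prod>j<m. ?G j (part Y j A)) = (\<Prod>j\<in>{i}. ?G j (part Y j A))"
      by (rule prod.mono_neutral_right) (use i in auto)
    then show "x ^ card A * (if q (part Y i A) then 1 else 0) = x ^ card A * (\<Prod>j<m. ?G j (part Y j A))" by simp
  qed
  also have "\<dots> = (\<Prod>j<m. \<Sum>B\<in>Pow {..<Y}. x ^ card B * ?G j B)" by (rule sum_Pow_prod_parts[OF Y])
  also have "\<dots> = (\<Sum>B\<in>Pow {..<Y}. x ^ card B * ?G i B) * (\<Prod>j\<in>{..<m} - {i}. \<Sum>B\<in>Pow {..<Y}. x ^ card B * ?G j B)"
    by (rule prod.remove) (use i in auto)
  also have "(\<Prod>j\<in>{..<m} - {i}. \<Sum>B\<in>Pow {..<Y}. x ^ card B * ?G j B) = (\<Prod>j\<in>{..<m} - {i}. (1 + x) ^ Y)"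
    by (rule prod.cong) (auto simp: sum_Pow_power_card)
  also have "\<dots> = (1 + x) ^ (Y * (m - 1))" using i by (simp add: power_mult)
  also have "(\<Sum>B\<in>Pow {..<Y}. x ^ card B * ?G i B) = (\<Sum>B | B \<subseteq> {..<Y} \<and> q B. x ^ card B)"
    by (rule sum.mono_neutral_cong_right) auto
  finally have "(\<Sum>A | A \<subseteq> {..<m * Y} \<and> q (part Y i A). x ^ card A) =
      (\<Sum>B | B \<subseteq> {..<Y} \<and> q B. x ^ card B) * (1 + x) ^ (Y * (m - 1))" .
  moreover have "Y + Y * (m - 1) = m * Y" using i by (cases m) auto
  ultimately show ?thesis by (simp add: power_add[symmetric] mult_ac flip: One_nat_def)
qed

lemma concat_payload:
  fixes M :: "nat \<Rightarrow> nat" and P :: "nat \<Rightarrow> nat set"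
  shows "\<exists>Q. \<forall>i<g. \<forall>a<M i. (\<Sum>j<i. M j) + a \<in> Q \<longleftrightarrow> a \<in> P i"
proof (induction g)
  case (Suc g)
  then obtain Q where Q: "\<forall>i<g. \<forall>a<M i. (\<Sum>j<i. M j) + a \<in> Q \<longleftrightarrow> a \<in> P i" by blast
  let ?o = "\<Sum>j<g. M j"
  define R where "R = (Q \<inter> {..<?o}) \<union> (+) ?o ` P g"
  have "(\<Sum>j<i. M j) + a \<in> R \<longleftrightarrow> a \<in> P i" if "i < Suc g" "a < M i" for i a
  proof (cases "i = g")
    case True then show ?thesis by (auto simp: R_def)
  next
    case False
    then have "Suc i \<le> g" using that by simp
    then have "(\<Sum>j<Suc i. M j) \<le> ?o" by (intro sum_mono2) auto
    then have "(\<Sum>j<i. M j) + a < ?o" using that by simp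
    then show ?thesis using Q False that by (auto simp: R_def)
  qed
  then show ?case by blast
qed simp

text \<open>The start of sub-block \<open>i\<close> in the common payload is a sum of lengths known
  from the descriptor, so finding it costs no read.\<close>

lemma desc_scheme_combine:
  assumes D: "desc_scheme b t Y Gd T M cn de qr" and Y: "Y > 0"
    and Gd': "\<And>A. A \<subseteq> {..<g * Y} \<Longrightarrow> Gd' A \<Longrightarrow> (\<forall>i<g. Gd (part Y i A)) \<and> card A \<le> smax"
  shows "desc_scheme b t (g * Y) Gd' {c \<in> PiE {..<g} (\<lambda>_. T). (\<Sum>i<g. cn (c i)) \<le> smax}
     (\<lambda>c. \<Sum>i<g. M (c i)) (\<lambda>c. \<Sum>i<g. cn (c i)) (\<lambda>A. \<lambda>i\<in>{..<g}. de (part Y i A))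
     (\<lambda>c y f. qr (c (y div Y)) (y mod Y) {a. (\<Sum>i<y div Y. M (c i)) + a \<in> f})"
  unfolding desc_scheme_def
proof (intro conjI allI impI)
  have T: "finite T" and loc: "\<And>d y. qlocal b t (qr d y)"
    and cn: "\<And>A. A \<subseteq> {..<Y} \<Longrightarrow> Gd A \<Longrightarrow> de A \<in> T \<and> cn (de A) = card A"
    and P: "\<And>A. A \<subseteq> {..<Y} \<Longrightarrow> Gd A \<Longrightarrow>
       \<exists>P. \<forall>f. (\<forall>a < M (de A). a \<in> f \<longleftrightarrow> a \<in> P) \<longrightarrow> (\<forall>y<Y. qr (de A) y f \<longleftrightarrow> y \<in> A)"
    using D unfolding desc_scheme_def by blast+
  show "finite {c \<in> PiE {..<g} (\<lambda>_. T). (\<Sum>i<g. cn (c i)) \<le> smax}"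
    by (rule finite_subset[of _ "PiE {..<g} (\<lambda>_. T)"]) (use T in \<open>auto intro: finite_PiE\<close>)
  show "qlocal b t (\<lambda>f. qr (c (y div Y)) (y mod Y) {a. (\<Sum>i<y div Y. M (c i)) + a \<in> f})" for c y
    by (rule qlocal_shift[OF loc])
  fix A assume "A \<subseteq> {..<g * Y} \<and> Gd' A"
  then have A: "A \<subseteq> {..<g * Y}" and good: "\<And>i. i < g \<Longrightarrow> Gd (part Y i A)" and c: "card A \<le> smax"
    using Gd' by auto
  let ?d = "\<lambda>i\<in>{..<g}. de (part Y i A)"
  show leaves: "(\<Sum>i<g. cn (?d i)) = card A"
    using cn[OF part_subset good] card_parts[OF Y A] by simp
  show "?d \<in> {c \<in> PiE {..<g} (\<lambda>_. T). (\<Sum>i<g. cn (c i)) \<le> smax}"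
    using cn[OF part_subset good] leaves c by auto
  have "\<forall>i. \<exists>P. i < g \<longrightarrow> (\<forall>f. (\<forall>a < M (?d i). a \<in> f \<longleftrightarrow> a \<in> P) \<longrightarrow> (\<forall>y<Y. qr (?d i) y f \<longleftrightarrow> y \<in> part Y i A))"
  proof
    fix i
    show "\<exists>P. i < g \<longrightarrow> (\<forall>f. (\<forall>a < M (?d i). a \<in> f \<longleftrightarrow> a \<in> P) \<longrightarrow> (\<forall>y<Y. qr (?d i) y f \<longleftrightarrow> y \<in> part Y i A))"
    proof (cases "i < g")
      case True
      then show ?thesis using P[OF part_subset good[OF True]] by simp
    qed simp
  qed
  then obtain P where P: "\<And>i f y. i < g \<Longrightarrow> \<forall>a < M (?d i). a \<in> f \<longleftrightarrow> a \<in> P i \<Longrightarrow> y < Y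
      \<Longrightarrow> qr (?d i) y f \<longleftrightarrow> y \<in> part Y i A" by metis
  obtain Q where Q: "\<And>i a. i < g \<Longrightarrow> a < M (?d i) \<Longrightarrow> (\<Sum>j<i. M (?d j)) + a \<in> Q \<longleftrightarrow> a \<in> P i"
    using concat_payload[of g "\<lambda>i. M (?d i)" P] by blast
  show "\<exists>P. \<forall>f. (\<forall>a<\<Sum>i<g. M (?d i). a \<in> f \<longleftrightarrow> a \<in> P) \<longrightarrow>
      (\<forall>y<g * Y. qr (?d (y div Y)) (y mod Y) {a. (\<Sum>i<y div Y. M (?d i)) + a \<in> f} \<longleftrightarrow> y \<in> A)"
  proof (intro exI[of _ Q] allI impI)
    fix f y assume f: "\<forall>a<\<Sum>i<g. M (?d i). a \<in> f \<longleftrightarrow> a \<in> Q" and y: "y < g * Y"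
    define i where "i = y div Y"
    have i: "i < g" using y Y by (simp add: i_def div_less_iff_less_mult)
    have "qr (?d i) (y mod Y) {a. (\<Sum>i<i. M (?d i)) + a \<in> f} \<longleftrightarrow> y mod Y \<in> part Y i A"
    proof (rule P[OF i])
      show "y mod Y < Y" using Y by simp
      show "\<forall>a<M (?d i). a \<in> {a. (\<Sum>i<i. M (?d i)) + a \<in> f} \<longleftrightarrow> a \<in> P i"
      proof (intro allI impI)
        fix a assume a: "a < M (?d i)"
        have "Suc i \<le> g" using i by simp
        then have "(\<Sum>j<Suc i. M (?d j)) \<le> (\<Sum>i<g. M (?d i))" by (intro sum_mono2) auto
        then have "(\<Sum>j<i. M (?d j)) + a < (\<Sum>i<g. M (?d i))" using a by simp
        then show "a \<in> {a. (\<Sum>i<i. M (?d i)) + a \<in> f} \<longleftrightarrow> a \<in> P i" using f Q[OF i a] by auto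
      qed
    qed
    then show "qr (?d (y div Y)) (y mod Y) {a. (\<Sum>i<y div Y. M (?d i)) + a \<in> f} \<longleftrightarrow> y \<in> A"
      using mem_part[OF Y] by (simp add: i_def)
  qed
qed

text \<open>Letting \<open>i\<close> range over all numbers is harmless, since parts beyond the set
  are empty and their tries have no nodes; it makes the predicate pass to sub-blocks.\<close>

definition cells_good :: "nat \<Rightarrow> nat \<Rightarrow> nat set \<Rightarrow> bool" where
  "cells_good v h A \<longleftrightarrow> (\<forall>i. nodes (shape_of v (part (2 ^ v) i A)) \<le> h)"

lemma nodes_shape_of_empty: "nodes (shape_of v {}) = 0"
  by (cases v) auto

lemma part_part:
  assumes "0 < c"
  shows "part z i' (part (z * c) i A) = (if i' < c then part z (i * c + i') A else {})"
proof (cases "i' < c")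
  case True
  have "i' * z + y < z * c" if "y < z" for y
    using mult_add_less[OF True that] by (simp add: mult.commute)
  then show ?thesis using True by (auto simp: part_def algebra_simps)
next
  case False
  then have "c * z \<le> i' * z" by simp
  then have "\<not> i' * z + y < z * c" for y
    using trans_le_add1[of "c * z" "i' * z" y] by (simp only: mult.commute[of z c] not_less)
  then show ?thesis using False by (auto simp: part_def)
qed

lemma cells_good_part: "0 < c \<Longrightarrow> cells_good v h A \<Longrightarrow> cells_good v h (part (2 ^ v * c) i A)"
  unfolding cells_good_def by (auto simp: part_part nodes_shape_of_empty)

text \<open>The number of regroupings inside one block of level \<open>j\<close>; each of them
  inflates the total weight by \<open>1 + 1 / L\<close>.\<close>

primrec merge_count :: "nat \<Rightarrow> nat \<Rightarrow> nat" where
  "merge_count g 0 = 1"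
| "merge_count g (Suc j) = g * merge_count g j + 1"

text \<open>Each round joins \<open>g\<close> sub-blocks and regroups, which adds one read for the
  index of the \<open>g\<close>-tuple of classes. \<open>K1\<close> makes the index of a trie shape
  fit into \<open>K\<close> bits, \<open>K2\<close> that of a tuple. The final lower bound says that
  a payload is at most \<open>K\<close> bits shorter than the cost of its sets.\<close>

lemma block_scheme:
  fixes x L :: real
  assumes x: "0 < x" and L: "1 \<le> L" and g: "0 < g" and v: "v \<le> b" and Kb: "K \<le> b"
    and K1: "4 * ((3 * 9 ^ h + 1) * real (smax + 1) * L) \<le> 2 ^ K"
    and K2: "4 * ((real ((smax + 1) * (K + 1)) ^ g + 1) * real (smax + 1) * L) \<le> 2 ^ K"
  shows "\<exists>T M de qr. desc_scheme b (j + 2) (2 ^ v * g ^ j) (\<lambda>A. cells_good v h A \<and> card A \<le> smax) T M fst de qr \<and>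
     T \<subseteq> {..smax} \<times> {..K} \<and>
     (\<Sum>c\<in>T. 2 ^ M c * x ^ fst c) \<le> (1 + x) ^ (2 ^ v * g ^ j) * (1 + 1 / L) ^ merge_count g j \<and>
     (\<forall>c\<in>T. (1 + x) ^ (2 ^ v * g ^ j) * (1 + 1 / L) ^ merge_count g j \<le> 2 ^ K * 2 ^ M c * x ^ fst c)"
proof (induction j)
  case 0
  let ?V = "{s \<in> shapes v. nodes s \<le> h \<and> leaves s \<le> smax}"
  have D: "desc_scheme b 1 (2 ^ v) (\<lambda>A. (cells_good v h A \<and> card A \<le> smax) \<and> A \<subseteq> {..<2 ^ v})
      ?V (\<lambda>s. shape_bits s v) leaves (shape_of v) (\<lambda>s. shape_query s v)"
  proof (rule shapes_desc_scheme[OF v])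
    fix A assume A: "(cells_good v h A \<and> card A \<le> smax) \<and> A \<subseteq> {..<2 ^ v}"
    have "part (2 ^ v) 0 A = A" using A by (auto simp: part_def)
    then show "nodes (shape_of v A) \<le> h \<and> leaves (shape_of v A) \<le> smax"
      using A shape_of_correct[of A v] unfolding cells_good_def by metis
  qed
  then have D': "desc_scheme b 1 (2 ^ v) (\<lambda>A. cells_good v h A \<and> card A \<le> smax)
      ?V (\<lambda>s. shape_bits s v) leaves (shape_of v) (\<lambda>s. shape_query s v)"
    unfolding desc_scheme_def by blast
  have "real (card ?V) \<le> real (card {s \<in> shapes v. nodes s \<le> h})"
    using finite_shapes[of v] by (intro of_nat_mono card_mono) auto
  also have "\<dots> \<le> 3 * 9 ^ h" by (rule card_shapes_le)
  finally have "real (card ?V + 1) \<le> 3 * 9 ^ h + 1" by simp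
  then have "4 * (real (card ?V + 1) * real (smax + 1) * L) \<le> 4 * ((3 * 9 ^ h + 1) * real (smax + 1) * L)"
    using L by (intro mult_left_mono mult_right_mono) auto
  also note K1
  finally have K: "4 * (real (card ?V + 1) * real (smax + 1) * L) \<le> 2 ^ K" .
  have "(\<Sum>s\<in>?V. 2 ^ shape_bits s v * x ^ leaves s) \<le> (\<Sum>s\<in>shapes v. shape_weight x 1 v s)"
    unfolding shape_weight_def using x finite_shapes[of v]
    by (simp, intro sum_mono2) auto
  also have "\<dots> = (1 + x) ^ 2 ^ v" by (rule sum_shape_weight_1)
  finally have S: "(\<Sum>s\<in>?V. 2 ^ shape_bits s v * x ^ leaves s) \<le> (1 + x) ^ 2 ^ v" .
  have Z: "0 < (1 + x) ^ 2 ^ v" using x by simp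
  from desc_scheme_regroup[OF D' _ x Z L S K Kb] show ?case by (simp add: numeral_2_eq_2)
next
  case (Suc j)
  define Y where "Y = 2 ^ v * g ^ j"
  define Z where "Z = (1 + x) ^ Y * (1 + 1 / L) ^ merge_count g j"
  let ?Gd = "\<lambda>A. cells_good v h A \<and> card A \<le> smax"
  have Y: "Y > 0" using g by (simp add: Y_def)
  from Suc obtain T M de qr where D: "desc_scheme b (j + 2) Y ?Gd T M fst de qr"
    and T: "T \<subseteq> {..smax} \<times> {..K}" and S: "(\<Sum>c\<in>T. 2 ^ M c * x ^ fst c) \<le> Z"
    unfolding Y_def[symmetric] Z_def by blast
  let ?V = "{c \<in> PiE {..<g} (\<lambda>_. T). (\<Sum>i<g. fst (c i)) \<le> smax}"
  have finT: "finite T" using D by (simp add: desc_scheme_def)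
  have finPi: "finite (PiE {..<g} (\<lambda>_. T))" using finT by (auto intro: finite_PiE)
  have D2: "desc_scheme b (j + 2) (g * Y) ?Gd ?V
     (\<lambda>c. \<Sum>i<g. M (c i)) (\<lambda>c. \<Sum>i<g. fst (c i)) (\<lambda>A. \<lambda>i\<in>{..<g}. de (part Y i A))
     (\<lambda>c y f. qr (c (y div Y)) (y mod Y) {a. (\<Sum>i<y div Y. M (c i)) + a \<in> f})"
  proof (rule desc_scheme_combine[OF D Y])
    fix A assume A: "A \<subseteq> {..<g * Y}" "?Gd A"
    have "card (part Y i A) \<le> card A" if "i < g" for i
      unfolding card_parts[OF Y A(1)] using that by (intro member_le_sum) auto
    then show "(\<forall>i<g. ?Gd (part Y i A)) \<and> card A \<le> smax"
      using A cells_good_part[of "g ^ j" v h A] g unfolding Y_def by fastforce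
  qed
  have "card ?V \<le> card (PiE {..<g} (\<lambda>_. T))" by (intro card_mono finPi) auto
  also have "\<dots> = card T ^ g" by (simp add: card_PiE)
  also have "\<dots> \<le> ((smax + 1) * (K + 1)) ^ g"
  proof (rule power_mono)
    have "card T \<le> card ({..smax} \<times> {..K})" using T by (intro card_mono) auto
    then show "card T \<le> (smax + 1) * (K + 1)" by (simp add: card_cartesian_product)
  qed simp
  finally have "real (card ?V) \<le> real (((smax + 1) * (K + 1)) ^ g)" by (rule of_nat_mono)
  then have "real (card ?V + 1) \<le> real ((smax + 1) * (K + 1)) ^ g + 1" by (simp only: of_nat_power of_nat_add of_nat_1 add_le_cancel_right)
  then have "4 * (real (card ?V + 1) * real (smax + 1) * L) \<le> 4 * ((real ((smax + 1) * (K + 1)) ^ g + 1) * real (smax + 1) * L)"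
    using L by (intro mult_left_mono mult_right_mono) auto
  also note K2
  finally have K: "4 * (real (card ?V + 1) * real (smax + 1) * L) \<le> 2 ^ K" .
  have "(\<Sum>c\<in>?V. 2 ^ (\<Sum>i<g. M (c i)) * x ^ (\<Sum>i<g. fst (c i))) \<le>
      (\<Sum>c\<in>PiE {..<g} (\<lambda>_. T). 2 ^ (\<Sum>i<g. M (c i)) * x ^ (\<Sum>i<g. fst (c i)))"
    using x finPi by (intro sum_mono2) auto
  also have "\<dots> = (\<Sum>c\<in>PiE {..<g} (\<lambda>_. T). \<Prod>i<g. 2 ^ M (c i) * x ^ fst (c i))"
    by (simp add: power_sum prod.distrib)
  also have "\<dots> = (\<Prod>i<g. \<Sum>c\<in>T. 2 ^ M c * x ^ fst c)"
    by (rule prod_sum_PiE[symmetric]) (use finT in auto)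
  also have "\<dots> \<le> Z ^ g"
    using S x by (auto intro!: power_mono sum_nonneg)
  finally have S2: "(\<Sum>c\<in>?V. 2 ^ (\<Sum>i<g. M (c i)) * x ^ (\<Sum>i<g. fst (c i))) \<le> Z ^ g" .
  have Zpos: "0 < Z ^ g" using x L by (simp add: Z_def add_pos_pos)
  have Zeq: "Z ^ g * (1 + 1 / L) = (1 + x) ^ (g * Y) * (1 + 1 / L) ^ merge_count g (Suc j)"
    unfolding Z_def by (simp add: power_mult_distrib power_mult[symmetric] mult.commute)
  have Yeq: "g * Y = 2 ^ v * g ^ Suc j" by (simp add: Y_def)
  from desc_scheme_regroup[OF D2 _ x Zpos L S2 K Kb]
  show ?case unfolding Zeq unfolding Yeq by simp
qed

subsection \<open>Random local constraint systems\<close>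

definition loc_funs :: "nat \<Rightarrow> 'w set \<Rightarrow> 'l set \<Rightarrow> ((nat \<times> nat \<times> nat \<times> nat) \<times> ('w \<times> 'w \<times> 'w \<times> 'w \<Rightarrow> 'l)) set" where
  "loc_funs N Wd Lab = ({..<N} \<times> {..<N} \<times> {..<N} \<times> {..<N}) \<times> PiE (Wd \<times> Wd \<times> Wd \<times> Wd) (\<lambda>_. Lab)"

definition loc_eval :: "(nat \<times> nat \<times> nat \<times> nat) \<times> ('w \<times> 'w \<times> 'w \<times> 'w \<Rightarrow> 'l) \<Rightarrow> (nat \<Rightarrow> 'w) \<Rightarrow> 'l" where
  "loc_eval \<phi> m = (case \<phi> of ((a, b, c, d), t) \<Rightarrow> t (m a, m b, m c, m d))"

text \<open>The probability of \<open>\<phi>\<close> when the four addresses are uniform and the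
  table entries are independent with law \<open>P\<close>.\<close>

definition loc_wt :: "nat \<Rightarrow> 'w set \<Rightarrow> ('l \<Rightarrow> real) \<Rightarrow> (nat \<times> nat \<times> nat \<times> nat) \<times> ('w \<times> 'w \<times> 'w \<times> 'w \<Rightarrow> 'l) \<Rightarrow> real" where
  "loc_wt N Wd P \<phi> = (1 / real N ^ 4) * (\<Prod>u\<in>Wd \<times> Wd \<times> Wd \<times> Wd. P (snd \<phi> u))"

lemma sum_tables:
  fixes P :: "'l \<Rightarrow> real"
  assumes D: "finite D" and Lab: "finite Lab" and P: "sum P Lab = 1" and v: "v \<in> Lab" and X: "X \<subseteq> D"
  shows "(\<Sum>t\<in>PiE D (\<lambda>_. Lab). (\<Prod>u\<in>D. P (t u)) * of_bool (\<forall>u\<in>X. t u = v)) = P v ^ card X"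
proof -
  let ?h = "\<lambda>u l. if u \<in> X then of_bool (l = v) else (1::real)"
  have finX: "finite X" using X D finite_subset by blast
  have "(\<Prod>u\<in>D. P (t u)) * of_bool (\<forall>u\<in>X. t u = v) = (\<Prod>u\<in>D. P (t u) * ?h u (t u))" for t
  proof -
    have "(\<Prod>u\<in>D. ?h u (t u)) = (\<Prod>u\<in>X. ?h u (t u))"
      by (rule prod.mono_neutral_right) (use D X in auto)
    also have "\<dots> = (\<Prod>u\<in>X. of_bool (t u = v))" by (rule prod.cong) auto
    also have "\<dots> = of_bool (\<forall>u\<in>X. t u = v)" using finX by (induction X rule: finite_induct) auto
    finally show ?thesis by (simp add: prod.distrib)
  qed
  then have "(\<Sum>t\<in>PiE D (\<lambda>_. Lab). (\<Prod>u\<in>D. P (t u)) * of_bool (\<forall>u\<in>X. t u = v)) =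
      (\<Sum>t\<in>PiE D (\<lambda>_. Lab). \<Prod>u\<in>D. P (t u) * ?h u (t u))" by simp
  also have "\<dots> = (\<Prod>u\<in>D. \<Sum>l\<in>Lab. P l * ?h u l)"
    by (rule prod_sum_PiE[symmetric]) (use D Lab in auto)
  also have "\<dots> = (\<Prod>u\<in>X. \<Sum>l\<in>Lab. P l * ?h u l)"
    by (rule prod.mono_neutral_right) (use D X P in auto)
  also have "\<dots> = (\<Prod>u\<in>X. P v)"
  proof (rule prod.cong[OF refl])
    fix u assume u: "u \<in> X"
    have "(\<Sum>l\<in>Lab. P l * ?h u l) = (\<Sum>l\<in>{v}. P l * ?h u l)"
      by (rule sum.mono_neutral_right) (use Lab v u in auto)
    then show "(\<Sum>l\<in>Lab. P l * ?h u l) = P v" using u by simp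
  qed
  finally show ?thesis by simp
qed

lemma loc_wt_nonneg: "(\<And>l. 0 \<le> P l) \<Longrightarrow> 0 \<le> loc_wt N Wd P \<phi>"
  unfolding loc_wt_def by (simp add: prod_nonneg)

lemma sum_loc_wt:
  assumes N: "N > 0" and Wd: "finite Wd" and Lab: "finite Lab" and P: "sum P Lab = 1"
  shows "(\<Sum>\<phi>\<in>loc_funs N Wd Lab. loc_wt N Wd P \<phi>) = 1"
proof -
  let ?D = "Wd \<times> Wd \<times> Wd \<times> Wd"
  have "(\<Prod>u\<in>?D. \<Sum>l\<in>Lab. P l) = (\<Sum>t\<in>PiE ?D (\<lambda>_. Lab). \<Prod>u\<in>?D. P (t u))"
    by (rule prod_sum_PiE) (use Wd Lab in auto)
  then have S: "(\<Sum>t\<in>PiE ?D (\<lambda>_. Lab). \<Prod>u\<in>?D. P (t u)) = 1" using P by simp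
  have "(\<Sum>\<phi>\<in>loc_funs N Wd Lab. loc_wt N Wd P \<phi>) =
      (\<Sum>ad\<in>{..<N} \<times> {..<N} \<times> {..<N} \<times> {..<N}. \<Sum>t\<in>PiE ?D (\<lambda>_. Lab). 1 / real N ^ 4 * (\<Prod>u\<in>?D. P (t u)))"
    unfolding loc_funs_def loc_wt_def sum.cartesian_product by (intro sum.cong) auto
  also have "\<dots> = 1"
    unfolding sum_distrib_left[symmetric] S using N
    by (simp add: card_cartesian_product power4_eq_xxxx)
  finally show ?thesis .
qed

text \<open>Two memories consult the same table entry exactly if they agree at all four addresses,
  which has probability the fourth power of their agreement; otherwise they see two independent
  entries.\<close>

lemma sum_loc_wt_pair:
  assumes N: "N > 0" and Wd: "finite Wd" and Lab: "finite Lab" and P: "sum P Lab = 1" and v: "v \<in> Lab"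
    and m: "m \<in> PiE {..<N} (\<lambda>_. Wd)" and m': "m' \<in> PiE {..<N} (\<lambda>_. Wd)"
  shows "(\<Sum>\<phi>\<in>loc_funs N Wd Lab. loc_wt N Wd P \<phi> * of_bool (loc_eval \<phi> m = v \<and> loc_eval \<phi> m' = v)) =
     (P v)\<^sup>2 + (real (card {a. a < N \<and> m a = m' a}) / real N) ^ 4 * (P v - (P v)\<^sup>2)"
proof -
  let ?D = "Wd \<times> Wd \<times> Wd \<times> Wd"
  let ?A = "{..<N} \<times> {..<N} \<times> {..<N} \<times> {..<N}"
  let ?G = "{a. a < N \<and> m a = m' a}"
  define u where "u m ad = (case ad of (a, b, c, d) \<Rightarrow> (m a, m b, m c, m d))" for m :: "nat \<Rightarrow> 'a" and ad :: "nat \<times> nat \<times> nat \<times> nat"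
  have uD: "u m ad \<in> ?D" "u m' ad \<in> ?D" if "ad \<in> ?A" for ad
    using m m' that by (auto simp: u_def PiE_def Pi_def)
  have inner: "(\<Sum>t\<in>PiE ?D (\<lambda>_. Lab). (\<Prod>w\<in>?D. P (t w)) * of_bool (t (u m ad) = v \<and> t (u m' ad) = v))
      = (P v)\<^sup>2 + of_bool (u m ad = u m' ad) * (P v - (P v)\<^sup>2)" if "ad \<in> ?A" for ad
  proof -
    have "(\<Sum>t\<in>PiE ?D (\<lambda>_. Lab). (\<Prod>w\<in>?D. P (t w)) * of_bool (\<forall>w\<in>{u m ad, u m' ad}. t w = v))
      = P v ^ card {u m ad, u m' ad}"
      by (rule sum_tables) (use Wd Lab P v uD[OF that] in auto)
    then show ?thesis by (cases "u m ad = u m' ad") (auto simp: numeral_2_eq_2)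
  qed
  have "(\<Sum>\<phi>\<in>loc_funs N Wd Lab. loc_wt N Wd P \<phi> * of_bool (loc_eval \<phi> m = v \<and> loc_eval \<phi> m' = v)) =
      (\<Sum>ad\<in>?A. \<Sum>t\<in>PiE ?D (\<lambda>_. Lab). 1 / real N ^ 4 *
         ((\<Prod>w\<in>?D. P (t w)) * of_bool (t (u m ad) = v \<and> t (u m' ad) = v)))"
    unfolding loc_funs_def loc_wt_def loc_eval_def u_def sum.cartesian_product
    by (intro sum.cong) (auto simp: case_prod_beta mult.assoc)
  also have "\<dots> = (\<Sum>ad\<in>?A. 1 / real N ^ 4 * ((P v)\<^sup>2 + of_bool (u m ad = u m' ad) * (P v - (P v)\<^sup>2)))"
  proof (rule sum.cong[OF refl])
    fix ad assume "ad \<in> ?A"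
    from inner[OF this] show "(\<Sum>t\<in>PiE ?D (\<lambda>_. Lab). 1 / real N ^ 4 *
         ((\<Prod>w\<in>?D. P (t w)) * of_bool (t (u m ad) = v \<and> t (u m' ad) = v))) =
       1 / real N ^ 4 * ((P v)\<^sup>2 + of_bool (u m ad = u m' ad) * (P v - (P v)\<^sup>2))"
      by (simp only: sum_distrib_left[symmetric])
  qed
  also have "\<dots> = 1 / real N ^ 4 * (real (card ?A) * (P v)\<^sup>2 + (\<Sum>ad\<in>?A. of_bool (u m ad = u m' ad)) * (P v - (P v)\<^sup>2))"
    by (simp only: sum_distrib_left[symmetric] sum.distrib sum_distrib_right[symmetric] sum_constant)
  also have "(\<Sum>ad\<in>?A. of_bool (u m ad = u m' ad)) = real (card (?G \<times> ?G \<times> ?G \<times> ?G))"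
  proof -
    have "{ad \<in> ?A. u m ad = u m' ad} = ?G \<times> ?G \<times> ?G \<times> ?G" by (auto simp: u_def)
    moreover have "finite ?A" by simp
    ultimately show ?thesis by (simp only: sum_of_bool_eq) (simp add: Int_def)
  qed
  also have "card (?G \<times> ?G \<times> ?G \<times> ?G) = card ?G ^ 4" by (simp add: card_cartesian_product power4_eq_xxxx)
  also have "card ?A = N ^ 4" by (simp add: card_cartesian_product power4_eq_xxxx)
  finally show ?thesis using N by (simp add: field_simps power_divide)
qed

text \<open>Once the set of agreement is chosen, the other words are counted as free although they
  have to differ; this overcount gives the power of \<open>card Wd\<close>.\<close>

lemma sum_agree_le:
  fixes h :: "nat \<Rightarrow> real"
  assumes Wd: "finite Wd" and m: "m \<in> PiE {..<N} (\<lambda>_. Wd)" and h: "\<And>j. 0 \<le> h j"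
  shows "(\<Sum>m'\<in>PiE {..<N} (\<lambda>_. Wd). h (card {a. a < N \<and> m a = m' a})) \<le>
     (\<Sum>j\<le>N. real (N choose j) * real (card Wd) ^ (N - j) * h j)"
proof -
  let ?M = "PiE {..<N} (\<lambda>_. Wd)"
  let ?ag = "\<lambda>m'. {a. a < N \<and> m a = m' a}"
  have finM: "finite ?M" using Wd by (auto intro: finite_PiE)
  have "(\<Sum>m'\<in>?M. h (card (?ag m'))) = (\<Sum>G\<in>Pow {..<N}. \<Sum>m' | m' \<in> ?M \<and> ?ag m' = G. h (card (?ag m')))"
    by (rule sum.group[symmetric]) (use finM in auto)
  also have "\<dots> \<le> (\<Sum>G\<in>Pow {..<N}. real (card Wd) ^ (N - card G) * h (card G))"
  proof (rule sum_mono)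
    fix G assume G: "G \<in> Pow {..<N}"
    have "(\<Sum>m' | m' \<in> ?M \<and> ?ag m' = G. h (card (?ag m'))) = real (card {m'. m' \<in> ?M \<and> ?ag m' = G}) * h (card G)"
      by simp
    also have "card {m'. m' \<in> ?M \<and> ?ag m' = G} \<le> card (PiE {..<N} (\<lambda>a. if a \<in> G then {m a} else Wd))"
    proof (rule card_mono)
      show "finite (PiE {..<N} (\<lambda>a. if a \<in> G then {m a} else Wd))" using Wd by (auto intro: finite_PiE)
      show "{m'. m' \<in> ?M \<and> ?ag m' = G} \<subseteq> PiE {..<N} (\<lambda>a. if a \<in> G then {m a} else Wd)"
        by (auto simp: PiE_def Pi_def)
    qed
    also have "card (PiE {..<N} (\<lambda>a. if a \<in> G then {m a} else Wd)) = (\<Prod>a<N. if a \<in> G then 1 else card Wd)"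
      by (subst card_PiE) (auto intro!: prod.cong)
    also have "\<dots> = (\<Prod>a\<in>{..<N} - G. if a \<in> G then 1 else card Wd)"
      by (rule prod.mono_neutral_right) auto
    also have "\<dots> = card Wd ^ (N - card G)"
    proof -
      have "card ({..<N} - G) = N - card G"
        using G finite_subset[of G "{..<N}"] by (simp add: card_Diff_subset)
      then show ?thesis by simp
    qed
    finally show "(\<Sum>m' | m' \<in> ?M \<and> ?ag m' = G. h (card (?ag m'))) \<le> real (card Wd) ^ (N - card G) * h (card G)"
      using h by (simp add: mult_right_mono)
  qed
  also have "\<dots> = (\<Sum>j\<le>N. \<Sum>G | G \<in> Pow {..<N} \<and> card G = j. real (card Wd) ^ (N - card G) * h (card G))"
  proof (rule sum.group[symmetric])
    show "card ` Pow {..<N} \<subseteq> {..N}"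
    proof
      fix j assume "j \<in> card ` Pow {..<N}"
      then obtain G where "j = card G" "G \<subseteq> {..<N}" by auto
      then show "j \<in> {..N}" using card_mono[of "{..<N}" G] by simp
    qed
  qed auto
  also have "\<dots> = (\<Sum>j\<le>N. real (N choose j) * real (card Wd) ^ (N - j) * h j)"
  proof (rule sum.cong[OF refl])
    fix j
    have "card {G. G \<subseteq> {..<N} \<and> card G = j} = N choose j" using n_subsets[of "{..<N}" j] by simp
    then show "(\<Sum>G | G \<in> Pow {..<N} \<and> card G = j. real (card Wd) ^ (N - card G) * h (card G)) =
        real (N choose j) * real (card Wd) ^ (N - j) * h j" by (simp add: mult.assoc)
  qed
  finally show ?thesis .
qed

section \<open>Second moment method for random constraint systems\<close>

definition csp_systems where
  "csp_systems I N Wd Lab = PiE I (\<lambda>_. loc_funs N Wd Lab)"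

definition csp_wt where
  "csp_wt I N Wd P \<omega> = (\<Prod>i\<in>I. loc_wt N Wd (P i) (\<omega> i))"

text \<open>Second moment method for the number of memories that satisfy all active constraints.\<close>

lemma csp_sat_weight:
  fixes P :: "'i \<Rightarrow> 'l \<Rightarrow> real" and Wd :: "'w set"
  assumes I: "finite I" and Lab: "finite Lab" and N: "N > 0" and Wd: "finite Wd" "Wd \<noteq> {}"
    and P0: "\<And>i l. 0 \<le> P i l" and P1: "\<And>i. i \<in> I \<Longrightarrow> sum (P i) Lab = 1"
    and Act: "Act \<subseteq> I" and val: "\<And>i. i \<in> Act \<Longrightarrow> val i \<in> Lab" "\<And>i. i \<in> Act \<Longrightarrow> 0 < P i (val i)"
  shows "1 / (\<Sum>j\<le>N. real (N choose j) / real (card Wd) ^ j *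
            (\<Prod>i\<in>Act. 1 + (real j / real N) ^ 4 * (1 / P i (val i) - 1)))
     \<le> (\<Sum>\<omega>\<in>csp_systems I N Wd Lab. csp_wt I N Wd P \<omega> *
          of_bool (\<exists>m\<in>PiE {..<N} (\<lambda>_. Wd). \<forall>i\<in>Act. loc_eval (\<omega> i) m = val i))"
proof -
  let ?M = "PiE {..<N} (\<lambda>_. Wd)"
  let ?F = "loc_funs N Wd Lab"
  let ?S = "csp_systems I N Wd Lab"
  define K where "K = real (card Wd)"
  have K: "K > 0" using Wd by (simp add: K_def card_gt_0_iff)
  define wt where "wt = csp_wt I N Wd P"
  define sat where "sat \<omega> m = (\<forall>i\<in>Act. loc_eval (\<omega> i) m = val i)"
    for \<omega> :: "'i \<Rightarrow> (nat \<times> nat \<times> nat \<times> nat) \<times> ('w \<times> 'w \<times> 'w \<times> 'w \<Rightarrow> 'l)" and m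
  define p where "p i = P i (val i)" for i
  \<comment> \<open>\<open>R\<close> bounds the ratio of the second moment of \<open>Z\<close> to
    the square of its mean, sorted by the number \<open>j\<close> of words on which two memories
    agree.\<close>
  define R where "R = (\<Sum>j\<le>N. real (N choose j) / K ^ j * (\<Prod>i\<in>Act. 1 + (real j / real N) ^ 4 * (1 / p i - 1)))"
  define Z where "Z \<omega> = (\<Sum>m\<in>?M. of_bool (sat \<omega> m) :: real)" for \<omega>
  have finM: "finite ?M" using Wd by (auto intro: finite_PiE)
  have finF: "finite ?F"
    unfolding loc_funs_def using Wd Lab by (intro finite_cartesian_product finite_PiE) auto
  have finS: "finite ?S" unfolding csp_systems_def using I finF by (auto intro: finite_PiE)
  have finA: "finite Act" using Act I finite_subset by blast
  have cardM: "real (card ?M) = K ^ N" by (simp add: card_PiE K_def)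
  have wt0: "0 \<le> wt \<omega>" for \<omega> unfolding wt_def csp_wt_def by (intro prod_nonneg) (auto intro: loc_wt_nonneg P0)
  have p0: "0 < p i" if "i \<in> Act" for i using val that by (simp add: p_def)
  have p1: "p i \<le> 1" if "i \<in> Act" for i
  proof -
    have "P i (val i) \<le> sum (P i) Lab" using val that Lab P0 by (intro member_le_sum) auto
    then show ?thesis using P1 Act that by (auto simp: p_def)
  qed
  have two: "(\<Sum>\<omega>\<in>?S. wt \<omega> * of_bool (sat \<omega> m \<and> sat \<omega> m')) =
      (\<Prod>i\<in>Act. (p i)\<^sup>2 + (real (card {a. a < N \<and> m a = m' a}) / real N) ^ 4 * (p i - (p i)\<^sup>2))"
    if m: "m \<in> ?M" and m': "m' \<in> ?M" for m m'
  proof -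
    let ?h = "\<lambda>i \<phi>. if i \<in> Act then of_bool (loc_eval \<phi> m = val i \<and> loc_eval \<phi> m' = val i) else (1::real)"
    have "wt \<omega> * of_bool (sat \<omega> m \<and> sat \<omega> m') = (\<Prod>i\<in>I. loc_wt N Wd (P i) (\<omega> i) * ?h i (\<omega> i))" for \<omega>
    proof -
      have "(\<Prod>i\<in>I. ?h i (\<omega> i)) = (\<Prod>i\<in>Act. ?h i (\<omega> i))"
        by (rule prod.mono_neutral_right) (use I Act in auto)
      also have "\<dots> = (\<Prod>i\<in>Act. of_bool (loc_eval (\<omega> i) m = val i \<and> loc_eval (\<omega> i) m' = val i))" by (rule prod.cong) auto
      also have "\<dots> = of_bool (\<forall>i\<in>Act. loc_eval (\<omega> i) m = val i \<and> loc_eval (\<omega> i) m' = val i)"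
        using finA by (induction Act rule: finite_induct) auto
      also have "\<dots> = of_bool (sat \<omega> m \<and> sat \<omega> m')" unfolding sat_def by auto
      finally show ?thesis unfolding wt_def csp_wt_def by (simp add: prod.distrib)
    qed
    then have "(\<Sum>\<omega>\<in>?S. wt \<omega> * of_bool (sat \<omega> m \<and> sat \<omega> m')) = (\<Sum>\<omega>\<in>?S. \<Prod>i\<in>I. loc_wt N Wd (P i) (\<omega> i) * ?h i (\<omega> i))"
      by simp
    also have "\<dots> = (\<Prod>i\<in>I. \<Sum>\<phi>\<in>?F. loc_wt N Wd (P i) \<phi> * ?h i \<phi>)"
      unfolding csp_systems_def by (rule prod_sum_PiE[symmetric]) (use I finF in auto)
    also have "\<dots> = (\<Prod>i\<in>Act. \<Sum>\<phi>\<in>?F. loc_wt N Wd (P i) \<phi> * ?h i \<phi>)"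
      by (rule prod.mono_neutral_right) (use I Act sum_loc_wt[OF N Wd(1) Lab P1] in auto)
    also have "\<dots> = (\<Prod>i\<in>Act. (p i)\<^sup>2 + (real (card {a. a < N \<and> m a = m' a}) / real N) ^ 4 * (p i - (p i)\<^sup>2))"
      unfolding p_def
    proof (rule prod.cong[OF refl])
      fix i assume i: "i \<in> Act"
      then have "sum (P i) Lab = 1" using P1 Act by auto
      from sum_loc_wt_pair[OF N Wd(1) Lab this val(1)[OF i] m m'] i
      show "(\<Sum>\<phi>\<in>?F. loc_wt N Wd (P i) \<phi> * ?h i \<phi>) =
        (P i (val i))\<^sup>2 + (real (card {a. a < N \<and> m a = m' a}) / real N) ^ 4 * (P i (val i) - (P i (val i))\<^sup>2)"
        by simp
    qed
    finally show ?thesis .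
  qed
  define q where "q = (\<Prod>i\<in>Act. p i)"
  have q: "0 < q" unfolding q_def using p0 by (intro prod_pos) auto
  have EZ: "(\<Sum>\<omega>\<in>?S. wt \<omega> * Z \<omega>) = K ^ N * q"
  proof -
    have "(\<Sum>\<omega>\<in>?S. wt \<omega> * Z \<omega>) = (\<Sum>m\<in>?M. \<Sum>\<omega>\<in>?S. wt \<omega> * of_bool (sat \<omega> m))"
      unfolding Z_def sum_distrib_left by (rule sum.swap)
    also have "\<dots> = (\<Sum>m\<in>?M. q)"
    proof (rule sum.cong[OF refl])
      fix m assume m: "m \<in> ?M"
      have "{a. a < N \<and> m a = m a} = {..<N}" by auto
      then show "(\<Sum>\<omega>\<in>?S. wt \<omega> * of_bool (sat \<omega> m)) = q"
        using two[OF m m] N unfolding q_def by simp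
    qed
    finally show ?thesis using cardM by simp
  qed
  have EZ2: "(\<Sum>\<omega>\<in>?S. wt \<omega> * (Z \<omega>)\<^sup>2) \<le> (K ^ N * q)\<^sup>2 * R"
  proof -
    define g where "g j = (\<Prod>i\<in>Act. (p i)\<^sup>2 + (real j / real N) ^ 4 * (p i - (p i)\<^sup>2))" for j
    have g: "g j = q\<^sup>2 * (\<Prod>i\<in>Act. 1 + (real j / real N) ^ 4 * (1 / p i - 1))" for j
    proof -
      have "g j = (\<Prod>i\<in>Act. (p i)\<^sup>2 * (1 + (real j / real N) ^ 4 * (1 / p i - 1)))"
        unfolding g_def using p0 by (intro prod.cong) (auto simp: field_simps power2_eq_square)
      then show ?thesis by (simp add: prod.distrib q_def prod_power_distrib)
    qed
    have g0: "0 \<le> g j" for j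
      unfolding g_def
    proof (intro prod_nonneg)
      fix i assume i: "i \<in> Act"
      have "(p i)\<^sup>2 \<le> p i" using p0[OF i] p1[OF i] by (simp add: power2_eq_square mult_le_one mult_left_le)
      then show "0 \<le> (p i)\<^sup>2 + (real j / real N) ^ 4 * (p i - (p i)\<^sup>2)" by simp
    qed
    have "wt \<omega> * (Z \<omega>)\<^sup>2 = (\<Sum>m\<in>?M. \<Sum>m'\<in>?M. wt \<omega> * of_bool (sat \<omega> m \<and> sat \<omega> m'))" for \<omega>
    proof -
      have "(Z \<omega>)\<^sup>2 = (\<Sum>m\<in>?M. \<Sum>m'\<in>?M. of_bool (sat \<omega> m \<and> sat \<omega> m'))"
        unfolding Z_def power2_eq_square sum_product by (simp add: of_bool_conj)
      then show ?thesis by (simp only: sum_distrib_left)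
    qed
    then have "(\<Sum>\<omega>\<in>?S. wt \<omega> * (Z \<omega>)\<^sup>2) = (\<Sum>\<omega>\<in>?S. \<Sum>m\<in>?M. \<Sum>m'\<in>?M. wt \<omega> * of_bool (sat \<omega> m \<and> sat \<omega> m'))"
      by simp
    also have "\<dots> = (\<Sum>m\<in>?M. \<Sum>m'\<in>?M. \<Sum>\<omega>\<in>?S. wt \<omega> * of_bool (sat \<omega> m \<and> sat \<omega> m'))"
      by (subst sum.swap) (intro sum.cong refl sum.swap)
    also have "\<dots> = (\<Sum>m\<in>?M. \<Sum>m'\<in>?M. g (card {a. a < N \<and> m a = m' a}))"
      unfolding g_def using two by (intro sum.cong refl) auto
    also have "\<dots> \<le> (\<Sum>m\<in>?M. \<Sum>j\<le>N. real (N choose j) * K ^ (N - j) * g j)"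
      unfolding K_def by (intro sum_mono sum_agree_le Wd g0)
    also have "\<dots> = K ^ N * (\<Sum>j\<le>N. real (N choose j) * K ^ (N - j) * g j)" using cardM by simp
    also have "(\<Sum>j\<le>N. real (N choose j) * K ^ (N - j) * g j) = K ^ N * q\<^sup>2 * R"
      unfolding R_def sum_distrib_left
    proof (rule sum.cong[OF refl])
      fix j assume "j \<in> {..N}"
      then have "K ^ (N - j) = K ^ N / K ^ j" using K by (simp add: power_diff)
      then show "real (N choose j) * K ^ (N - j) * g j = K ^ N * q\<^sup>2 * (real (N choose j) / K ^ j *
          (\<Prod>i\<in>Act. 1 + (real j / real N) ^ 4 * (1 / p i - 1)))" unfolding g by simp
    qed
    finally show ?thesis by (simp add: power2_eq_square mult_ac)
  qed
  define pr where "pr = (\<Sum>\<omega>\<in>?S. wt \<omega> * of_bool (\<exists>m\<in>?M. sat \<omega> m))"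
  have pr0: "0 \<le> pr" unfolding pr_def using wt0 by (intro sum_nonneg) auto
  \<comment> \<open>Cauchy-Schwarz for \<open>Z\<close> times the indicator of \<open>Z > 0\<close>:
    the squared mean is at most the success probability times the second moment.\<close>
  have "(\<Sum>\<omega>\<in>?S. wt \<omega> * Z \<omega>)\<^sup>2 = (\<Sum>\<omega>\<in>?S. (sqrt (wt \<omega>) * of_bool (\<exists>m\<in>?M. sat \<omega> m)) * (sqrt (wt \<omega>) * Z \<omega>))\<^sup>2"
  proof (rule arg_cong[where f = "\<lambda>x. x\<^sup>2"], rule sum.cong[OF refl])
    fix \<omega>
    have "Z \<omega> = 0" if "\<not> (\<exists>m\<in>?M. sat \<omega> m)"
      unfolding Z_def by (rule sum.neutral) (use that in auto)
    then have "of_bool (\<exists>m\<in>?M. sat \<omega> m) * Z \<omega> = Z \<omega>" by auto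
    moreover have "sqrt (wt \<omega>) * sqrt (wt \<omega>) = wt \<omega>" using wt0 by simp
    ultimately show "wt \<omega> * Z \<omega> = (sqrt (wt \<omega>) * of_bool (\<exists>m\<in>?M. sat \<omega> m)) * (sqrt (wt \<omega>) * Z \<omega>)"
      by (simp only: mult.assoc mult.left_commute[of "of_bool _" "sqrt _"]) (simp only: mult.assoc[symmetric])
  qed
  also have "\<dots> \<le> (\<Sum>\<omega>\<in>?S. (sqrt (wt \<omega>) * of_bool (\<exists>m\<in>?M. sat \<omega> m))\<^sup>2) * (\<Sum>\<omega>\<in>?S. (sqrt (wt \<omega>) * Z \<omega>)\<^sup>2)"
    by (rule Cauchy_Schwarz_ineq_sum)
  also have "\<dots> = pr * (\<Sum>\<omega>\<in>?S. wt \<omega> * (Z \<omega>)\<^sup>2)"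
  proof -
    have "(of_bool c :: real)\<^sup>2 = of_bool c" for c by (cases c) auto
    then show ?thesis unfolding pr_def using wt0 by (simp add: power_mult_distrib)
  qed
  also have "\<dots> \<le> pr * ((K ^ N * q)\<^sup>2 * R)" by (intro mult_left_mono EZ2 pr0)
  finally have "(K ^ N * q)\<^sup>2 * 1 \<le> (K ^ N * q)\<^sup>2 * (pr * R)" unfolding EZ by (simp add: mult_ac)
  then have prR: "1 \<le> pr * R" using K q by (subst (asm) mult_le_cancel_left_pos) auto
  then have "0 < R" using pr0 by (metis less_le_trans mult_nonneg_nonpos not_less zero_less_one)
  with prR have "1 / R \<le> pr" by (simp add: pos_divide_le_eq)
  then show ?thesis unfolding R_def pr_def p_def K_def wt_def sat_def .
qed

subsection \<open>Estimates, covering and random permutations\<close>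

text \<open>Used with \<open>u = \<gamma>^2\<close>: a fair bit contributes the factor
  \<open>1 + \<gamma>^4\<close> and is thereby charged only \<open>\<gamma>^2\<close> bits. The
  proof compares with the tangents of \<open>2 powr u\<close> at 0 and at 1.\<close>

lemma one_plus_sq_le_powr:
  fixes u :: real
  assumes "0 \<le> u" "u \<le> 1"
  shows "1 + u\<^sup>2 \<le> 2 powr u"
proof (cases "u \<le> 1/2")
  case True
  have l: "2/3 \<le> ln (2::real)" by (rule ln2_ge_two_thirds)
  have "u\<^sup>2 \<le> u * ln 2"
    unfolding power2_eq_square using True assms l by (intro mult_left_mono) auto
  also have "1 + u * ln 2 \<le> exp (u * ln 2)" by (rule exp_ge_add_one_self)
  finally show ?thesis by (simp add: powr_def)
next
  case False
  have l: "ln (2::real) \<le> 25/36" by (rule ln2_le_25_over_36)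
  have "(1 - u) * (1 + u - 2 * ln 2) \<ge> 0"
    using False assms l by (intro mult_nonneg_nonneg) auto
  then have "1 + u\<^sup>2 \<le> 2 * (1 - (1 - u) * ln 2)" by (simp add: algebra_simps power2_eq_square)
  also have "\<dots> \<le> 2 * exp (- ((1 - u) * ln 2))" using exp_ge_add_one_self[of "- ((1 - u) * ln 2)"] by simp
  also have "\<dots> = 2 powr u"
  proof -
    have "(2::real) * exp (- ((1 - u) * ln 2)) = exp (ln 2) * exp (- ((1 - u) * ln 2))" by simp
    also have "\<dots> = exp (u * ln 2)" unfolding exp_add[symmetric] by (simp add: algebra_simps)
    finally show ?thesis by (simp add: powr_def)
  qed
  finally show ?thesis .
qed

lemma powr_le_affine:
  fixes p u :: real
  assumes p: "0 < p" and u: "0 \<le> u" "u \<le> 1"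
  shows "p powr u \<le> u * p + (1 - u)"
  using Youngs_inequality_0[of u "1 - u" p 1] assms by simp

lemma binomial_le_pow_min: "j \<le> N \<Longrightarrow> N choose j \<le> N ^ min j (N - j)"
  by (metis binomial_le_pow binomial_symmetric diff_le_self min_def)

text \<open>Budget in bits: agreement in a fraction \<gamma> of the words saves
  \<open>\<gamma> * W * N\<close>, the items demand at most \<open>\<gamma>^2 * W * N\<close>. Of
  the gap \<open>\<gamma> * (1 - \<gamma>) * W * N\<close>, one half pays for the binomial
  coefficient, because \<open>N\<close> is at most \<open>2 powr (W / 4)\<close>, and one half for
  the \<open>m\<close> class laws. So the bound holds even for
  \<open>\<kappa> = W * N\<close>.\<close>

lemma csp_term_le_1:
  fixes \<kappa> A :: real
  assumes N: "N > 0" and j: "j \<le> N" and N4: "real N ^ 4 \<le> 2 ^ W"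
    and \<kappa>: "\<kappa> \<le> real W * real N" and A: "0 \<le> A" "6 * real m * A \<le> real W * real N"
  shows "real (N choose j) / (2 ^ W) ^ j * (2 powr ((real j / real N)\<^sup>2 * \<kappa>) *
     (1 + (real j / real N) ^ 4 * (1 - (real j / real N)\<^sup>2) * A) ^ m) \<le> 1"
proof -
  define \<gamma> where "\<gamma> = real j / real N"
  define WN where "WN = real W * real N"
  have g: "0 \<le> \<gamma>" "\<gamma> \<le> 1" using N j by (auto simp: \<gamma>_def)
  have WN0: "0 \<le> WN" by (simp add: WN_def)
  define mn where "mn = min j (N - j)"
  define y where "y = \<gamma> ^ 4 * (1 - \<gamma>\<^sup>2) * A"
  have Nle: "real N \<le> 2 powr (real W / 4)"
  proof -
    have "real N = (real N ^ 4) powr (1/4)" using N by (simp add: powr_powr flip: powr_numeral)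
    also have "\<dots> \<le> (2 ^ W) powr (1/4)" using N4 by (intro powr_mono2) auto
    also have "\<dots> = 2 powr (real W / 4)" by (simp add: powr_powr flip: powr_realpow)
    finally show ?thesis .
  qed
  have t1: "real (N choose j) \<le> 2 powr (real W / 4 * real mn)"
  proof -
    have "real (N choose j) \<le> real (N ^ mn)" unfolding mn_def by (intro of_nat_mono binomial_le_pow_min j)
    also have "\<dots> \<le> (2 powr (real W / 4)) ^ mn" using Nle by (simp add: power_mono)
    also have "\<dots> = 2 powr (real W / 4 * real mn)" by (simp add: powr_powr flip: powr_realpow)
    finally show ?thesis .
  qed
  have y0: "0 \<le> y" unfolding y_def using g A by (simp add: power_le_one)
  have yle: "y \<le> 2 * (\<gamma> * (1 - \<gamma>)) * A"
  proof -
    have "\<gamma> ^ 4 * (1 - \<gamma>\<^sup>2) = (\<gamma> ^ 3 * (1 + \<gamma>)) * (\<gamma> * (1 - \<gamma>))" by (simp add: power2_eq_square eval_nat_numeral algebra_simps)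
    also have "\<dots> \<le> 2 * (\<gamma> * (1 - \<gamma>))"
    proof (rule mult_right_mono)
      have "\<gamma> ^ 3 * (1 + \<gamma>) \<le> 1 * 2" using g by (intro mult_mono power_le_one) auto
      then show "\<gamma> ^ 3 * (1 + \<gamma>) \<le> 2" by simp
    qed (use g in auto)
    finally show ?thesis unfolding y_def using A by (intro mult_right_mono)
  qed
  have t2: "(1 + y) ^ m \<le> 2 powr (\<gamma> * (1 - \<gamma>) * WN / 2)"
  proof -
    have "(1 + y) ^ m \<le> exp y ^ m" using y0 exp_ge_add_one_self[of y] by (intro power_mono) auto
    also have "\<dots> = exp (real m * y)" by (simp add: exp_of_nat_mult)
    also have "\<dots> \<le> exp (\<gamma> * (1 - \<gamma>) * WN / 2 * ln 2)"
    proof -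
      have "real m * y \<le> real m * (2 * (\<gamma> * (1 - \<gamma>)) * A)" using yle by (intro mult_left_mono) auto
      also have "\<dots> = (\<gamma> * (1 - \<gamma>)) / 3 * (6 * real m * A)" by simp
      also have "\<dots> \<le> (\<gamma> * (1 - \<gamma>)) / 3 * WN" using g A unfolding WN_def by (intro mult_left_mono) auto
      also have "\<dots> = \<gamma> * (1 - \<gamma>) * WN / 2 * (2/3)" by simp
      also have "\<dots> \<le> \<gamma> * (1 - \<gamma>) * WN / 2 * ln 2"
        using g WN0 ln2_ge_two_thirds by (intro mult_left_mono) auto
      finally show ?thesis by simp
    qed
    also have "\<dots> = 2 powr (\<gamma> * (1 - \<gamma>) * WN / 2)" by (simp add: powr_def)
    finally show ?thesis .
  qed
  have jW: "real W * real j = \<gamma> * WN" using N by (simp add: \<gamma>_def WN_def)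
  have t3: "1 / (2 ^ W) ^ j = 2 powr (- (\<gamma> * WN))"
    unfolding jW[symmetric] by (simp add: powr_minus_divide powr_powr flip: powr_realpow)
  have t4: "2 powr (\<gamma>\<^sup>2 * \<kappa>) \<le> 2 powr (\<gamma>\<^sup>2 * WN)"
    using \<kappa> unfolding WN_def by (intro powr_mono mult_left_mono) auto
  have mn: "real mn / 2 \<le> \<gamma> * (1 - \<gamma>) * real N"
  proof -
    have e: "\<gamma> * (1 - \<gamma>) * real N = real j * real (N - j) / real N"
      using N j by (simp add: \<gamma>_def of_nat_diff field_simps)
    have "real mn * real N / 2 \<le> real j * real (N - j)"
    proof (cases "j \<le> N - j")
      case True
      then have "real N \<le> 2 * real (N - j)" by linarith
      then have "real j * real N \<le> real j * (2 * real (N - j))" by (intro mult_left_mono) auto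
      then show ?thesis using True by (simp add: mn_def algebra_simps)
    next
      case False
      then have "real N \<le> 2 * real j" by linarith
      then have "real (N - j) * real N \<le> real (N - j) * (2 * real j)" by (intro mult_left_mono) auto
      then show ?thesis using False by (simp add: mn_def mult_ac)
    qed
    then show ?thesis unfolding e using N by (simp add: field_simps)
  qed
  have "real (N choose j) / (2 ^ W) ^ j * (2 powr (\<gamma>\<^sup>2 * \<kappa>) * (1 + y) ^ m) =
      real (N choose j) * (1 / (2 ^ W) ^ j) * (2 powr (\<gamma>\<^sup>2 * \<kappa>) * (1 + y) ^ m)" by simp
  also have "\<dots> \<le> 2 powr (real W / 4 * real mn) * 2 powr (- (\<gamma> * WN)) * (2 powr (\<gamma>\<^sup>2 * WN) * 2 powr (\<gamma> * (1 - \<gamma>) * WN / 2))"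
    using t1 t2 t3 t4 y0 by (intro mult_mono) auto
  also have "\<dots> = 2 powr (real W / 4 * real mn + (- (\<gamma> * WN)) + (\<gamma>\<^sup>2 * WN + \<gamma> * (1 - \<gamma>) * WN / 2))"
    by (simp only: powr_add)
  also have "\<dots> \<le> 2 powr 0"
  proof (rule powr_mono)
    have "real W / 2 * (real mn / 2) \<le> real W / 2 * (\<gamma> * (1 - \<gamma>) * real N)"
      using mn by (intro mult_left_mono) auto
    moreover have "real W / 4 * real mn + (- (\<gamma> * WN)) + (\<gamma>\<^sup>2 * WN + \<gamma> * (1 - \<gamma>) * WN / 2) =
        real W / 2 * (real mn / 2) - real W / 2 * (\<gamma> * (1 - \<gamma>) * real N)"
      unfolding WN_def by (simp add: field_simps power2_eq_square)
    ultimately show "real W / 4 * real mn + (- (\<gamma> * WN)) + (\<gamma>\<^sup>2 * WN + \<gamma> * (1 - \<gamma>) * WN / 2) \<le> 0"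
      by simp
  qed simp
  finally show ?thesis unfolding y_def \<gamma>_def by simp
qed

section \<open>Binomial weights and concentration\<close>

text \<open>This \<open>x\<close> makes \<open>n\<close> the mode of the binomial weights, since the
  ratio of consecutive terms crosses 1 there; the largest of \<open>U + 1\<close> terms is at least
  their average.\<close>

lemma binomial_max_term:
  fixes x :: real
  assumes n: "0 < n" "n < U" and x: "x = real n / real (U - n)"
  shows "(1 + x) ^ U \<le> real (U + 1) * (real (U choose n) * x ^ n)"
proof -
  define f where "f j = real (U choose j) * x ^ j" for j
  have x0: "0 < x" using n x by simp
  have step: "real (Suc j) * f (Suc j) = real (U - j) * x * f j" for j
  proof -
    have "real (Suc j) * real (U choose Suc j) = real (U - j) * real (U choose j)"
      unfolding of_nat_mult[symmetric] by (simp only: binomial_absorption binomial_absorb_comp)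
    then have "real (Suc j) * real (U choose Suc j) * x ^ Suc j = real (U - j) * real (U choose j) * x ^ Suc j" by simp
    then show ?thesis by (simp add: f_def mult_ac)
  qed
  have f0: "0 \<le> f j" for j using x0 by (simp add: f_def)
  have up: "f j \<le> f (Suc j)" if "Suc j \<le> n" for j
  proof -
    have "real (Suc j) * real (U - n) \<le> real (U - j) * real n"
      using that by (subst mult.commute, intro mult_mono of_nat_mono) auto
    then have "real (Suc j) \<le> real (U - j) * x" unfolding x using n by (simp add: field_simps)
    then have "real (Suc j) * f j \<le> real (U - j) * x * f j" using f0 by (intro mult_right_mono)
    then have "real (Suc j) * f j \<le> real (Suc j) * f (Suc j)" using step by simp
    then show ?thesis by (simp only: mult_le_cancel_left_pos of_nat_0_less_iff zero_less_Suc)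
  qed
  have down: "f (Suc j) \<le> f j" if "n \<le> j" for j
  proof -
    have "real (U - j) * real n \<le> real (Suc j) * real (U - n)"
      using that by (subst mult.commute, intro mult_mono of_nat_mono) auto
    then have "real (U - j) * x \<le> real (Suc j)" unfolding x using n by (simp add: field_simps)
    then have "real (U - j) * x * f j \<le> real (Suc j) * f j" using f0 by (intro mult_right_mono)
    then have "real (Suc j) * f (Suc j) \<le> real (Suc j) * f j" using step by simp
    then show ?thesis by (simp only: mult_le_cancel_left_pos of_nat_0_less_iff zero_less_Suc)
  qed
  have le: "f j \<le> f n" for j
  proof (cases "j \<le> n")
    case True
    then show ?thesis
    proof (induction rule: inc_induct)
      case (step k) then show ?case using up[of k] by linarith
    qed simp
  next
    case False
    then have "n \<le> j" by simp
    then show ?thesis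
    proof (induction rule: dec_induct)
      case (step k) then show ?case using down[of k] by linarith
    qed simp
  qed
  have "(1 + x) ^ U = (\<Sum>j\<le>U. f j)"
    using binomial_ring[of x 1 U] by (simp add: f_def add.commute)
  also have "\<dots> \<le> (\<Sum>j\<le>U. f n)" by (intro sum_mono le)
  finally show ?thesis by (simp add: f_def)
qed

lemma exp_le_quadratic: "\<bar>t\<bar> \<le> 1 \<Longrightarrow> exp t \<le> 1 + t + (t::real)\<^sup>2"
proof (cases "0 \<le> t")
  case True
  assume "\<bar>t\<bar> \<le> 1"
  then show ?thesis using exp_bound[of t] True by simp
next
  case False
  assume t: "\<bar>t\<bar> \<le> 1"
  define s where "s = - t"
  have s: "0 \<le> s" "s \<le> 1" using t False by (auto simp: s_def)
  have "1 \<le> (1 - s + s\<^sup>2) * (1 + s)" using s by (simp add: algebra_simps power2_eq_square)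
  also have "\<dots> \<le> (1 - s + s\<^sup>2) * exp s"
    using s by (intro mult_left_mono exp_ge_add_one_self) auto
  finally have "exp (- s) \<le> 1 - s + s\<^sup>2" by (simp add: exp_minus field_simps)
  then show ?thesis by (simp add: s_def)
qed

text \<open>Chernoff's bound with tilt \<open>D / (2 * B)\<close>, where \<open>B\<close> is the
  mean; \<open>D \<le> 2 * B\<close> keeps the tilt within the range of the quadratic bound for
  \<open>exp\<close>.\<close>

lemma card_tail_sets:
  fixes x B D :: real
  assumes x: "0 < x" and B: "B = real Y * (x / (1 + x))"
    and D: "0 < D" "D \<le> 2 * B"
  shows "(\<Sum>A | A \<subseteq> {..<Y} \<and> D < \<bar>real (card A) - B\<bar>. x ^ card A) \<le> 2 * exp (- D\<^sup>2 / (4 * B)) * (1 + x) ^ Y"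
proof -
  have B0: "B > 0" using D by linarith
  have pw: "(\<Sum>A\<in>Pow {..<Y}. y ^ card A) = (1 + y) ^ Y" for y :: real
    by (subst sum_Pow_power_card) auto
  define t where "t = D / (2 * B)"
  have t: "0 < t" "t \<le> 1" using D B0 by (auto simp: t_def)
  have tl: "(\<Sum>A\<in>Pow {..<Y}. x ^ card A * exp (\<theta> * (real (card A) - B) - t * D)) \<le> exp (- D\<^sup>2 / (4 * B)) * (1 + x) ^ Y"
    if th: "\<bar>\<theta>\<bar> = t" for \<theta>
  proof -
    have "(\<Sum>A\<in>Pow {..<Y}. x ^ card A * exp (\<theta> * (real (card A) - B) - t * D)) =
        (\<Sum>A\<in>Pow {..<Y}. (x * exp \<theta>) ^ card A * exp (- \<theta> * B - t * D))"
    proof (rule sum.cong[OF refl])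
      fix A :: "nat set"
      have "exp (\<theta> * (real (card A) - B) - t * D) = exp (real (card A) * \<theta>) * exp (- \<theta> * B - t * D)"
        unfolding exp_add[symmetric] by (simp add: algebra_simps)
      then show "x ^ card A * exp (\<theta> * (real (card A) - B) - t * D) = (x * exp \<theta>) ^ card A * exp (- \<theta> * B - t * D)"
        by (simp add: exp_of_nat_mult power_mult_distrib)
    qed
    also have "\<dots> = (1 + x * exp \<theta>) ^ Y * exp (- \<theta> * B - t * D)"
      unfolding sum_distrib_right[symmetric] pw ..
    also have "(1 + x * exp \<theta>) ^ Y \<le> ((1 + x) * exp (x / (1 + x) * (\<theta> + \<theta>\<^sup>2))) ^ Y"
    proof (rule power_mono)
      have "1 + x * exp \<theta> \<le> 1 + x * (1 + \<theta> + \<theta>\<^sup>2)"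
        using x t th exp_le_quadratic[of \<theta>] by simp
      also have "\<dots> = (1 + x) * (1 + x / (1 + x) * (\<theta> + \<theta>\<^sup>2))" using x by (simp add: field_simps)
      also have "\<dots> \<le> (1 + x) * exp (x / (1 + x) * (\<theta> + \<theta>\<^sup>2))"
        using x by (intro mult_left_mono exp_ge_add_one_self) auto
      finally show "1 + x * exp \<theta> \<le> (1 + x) * exp (x / (1 + x) * (\<theta> + \<theta>\<^sup>2))" .
    qed (use x in auto)
    also have "\<dots> = (1 + x) ^ Y * exp (B * (\<theta> + \<theta>\<^sup>2))"
      unfolding B by (simp add: power_mult_distrib exp_of_nat_mult[symmetric] mult_ac)
    finally have "(\<Sum>A\<in>Pow {..<Y}. x ^ card A * exp (\<theta> * (real (card A) - B) - t * D)) \<le>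
        (1 + x) ^ Y * exp (B * (\<theta> + \<theta>\<^sup>2)) * exp (- \<theta> * B - t * D)" by simp
    also have "\<dots> = (1 + x) ^ Y * exp (B * \<theta>\<^sup>2 - t * D)"
      unfolding mult.assoc exp_add[symmetric] by (simp add: algebra_simps)
    also have "\<theta>\<^sup>2 = t\<^sup>2" using th by (metis power2_abs)
    also have "B * t\<^sup>2 - t * D = - D\<^sup>2 / (4 * B)"
      using B0 by (simp add: t_def field_simps power2_eq_square)
    finally show ?thesis by (simp add: mult.commute)
  qed
  have "(\<Sum>A | A \<subseteq> {..<Y} \<and> D < \<bar>real (card A) - B\<bar>. x ^ card A) \<le>
      (\<Sum>A | A \<subseteq> {..<Y} \<and> D < \<bar>real (card A) - B\<bar>. x ^ card A * exp (t * (real (card A) - B) - t * D) +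
         x ^ card A * exp (- t * (real (card A) - B) - t * D))"
  proof (rule sum_mono)
    fix A assume "A \<in> {A. A \<subseteq> {..<Y} \<and> D < \<bar>real (card A) - B\<bar>}"
    then consider "D < real (card A) - B" | "D < - (real (card A) - B)" by fastforce
    then have "1 \<le> exp (t * (real (card A) - B) - t * D) + exp (- t * (real (card A) - B) - t * D)"
    proof cases
      case 1
      then have "t * D \<le> t * (real (card A) - B)" using t by (intro mult_left_mono) auto
      then have "1 \<le> exp (t * (real (card A) - B) - t * D)" by simp
      then show ?thesis by (simp add: add_increasing2)
    next
      case 2
      then have "t * D \<le> t * - (real (card A) - B)" using t by (intro mult_left_mono) auto
      then have "1 \<le> exp (- t * (real (card A) - B) - t * D)" by (simp add: algebra_simps)
      then show ?thesis by (simp add: add_increasing)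
    qed
    then have "x ^ card A * 1 \<le> x ^ card A * (exp (t * (real (card A) - B) - t * D) + exp (- t * (real (card A) - B) - t * D))"
      using x by (intro mult_left_mono) auto
    then show "x ^ card A \<le> x ^ card A * exp (t * (real (card A) - B) - t * D) +
         x ^ card A * exp (- t * (real (card A) - B) - t * D)" by (simp add: distrib_left)
  qed
  also have "\<dots> \<le> (\<Sum>A\<in>Pow {..<Y}. x ^ card A * exp (t * (real (card A) - B) - t * D) +
         x ^ card A * exp (- t * (real (card A) - B) - t * D))"
    using x by (intro sum_mono2) auto
  also have "\<dots> \<le> exp (- D\<^sup>2 / (4 * B)) * (1 + x) ^ Y + exp (- D\<^sup>2 / (4 * B)) * (1 + x) ^ Y"
    unfolding sum.distrib using t by (intro add_mono tl) auto
  finally show ?thesis by (simp add: mult_ac)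
qed

text \<open>The price of enlarging the universe to a multiple of the block size: each of the
  \<open>n\<close> factors grows by at most \<open>exp ((U' - U) / (U - n))\<close>.\<close>

lemma binomial_ratio_le:
  assumes n: "n < U" and U': "U \<le> U'"
  shows "real (U' choose n) \<le> real (U choose n) * exp (real n * real (U' - U) / real (U - n))"
  using n
proof (induction n)
  case 0
  then show ?case by simp
next
  case (Suc n)
  define t where "t = real (U' - U) / real (U - Suc n)"
  have t0: "0 \<le> t" by (simp add: t_def)
  have step: "real (V choose Suc n) = real (V choose n) * (real (V - n) / real (Suc n))" for V
  proof -
    have "real (Suc n) * real (V choose Suc n) = real (V - n) * real (V choose n)"
      unfolding of_nat_mult[symmetric] by (simp only: binomial_absorption binomial_absorb_comp)
    then show ?thesis by (simp add: field_simps del: of_nat_Suc)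
  qed
  have "real (U' choose n) \<le> real (U choose n) * exp (real n * real (U' - U) / real (U - n))" using Suc by simp
  also have "\<dots> \<le> real (U choose n) * exp (real n * t)"
  proof -
    have "real (U' - U) / real (U - n) \<le> t" unfolding t_def using Suc.prems by (intro divide_left_mono) auto
    then have "real n * (real (U' - U) / real (U - n)) \<le> real n * t" by (intro mult_left_mono) auto
    then show ?thesis by (intro mult_left_mono) auto
  qed
  finally have A: "real (U' choose n) \<le> real (U choose n) * exp (real n * t)" .
  have B: "real (U' - n) \<le> real (U - n) * exp t"
  proof -
    have "real (U' - n) = real (U - n) + real (U' - U)" using Suc.prems U' by simp
    also have "\<dots> \<le> real (U - n) * (1 + t)"
    proof -
      have "real (U' - U) = real (U - Suc n) * t" using Suc.prems by (simp add: t_def)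
      also have "\<dots> \<le> real (U - n) * t" using t0 by (intro mult_right_mono) auto
      finally show ?thesis by (simp add: distrib_left)
    qed
    also have "\<dots> \<le> real (U - n) * exp t" by (intro mult_left_mono exp_ge_add_one_self) auto
    finally show ?thesis .
  qed
  have "real (U' choose Suc n) = real (U' choose n) * (real (U' - n) / real (Suc n))" by (rule step)
  also have "\<dots> \<le> (real (U choose n) * exp (real n * t)) * ((real (U - n) * exp t) / real (Suc n))"
    using A B by (intro mult_mono divide_right_mono) auto
  also have "\<dots> = real (U choose Suc n) * (exp (real n * t) * exp t)"
    unfolding step by simp
  also have "exp (real n * t) * exp t = exp (real (Suc n) * t)"
    unfolding exp_add[symmetric] by (simp add: algebra_simps)
  finally show ?case by (simp add: t_def)
qed

section \<open>Greedy covering\<close>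

text \<open>Some choice covers at least the average share \<delta> of what is still uncovered, so
  every round shrinks the rest by \<open>1 - \<delta>\<close>.\<close>

lemma weighted_cover:
  fixes wt :: "'a \<Rightarrow> real" and \<delta> :: real
  assumes \<Omega>: "finite \<Omega>" "sum wt \<Omega> = 1" "\<And>\<omega>. \<omega> \<in> \<Omega> \<Longrightarrow> 0 \<le> wt \<omega>" and S: "finite S"
    and \<delta>: "\<delta> \<le> 1"
    and cov: "\<And>s. s \<in> S \<Longrightarrow> \<delta> \<le> (\<Sum>\<omega>\<in>\<Omega>. wt \<omega> * of_bool (c \<omega> s))"
  shows "\<exists>f. (\<forall>i. f i \<in> \<Omega>) \<and> real (card {s \<in> S. \<forall>i<J. \<not> c (f i) s}) \<le> (1 - \<delta>) ^ J * real (card S)"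
proof (induction J)
  case 0
  have "\<Omega> \<noteq> {}" using \<Omega>(2) by auto
  then obtain \<omega> where "\<omega> \<in> \<Omega>" by blast
  then show ?case by (intro exI[of _ "\<lambda>i. \<omega>"]) simp
next
  case (Suc J)
  then obtain f where f: "\<And>i. f i \<in> \<Omega>" "real (card {s \<in> S. \<forall>i<J. \<not> c (f i) s}) \<le> (1 - \<delta>) ^ J * real (card S)" by blast
  define R where "R = {s \<in> S. \<forall>i<J. \<not> c (f i) s}"
  have finR: "finite R" using S by (simp add: R_def)
  have "\<exists>\<omega>\<in>\<Omega>. \<delta> * real (card R) \<le> real (card {s \<in> R. c \<omega> s})"
  proof (rule ccontr)
    assume "\<not> ?thesis"
    then have less: "real (card {s \<in> R. c \<omega> s}) < \<delta> * real (card R)" if "\<omega> \<in> \<Omega>" for \<omega> using that by force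
    have "\<delta> * real (card R) = (\<Sum>s\<in>R. \<delta>)" by simp
    also have "\<dots> \<le> (\<Sum>s\<in>R. \<Sum>\<omega>\<in>\<Omega>. wt \<omega> * of_bool (c \<omega> s))"
      by (intro sum_mono cov) (simp add: R_def)
    also have "\<dots> = (\<Sum>\<omega>\<in>\<Omega>. \<Sum>s\<in>R. wt \<omega> * of_bool (c \<omega> s))" by (rule sum.swap)
    also have "\<dots> = (\<Sum>\<omega>\<in>\<Omega>. wt \<omega> * real (card {s \<in> R. c \<omega> s}))"
      unfolding sum_distrib_left[symmetric] using finR by (simp add: sum_of_bool_eq Int_def)
    finally have le: "\<delta> * real (card R) \<le> (\<Sum>\<omega>\<in>\<Omega>. wt \<omega> * real (card {s \<in> R. c \<omega> s}))" .
    obtain \<omega>0 where w0: "\<omega>0 \<in> \<Omega>" "0 < wt \<omega>0"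
    proof -
      have "\<exists>\<omega>\<in>\<Omega>. wt \<omega> \<noteq> 0" using \<Omega>(2) by (metis sum.neutral zero_neq_one)
      then show ?thesis using that \<Omega>(3) by force
    qed
    have "(\<Sum>\<omega>\<in>\<Omega>. wt \<omega> * real (card {s \<in> R. c \<omega> s})) < (\<Sum>\<omega>\<in>\<Omega>. wt \<omega> * (\<delta> * real (card R)))"
    proof (rule sum_strict_mono_ex1)
      show "\<forall>\<omega>\<in>\<Omega>. wt \<omega> * real (card {s \<in> R. c \<omega> s}) \<le> wt \<omega> * (\<delta> * real (card R))"
        using \<Omega>(3) less by (intro ballI mult_left_mono) (auto intro: less_imp_le)
      show "\<exists>\<omega>\<in>\<Omega>. wt \<omega> * real (card {s \<in> R. c \<omega> s}) < wt \<omega> * (\<delta> * real (card R))"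
        using w0 less[OF w0(1)] by (intro bexI[of _ \<omega>0] mult_strict_left_mono) auto
    qed (rule \<Omega>(1))
    also have "\<dots> = \<delta> * real (card R)" unfolding sum_distrib_right[symmetric] using \<Omega> by simp
    finally show False using le by simp
  qed
  then obtain \<omega> where w: "\<omega> \<in> \<Omega>" "\<delta> * real (card R) \<le> real (card {s \<in> R. c \<omega> s})" by blast
  let ?f = "f(J := \<omega>)"
  have "{s \<in> S. \<forall>i<Suc J. \<not> c (?f i) s} = R - {s \<in> R. c \<omega> s}"
    by (auto simp: R_def less_Suc_eq)
  then have "real (card {s \<in> S. \<forall>i<Suc J. \<not> c (?f i) s}) = real (card R) - real (card {s \<in> R. c \<omega> s})"
    using finR by (simp add: card_Diff_subset of_nat_diff card_mono)
  also have "\<dots> \<le> (1 - \<delta>) * real (card R)" using w(2) by (simp add: algebra_simps)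
  also have "\<dots> \<le> (1 - \<delta>) * ((1 - \<delta>) ^ J * real (card S))"
    using f(2) \<delta> unfolding R_def by (intro mult_left_mono) auto
  finally show ?case using f w by (intro exI[of _ ?f]) (auto simp: mult_ac)
qed

section \<open>Uniformly random permutations\<close>

lemma permutes_image_transitive:
  assumes V: "finite V" and S: "S \<subseteq> V" and T: "T \<subseteq> V" and c: "card S = card T"
  shows "\<exists>\<rho>. \<rho> permutes V \<and> \<rho> ` S = T"
proof -
  have fin: "finite S" "finite T" using S T V finite_subset by auto
  obtain f where f: "bij_betw f S T" using finite_same_card_bij[OF fin c] by blast
  have "card (V - S) = card (V - T)" using S T c fin by (simp add: card_Diff_subset)
  then obtain g where g: "bij_betw g (V - S) (V - T)" using finite_same_card_bij[of "V - S" "V - T"] V by auto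
  define \<rho> where "\<rho> x = (if x \<in> S then f x else if x \<in> V then g x else x)" for x
  have "bij_betw \<rho> S T" using f by (rule bij_betw_cong[THEN iffD1, rotated]) (simp add: \<rho>_def)
  moreover have "bij_betw \<rho> (V - S) (V - T)"
    using g by (rule bij_betw_cong[THEN iffD1, rotated]) (auto simp: \<rho>_def)
  ultimately have "bij_betw \<rho> (S \<union> (V - S)) (T \<union> (V - T))" by (rule bij_betw_combine) auto
  then have "bij_betw \<rho> V V" using S T by (simp add: Un_absorb1)
  then have "\<rho> permutes V" using S by (intro bij_imp_permutes) (auto simp: \<rho>_def)
  moreover have "\<rho> ` S = T" using \<open>bij_betw \<rho> S T\<close> by (simp add: bij_betw_def)
  ultimately show ?thesis by blast
qed

text \<open>A uniform permutation sends \<open>S\<close> to a uniform \<open>n\<close>-set: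
  composing with a permutation that maps \<open>S\<close> to \<open>T\<close> identifies the fibres
  over both, so all fibres have the same size.\<close>

lemma sum_permutes_image:
  fixes F :: "nat set \<Rightarrow> real"
  assumes V: "finite V" and S: "S \<subseteq> V" "card S = n"
  shows "(\<Sum>\<sigma> | \<sigma> permutes V. F (\<sigma> ` S)) * real (card V choose n) =
     fact (card V) * (\<Sum>T | T \<subseteq> V \<and> card T = n. F T)"
proof -
  let ?P = "{\<sigma>. \<sigma> permutes V}"
  let ?K = "{T. T \<subseteq> V \<and> card T = n}"
  define c where "c T = card {\<sigma> \<in> ?P. \<sigma> ` S = T}" for T
  have finP: "finite ?P" by (rule finite_permutations[OF V])
  have finK: "finite ?K" using V by simp
  have im: "(\<lambda>\<sigma>. \<sigma> ` S) ` ?P \<subseteq> ?K"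
  proof clarify
    fix \<sigma> :: "nat \<Rightarrow> nat" assume s: "\<sigma> permutes V"
    have "\<sigma> ` S \<subseteq> V" using permutes_image[OF s] S by auto
    moreover have "card (\<sigma> ` S) = n" using permutes_inj[OF s] S by (simp add: card_image inj_on_subset)
    ultimately show "\<sigma> ` S \<subseteq> V \<and> card (\<sigma> ` S) = n" by simp
  qed
  have const: "c T = c S" if T: "T \<in> ?K" for T
  proof -
    obtain \<rho> where r: "\<rho> permutes V" "\<rho> ` S = T" using permutes_image_transitive[OF V, of S T] S T by auto
    have "bij_betw (\<lambda>\<sigma>. \<rho> \<circ> \<sigma>) {\<sigma> \<in> ?P. \<sigma> ` S = S} {\<sigma> \<in> ?P. \<sigma> ` S = T}"
    proof (rule bij_betwI[where g = "\<lambda>\<sigma>. inv \<rho> \<circ> \<sigma>"])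
      have inj: "inj \<rho>" using permutes_inj[OF r(1)] .
      show "(\<lambda>\<sigma>. \<rho> \<circ> \<sigma>) \<in> {\<sigma> \<in> ?P. \<sigma> ` S = S} \<rightarrow> {\<sigma> \<in> ?P. \<sigma> ` S = T}"
        using r by (auto simp: permutes_compose simp flip: image_image)
      have "inv \<rho> ` T = S" unfolding r(2)[symmetric] using inj by (simp add: image_image)
      then have "(inv \<rho> \<circ> \<sigma>) permutes V \<and> (inv \<rho> \<circ> \<sigma>) ` S = S" if "\<sigma> permutes V" "\<sigma> ` S = T" for \<sigma>
        using permutes_compose[OF that(1) permutes_inv[OF r(1)]] that(2) by (simp only: image_comp[symmetric])
      then show "(\<lambda>\<sigma>. inv \<rho> \<circ> \<sigma>) \<in> {\<sigma> \<in> ?P. \<sigma> ` S = T} \<rightarrow> {\<sigma> \<in> ?P. \<sigma> ` S = S}"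
        by (intro funcsetI) simp
      show "inv \<rho> \<circ> (\<rho> \<circ> \<sigma>) = \<sigma>" for \<sigma> using inj by (simp add: fun_eq_iff)
      show "\<rho> \<circ> (inv \<rho> \<circ> \<sigma>) = \<sigma>" for \<sigma>
        using permutes_inverses(1)[OF r(1)] by (simp add: fun_eq_iff)
    qed
    then show ?thesis unfolding c_def by (simp add: bij_betw_same_card)
  qed
  have gr: "(\<Sum>\<sigma>\<in>?P. G (\<sigma> ` S)) = real (c S) * (\<Sum>T\<in>?K. G T)" for G :: "nat set \<Rightarrow> real"
  proof -
    have "(\<Sum>\<sigma>\<in>?P. G (\<sigma> ` S)) = (\<Sum>T\<in>?K. \<Sum>\<sigma> | \<sigma> \<in> ?P \<and> \<sigma> ` S = T. G (\<sigma> ` S))"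
      by (rule sum.group[symmetric, OF finP finK im])
    also have "\<dots> = (\<Sum>T\<in>?K. real (c T) * G T)" by (rule sum.cong) (auto simp: c_def)
    also have "\<dots> = (\<Sum>T\<in>?K. real (c S) * G T)" using const by simp
    finally show ?thesis by (simp add: sum_distrib_left)
  qed
  have "fact (card V) = real (c S) * real (card V choose n)"
    using gr[of "\<lambda>_. 1"] card_permutations[OF refl V] n_subsets[OF V, of n] by simp
  then show ?thesis using gr[of F] by simp
qed

subsection \<open>Blocks sharing one constraint memory\<close>

text \<open>The cost of a set with \<open>s\<close> keys is
  \<open>log 2 \<Lambda> + s * log 2 (1 / x)\<close>. \<open>M_range\<close> gives every payload
  \<open>b * E\<close> bits in a fixed place and at most \<open>E\<close> further bits;
  \<open>words\<close> demands that the shared memory hold what the fixed parts do not, in total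
  over all blocks and without slack. \<open>N4\<close> and \<open>classes\<close> feed the two
  halves of the second moment budget, and \<open>few_bad\<close> leaves at least half of the key
  sets representable.\<close>

locale block_array =
  fixes b t Y m n N E :: nat and x \<Lambda> :: real
    and Gd :: "nat set \<Rightarrow> bool" and T :: "(nat \<times> nat) set" and M :: "nat \<times> nat \<Rightarrow> nat"
    and de :: "nat set \<Rightarrow> nat \<times> nat" and qr :: "nat \<times> nat \<Rightarrow> nat \<Rightarrow> nat set \<Rightarrow> bool"
  assumes scheme: "desc_scheme b t Y Gd T M fst de qr"
    and pos: "0 < b" "0 < Y" "0 < N" "0 < E" "0 < \<Lambda>"
    and n: "0 < n" "n < m * Y" and x_def: "x = real n / real (m * Y - n)"
    and kraft: "(\<Sum>c\<in>T. 2 ^ M c * x ^ fst c) \<le> \<Lambda>"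
    and M_range: "\<And>c. c \<in> T \<Longrightarrow> b * E \<le> M c" "\<And>c. c \<in> T \<Longrightarrow> M c \<le> b * E + E"
    and N4: "real N ^ 4 \<le> 2 ^ b"
    and words: "real m * log 2 \<Lambda> + real n * log 2 (1 / x) - real m * real (b * E) \<le> real b * real N"
    and classes: "6 * real m * real (card T) \<le> real b * real N"
    and \<Lambda>_le: "\<Lambda> ^ m \<le> 3 * (1 + x) ^ (m * Y)"
    and few_bad: "2 * card {X. X \<subseteq> {..<m * Y} \<and> card X = n \<and> \<not> (\<forall>i<m. Gd (part Y i X))} \<le> m * Y choose n"
begin

definition p :: "nat \<times> nat \<Rightarrow> real" where "p c = 2 ^ M c * x ^ fst c / \<Lambda>"

text \<open>Item \<open>(i, 0)\<close> names the class of block \<open>i\<close>; the label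
  \<open>None\<close> receives the mass that \<open>p\<close> lacks. Item \<open>(i, Suc e)\<close>
  is a fair bit, with \<open>Some (0, 0)\<close> standing for 1 and \<open>None\<close> for
  0.\<close>

definition law :: "nat \<times> nat \<Rightarrow> (nat \<times> nat) option \<Rightarrow> real" where
  "law i l = (if snd i = 0 then (case l of None \<Rightarrow> 1 - sum p T | Some c \<Rightarrow> if c \<in> T then p c else 0)
     else if l = None \<or> l = Some (0, 0) then 1/2 else 0)"

definition items :: "(nat \<times> nat) set" where "items = {..<m} \<times> {..E}"

definition Lab :: "(nat \<times> nat) option set" where "Lab = insert None (Some ` insert (0, 0) T)"

abbreviation "words_set \<equiv> Pow {..<b}"

abbreviation "mems \<equiv> PiE {..<N} (\<lambda>_. words_set)"

definition cls :: "nat set \<Rightarrow> nat \<Rightarrow> nat \<times> nat" where "cls X i = de (part Y i X)"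

definition extra :: "nat \<times> nat \<Rightarrow> nat" where "extra c = M c - b * E"

definition good :: "nat set \<Rightarrow> bool" where "good X \<longleftrightarrow> (\<forall>i<m. Gd (part Y i X))"

definition active :: "nat set \<Rightarrow> (nat \<times> nat) set" where
  "active X = Sigma {..<m} (\<lambda>i. {..extra (cls X i)})"

definition payload :: "nat set \<Rightarrow> nat set" where
  "payload A = (SOME P. \<forall>f. (\<forall>a < M (de A). a \<in> f \<longleftrightarrow> a \<in> P) \<longrightarrow> (\<forall>y<Y. qr (de A) y f \<longleftrightarrow> y \<in> A))"

text \<open>The extra bits are those at multiples of \<open>b + 1\<close>, in accordance with the
  memory layout below.\<close>

definition val :: "nat set \<Rightarrow> nat \<times> nat \<Rightarrow> (nat \<times> nat) option" where
  "val X i = (case snd i of 0 \<Rightarrow> Some (cls X (fst i))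
     | Suc e \<Rightarrow> if e * (b + 1) \<in> payload (part Y (fst i) X) then Some (0, 0) else None)"

definition sat where
  "sat X \<omega> mem \<longleftrightarrow> (\<forall>i\<in>active X. loc_eval (\<omega> i) mem = val X i)"

lemma finT: "finite T" using scheme by (simp add: desc_scheme_def)

lemma x_pos: "0 < x"
proof -
  have "0 < real (m * Y - n)" using n by (simp only: of_nat_0_less_iff zero_less_diff)
  then show ?thesis unfolding x_def using n by (intro divide_pos_pos) auto
qed

lemma p_pos: "0 < p c" unfolding p_def using x_pos pos by simp

lemma sum_p: "sum p T \<le> 1"
  unfolding p_def sum_divide_distrib[symmetric] using kraft pos by simp

lemma p_le_1: "c \<in> T \<Longrightarrow> p c \<le> 1"
  using member_le_sum[of c T p] finT sum_p p_pos by (meson less_imp_le order_trans)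

lemma cls_in: "good X \<Longrightarrow> i < m \<Longrightarrow> cls X i \<in> T"
  and fst_cls: "good X \<Longrightarrow> i < m \<Longrightarrow> fst (cls X i) = card (part Y i X)"
  using scheme part_subset unfolding good_def cls_def desc_scheme_def by blast+

lemma payload:
  assumes "A \<subseteq> {..<Y}" "Gd A" "\<And>a. a < M (de A) \<Longrightarrow> a \<in> f \<longleftrightarrow> a \<in> payload A" "y < Y"
  shows "qr (de A) y f \<longleftrightarrow> y \<in> A"
proof -
  have "\<exists>P. \<forall>f. (\<forall>a < M (de A). a \<in> f \<longleftrightarrow> a \<in> P) \<longrightarrow> (\<forall>y<Y. qr (de A) y f \<longleftrightarrow> y \<in> A)"
    using scheme assms(1,2) unfolding desc_scheme_def by blast
  from someI_ex[OF this] show ?thesis using assms(3,4) unfolding payload_def[symmetric] by blast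
qed

lemma law_nonneg: "0 \<le> law i l"
  using sum_p p_pos by (auto simp: law_def less_imp_le split: option.split)

lemma sum_law: "sum (law i) Lab = 1"
proof -
  have "sum (law i) Lab = law i None + (\<Sum>c\<in>insert (0, 0) T. law i (Some c))"
  proof -
    have "sum (law i) (Some ` insert (0, 0) T) = (\<Sum>c\<in>insert (0, 0) T. law i (Some c))"
      by (subst sum.reindex) (auto simp: comp_def)
    then show ?thesis unfolding Lab_def using finT by (subst sum.insert) auto
  qed
  also have "\<dots> = 1"
  proof (cases "snd i = 0")
    case True
    have "(\<Sum>c\<in>insert (0, 0) T. law i (Some c)) = (\<Sum>c\<in>T. law i (Some c))"
      by (rule sum.mono_neutral_right) (use finT True in \<open>auto simp: law_def\<close>)
    then show ?thesis using True by (simp add: law_def)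
  next
    case False
    have "(\<Sum>c\<in>insert (0, 0) T. law i (Some c)) = (\<Sum>c\<in>{(0, 0)}. law i (Some c))"
      by (rule sum.mono_neutral_right) (use finT False in \<open>auto simp: law_def\<close>)
    then show ?thesis using False by (simp add: law_def)
  qed
  finally show ?thesis .
qed

section \<open>Averaging the second moment over key sets\<close>

text \<open>The second moment ratio for the key set \<open>X\<close>; its reciprocal bounds the
  success probability from below.\<close>

definition ratio :: "nat set \<Rightarrow> real" where
  "ratio X = (\<Sum>j\<le>N. real (N choose j) / (2 ^ b) ^ j *
            (\<Prod>i\<in>active X. 1 + (real j / real N) ^ 4 * (1 / law i (val X i) - 1)))"

abbreviation "systems \<equiv> csp_systems items N words_set Lab"
abbreviation "wt \<equiv> csp_wt items N words_set law"

lemma extra_le: "c \<in> T \<Longrightarrow> extra c \<le> E"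
  using M_range by (fastforce simp: extra_def)

lemma law_class: "good X \<Longrightarrow> i < m \<Longrightarrow> law (i, 0) (val X (i, 0)) = p (cls X i)"
  using cls_in by (simp add: law_def val_def)

lemma law_bit: "law (i, Suc e) (val X (i, Suc e)) = 1/2"
  by (simp add: law_def val_def)

lemma sat_weight:
  assumes X: "good X"
  shows "1 / ratio X \<le> (\<Sum>\<omega>\<in>systems. wt \<omega> * of_bool (\<exists>mem\<in>mems. sat X \<omega> mem))"
proof -
  have "1 / (\<Sum>j\<le>N. real (N choose j) / real (card words_set) ^ j *
            (\<Prod>i\<in>active X. 1 + (real j / real N) ^ 4 * (1 / law i (val X i) - 1)))
     \<le> (\<Sum>\<omega>\<in>systems. wt \<omega> * of_bool (\<exists>m\<in>mems. \<forall>i\<in>active X. loc_eval (\<omega> i) m = val X i))"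
  proof (rule csp_sat_weight)
    show "finite items" by (simp add: items_def)
    show "finite Lab" using finT by (simp add: Lab_def)
    show "active X \<subseteq> items"
      using extra_le[OF cls_in[OF X]] by (fastforce simp: active_def items_def)
    fix i assume "i \<in> active X"
    then obtain a e where i: "i = (a, e)" "a < m" by (auto simp: active_def)
    show "val X i \<in> Lab"
      using cls_in[OF X i(2)] i by (cases e) (auto simp: val_def Lab_def)
    show "0 < law i (val X i)"
      using law_class[OF X i(2)] law_bit[of a _ X] p_pos[of "cls X a"] i by (cases e) (simp, metis half_gt_zero_iff zero_less_one)
  qed (use pos sum_law law_nonneg in auto)
  then show ?thesis unfolding ratio_def sat_def by (simp add: card_Pow)
qed

lemma prod_active:
  assumes X: "good X"
  shows "(\<Prod>i\<in>active X. 1 + g * (1 / law i (val X i) - 1)) =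
     (\<Prod>i<m. (1 + g * (1 / p (cls X i) - 1)) * (1 + g) ^ extra (cls X i))"
proof -
  have "(\<Prod>i\<in>active X. 1 + g * (1 / law i (val X i) - 1)) =
      (\<Prod>i<m. \<Prod>e\<le>extra (cls X i). 1 + g * (1 / law (i, e) (val X (i, e)) - 1))"
    unfolding active_def by (subst prod.Sigma) (auto intro!: prod.cong)
  also have "\<dots> = (\<Prod>i<m. (1 + g * (1 / p (cls X i) - 1)) * (1 + g) ^ extra (cls X i))"
  proof (rule prod.cong[OF refl])
    fix i assume i: "i \<in> {..<m}"
    have "(\<Prod>e\<le>extra (cls X i). 1 + g * (1 / law (i, e) (val X (i, e)) - 1)) =
        (1 + g * (1 / law (i, 0) (val X (i, 0)) - 1)) * (\<Prod>e<extra (cls X i). 1 + g * (1 / law (i, Suc e) (val X (i, Suc e)) - 1))"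
      by (rule prod.atMost_shift)
    then show "(\<Prod>e\<le>extra (cls X i). 1 + g * (1 / law (i, e) (val X (i, e)) - 1)) =
        (1 + g * (1 / p (cls X i) - 1)) * (1 + g) ^ extra (cls X i)"
      using law_class[OF X, of i] i by (simp add: law_bit)
  qed
  finally show ?thesis .
qed

definition \<kappa> :: real where
  "\<kappa> = real m * log 2 \<Lambda> + real n * log 2 (1 / x) - real m * real (b * E)"

text \<open>The memory needed for the items of all blocks is the same for every key set.\<close>

lemma sum_extra:
  assumes X: "good X" "X \<subseteq> {..<m * Y}" "card X = n"
  shows "real (\<Sum>i<m. extra (cls X i)) = \<kappa> + (\<Sum>i<m. log 2 (p (cls X i)))"
proof -
  have "real (extra (cls X i)) = log 2 (p (cls X i)) + log 2 \<Lambda> + real (card (part Y i X)) * log 2 (1 / x) - real (b * E)"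
    if i: "i < m" for i
  proof -
    have c: "cls X i \<in> T" "fst (cls X i) = card (part Y i X)" using cls_in fst_cls X i by auto
    have "log 2 (p (cls X i)) = log 2 (2 ^ M (cls X i) * x ^ card (part Y i X)) - log 2 \<Lambda>"
      unfolding p_def c(2) using x_pos pos by (simp add: log_divide)
    also have "log 2 (2 ^ M (cls X i) * x ^ card (part Y i X)) = real (M (cls X i)) + real (card (part Y i X)) * log 2 x"
      using x_pos by (simp add: log_mult log_nat_power)
    finally show ?thesis
      using M_range(1)[OF c(1)] x_pos by (simp add: extra_def of_nat_diff log_divide)
  qed
  then have "real (\<Sum>i<m. extra (cls X i)) = (\<Sum>i<m. log 2 (p (cls X i)) + log 2 \<Lambda> + real (card (part Y i X)) * log 2 (1 / x) - real (b * E))"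
    by simp
  also have "\<dots> = (\<Sum>i<m. log 2 (p (cls X i))) + real m * log 2 \<Lambda> + real (\<Sum>i<m. card (part Y i X)) * log 2 (1 / x) - real m * real (b * E)"
    by (simp add: sum.distrib sum_subtractf sum_distrib_right)
  also have "(\<Sum>i<m. card (part Y i X)) = n" using card_parts[OF pos(2) X(2)] X(3) by simp
  finally show ?thesis by (simp add: \<kappa>_def)
qed

text \<open>Since the total demand is constant, the number of extra bits can be traded for
  \<open>\<kappa>\<close> and the class probabilities: \<open>2 powr (g^2 * extra)\<close> turns
  into \<open>p powr g^2\<close>. What remains is a product over blocks that can be averaged block
  by block.\<close>

lemma prod_active_le:
  assumes X: "good X" "X \<subseteq> {..<m * Y}" "card X = n" and g: "0 \<le> g" "g \<le> 1"
  shows "(\<Prod>i\<in>active X. 1 + g ^ 4 * (1 / law i (val X i) - 1)) \<le>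
     2 powr (g\<^sup>2 * \<kappa>) * (\<Prod>i<m. p (cls X i) powr g\<^sup>2 * (1 + g ^ 4 * (1 / p (cls X i) - 1)))"
proof -
  let ?q = "\<lambda>i. 1 + g ^ 4 * (1 / p (cls X i) - 1)"
  have q0: "0 \<le> ?q i" if "i < m" for i
  proof -
    have "1 \<le> 1 / p (cls X i)" using p_pos p_le_1[OF cls_in[OF X(1) that]] by simp
    then show ?thesis using g by (intro add_nonneg_nonneg mult_nonneg_nonneg) auto
  qed
  have "1 + g ^ 4 \<le> 2 powr g\<^sup>2"
    using one_plus_sq_le_powr[of "g\<^sup>2"] g by (simp add: power_le_one)
  then have pw: "(1 + g ^ 4) ^ k \<le> 2 powr (g\<^sup>2 * real k)" for k
    using power_mono[of "1 + g ^ 4" "2 powr g\<^sup>2" k] by (simp add: powr_powr flip: powr_realpow)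
  have "(\<Prod>i\<in>active X. 1 + g ^ 4 * (1 / law i (val X i) - 1)) = (\<Prod>i<m. ?q i * (1 + g ^ 4) ^ extra (cls X i))"
    by (rule prod_active[OF X(1)])
  also have "\<dots> \<le> (\<Prod>i<m. ?q i * 2 powr (g\<^sup>2 * real (extra (cls X i))))"
    using q0 pw by (intro prod_mono conjI mult_left_mono mult_nonneg_nonneg) auto
  also have "\<dots> = (\<Prod>i<m. ?q i) * 2 powr (\<Sum>i<m. g\<^sup>2 * real (extra (cls X i)))"
    by (simp add: prod.distrib powr_sum)
  also have "(\<Sum>i<m. g\<^sup>2 * real (extra (cls X i))) = g\<^sup>2 * \<kappa> + (\<Sum>i<m. log 2 (p (cls X i)) * g\<^sup>2)"
    using sum_extra[OF X] unfolding sum_distrib_left[symmetric] sum_distrib_right[symmetric] by (simp add: algebra_simps)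
  also have "2 powr (g\<^sup>2 * \<kappa> + (\<Sum>i<m. log 2 (p (cls X i)) * g\<^sup>2)) = 2 powr (g\<^sup>2 * \<kappa>) * (\<Prod>i<m. p (cls X i) powr g\<^sup>2)"
  proof -
    have "2 powr (log 2 (p c) * g\<^sup>2) = p c powr g\<^sup>2" for c
      using p_pos[of c] by (simp add: powr_powr[symmetric])
    then show ?thesis by (simp add: powr_add powr_sum)
  qed
  finally show ?thesis by (simp add: prod.distrib mult_ac)
qed

text \<open>Each term equals \<open>(1 - g^4) * p powr (1 + g^2) + g^4 * p powr g^2\<close>. Young's
  inequality for the second summand leaves an excess of \<open>g^4 * (1 - g^2)\<close> per class,
  which vanishes at \<open>g = 1\<close> as the second moment budget requires.\<close>

lemma sum_class_weights:
  assumes g: "0 \<le> g" "g \<le> 1"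
  shows "(\<Sum>c\<in>T. p c * (p c powr g\<^sup>2 * (1 + g ^ 4 * (1 / p c - 1)))) \<le> 1 + g ^ 4 * (1 - g\<^sup>2) * real (card T)"
proof -
  have g4: "0 \<le> 1 - g ^ 4" and g2: "g\<^sup>2 \<le> 1" "0 \<le> g\<^sup>2" using g by (auto simp: power_le_one)
  have "(\<Sum>c\<in>T. p c * (p c powr g\<^sup>2 * (1 + g ^ 4 * (1 / p c - 1)))) \<le>
      (\<Sum>c\<in>T. (1 - g ^ 4) * p c + g ^ 4 * (g\<^sup>2 * p c + (1 - g\<^sup>2)))"
  proof (rule sum_mono)
    fix c assume c: "c \<in> T"
    let ?u = "p c powr g\<^sup>2"
    have u1: "?u \<le> 1" using p_pos[of c] p_le_1[OF c] g2 by (simp add: powr_le1)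
    have u2: "?u \<le> g\<^sup>2 * p c + (1 - g\<^sup>2)" using powr_le_affine[OF p_pos g2(2,1)] .
    have "p c * (?u * (1 + g ^ 4 * (1 / p c - 1))) = (1 - g ^ 4) * (p c * ?u) + g ^ 4 * ?u"
      using p_pos[of c] by (simp add: field_simps)
    also have "\<dots> \<le> (1 - g ^ 4) * p c + g ^ 4 * (g\<^sup>2 * p c + (1 - g\<^sup>2))"
      using u1 u2 g4 p_pos[of c] g by (intro add_mono mult_left_mono) (auto simp: mult_left_le)
    finally show "p c * (?u * (1 + g ^ 4 * (1 / p c - 1))) \<le> (1 - g ^ 4) * p c + g ^ 4 * (g\<^sup>2 * p c + (1 - g\<^sup>2))" .
  qed
  also have "\<dots> = (1 - g ^ 4 + g ^ 4 * g\<^sup>2) * sum p T + g ^ 4 * (1 - g\<^sup>2) * real (card T)"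
  proof -
    have "(1 - g ^ 4) * p c + g ^ 4 * (g\<^sup>2 * p c + (1 - g\<^sup>2)) =
        (1 - g ^ 4 + g ^ 4 * g\<^sup>2) * p c + g ^ 4 * (1 - g\<^sup>2)" for c by (simp add: algebra_simps)
    then show ?thesis by (simp only: sum.distrib sum_distrib_left[symmetric] sum_constant) simp
  qed
  also have "(1 - g ^ 4 + g ^ 4 * g\<^sup>2) * sum p T \<le> 1 * 1"
  proof (rule mult_mono)
    show "1 - g ^ 4 + g ^ 4 * g\<^sup>2 \<le> 1"
      using mult_left_mono[OF g2(1), of "g ^ 4"] g by simp
    show "0 \<le> sum p T" by (intro sum_nonneg less_imp_le p_pos)
  qed (use sum_p in auto)
  finally show ?thesis by simp
qed

abbreviation "nsets \<equiv> {X. X \<subseteq> {..<m * Y} \<and> card X = n}"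

text \<open>Extending the sum from \<open>n\<close>-sets to all sets with weight
  \<open>x ^ card X\<close> makes it factor over the blocks, and the second moment budget bounds the
  contribution of each of the \<open>N + 1\<close> overlaps. The factor \<open>m * Y + 1\<close> is
  the price of returning to \<open>n\<close>-sets.\<close>

lemma sum_ratio:
  "(\<Sum>X | X \<in> nsets \<and> good X. ratio X) \<le> 3 * real (m * Y + 1) * real (N + 1) * real (m * Y choose n)"
proof -
  let ?G = "{X. X \<in> nsets \<and> good X}"
  have fin: "finite (Pow {..<m * Y})" by simp
  have finG: "finite ?G" by (rule finite_subset[of _ "Pow {..<m * Y}"]) auto
  define Zc where "Zc = \<Lambda> ^ m / x ^ n"
  have Zc0: "0 \<le> Zc" using pos x_pos by (simp add: Zc_def)
  have inner: "(\<Sum>X\<in>?G. \<Prod>i\<in>active X. 1 + g ^ 4 * (1 / law i (val X i) - 1)) \<le>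
      Zc * (2 powr (g\<^sup>2 * \<kappa>) * (1 + g ^ 4 * (1 - g\<^sup>2) * real (card T)) ^ m)" if g: "0 \<le> g" "g \<le> 1" for g
  proof -
    define y where "y c = p c powr g\<^sup>2 * (1 + g ^ 4 * (1 / p c - 1))" for c
    have y0: "0 \<le> y c" if "c \<in> T" for c
    proof -
      have "1 \<le> 1 / p c" using p_pos p_le_1[OF that] by simp
      then show ?thesis unfolding y_def using g by (intro mult_nonneg_nonneg add_nonneg_nonneg) auto
    qed
    have "(\<Sum>X\<in>?G. \<Prod>i\<in>active X. 1 + g ^ 4 * (1 / law i (val X i) - 1)) \<le>
        (\<Sum>X\<in>?G. 2 powr (g\<^sup>2 * \<kappa>) * (\<Prod>i<m. y (cls X i)))"
      unfolding y_def by (intro sum_mono prod_active_le g) auto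
    also have "\<dots> = 2 powr (g\<^sup>2 * \<kappa>) / x ^ n * (\<Sum>X\<in>?G. x ^ card X * (\<Prod>i<m. y (cls X i)))"
      unfolding sum_distrib_left using x_pos by (intro sum.cong) auto
    also have "(\<Sum>X\<in>?G. x ^ card X * (\<Prod>i<m. y (cls X i))) \<le>
        (\<Sum>X | X \<subseteq> {..<m * Y} \<and> good X. x ^ card X * (\<Prod>i<m. y (cls X i)))"
      using x_pos by (intro sum_mono2) (auto intro!: mult_nonneg_nonneg prod_nonneg y0[OF cls_in])
    also have "\<dots> = (\<Sum>X\<in>Pow {..<m * Y}. x ^ card X * (\<Prod>i<m. of_bool (Gd (part Y i X)) * y (de (part Y i X))))"
    proof (rule sum.mono_neutral_cong_left[OF fin])
      show "\<forall>X\<in>Pow {..<m * Y} - {X. X \<subseteq> {..<m * Y} \<and> good X}.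
          x ^ card X * (\<Prod>i<m. of_bool (Gd (part Y i X)) * y (de (part Y i X))) = 0"
        by (auto simp: good_def)
    qed (auto simp: good_def cls_def intro!: prod.cong)
    also have "\<dots> = (\<Prod>i<m. \<Sum>A\<in>Pow {..<Y}. x ^ card A * (of_bool (Gd A) * y (de A)))"
      by (rule sum_Pow_prod_parts[OF pos(2)])
    also have "\<dots> = (\<Sum>A | A \<subseteq> {..<Y} \<and> Gd A. x ^ card A * y (de A)) ^ m"
    proof -
      have "(\<Sum>A\<in>Pow {..<Y}. x ^ card A * (of_bool (Gd A) * y (de A))) = (\<Sum>A | A \<subseteq> {..<Y} \<and> Gd A. x ^ card A * y (de A))"
        by (rule sum.mono_neutral_cong_right) auto
      then show ?thesis by simp
    qed
    also have "\<dots> \<le> (\<Lambda> * (1 + g ^ 4 * (1 - g\<^sup>2) * real (card T))) ^ m"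
    proof (rule power_mono)
      have "(\<Sum>A | A \<subseteq> {..<Y} \<and> Gd A. x ^ card A * y (de A)) \<le> (\<Sum>c\<in>T. 2 ^ M c * x ^ fst c * y c)"
        by (rule desc_scheme_sum_le[OF scheme]) (use x_pos y0 in auto)
      also have "\<dots> = \<Lambda> * (\<Sum>c\<in>T. p c * y c)"
        unfolding sum_distrib_left p_def using pos by (intro sum.cong) auto
      also have "\<dots> \<le> \<Lambda> * (1 + g ^ 4 * (1 - g\<^sup>2) * real (card T))"
        using sum_class_weights[OF g] pos unfolding y_def by (intro mult_left_mono) auto
      finally show "(\<Sum>A | A \<subseteq> {..<Y} \<and> Gd A. x ^ card A * y (de A)) \<le> \<Lambda> * (1 + g ^ 4 * (1 - g\<^sup>2) * real (card T))" .
      show "0 \<le> (\<Sum>A | A \<subseteq> {..<Y} \<and> Gd A. x ^ card A * y (de A))"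
      proof (intro sum_nonneg mult_nonneg_nonneg y0)
        fix A assume "A \<in> {A. A \<subseteq> {..<Y} \<and> Gd A}"
        then show "de A \<in> T" using scheme unfolding desc_scheme_def by blast
      qed (use x_pos in auto)
    qed
    finally show ?thesis using x_pos by (simp add: Zc_def power_mult_distrib divide_simps mult_ac)
  qed
  have "(\<Sum>X\<in>?G. ratio X) = (\<Sum>j\<le>N. real (N choose j) / (2 ^ b) ^ j *
            (\<Sum>X\<in>?G. \<Prod>i\<in>active X. 1 + (real j / real N) ^ 4 * (1 / law i (val X i) - 1)))"
    unfolding ratio_def sum_distrib_left by (rule sum.swap)
  also have "\<dots> \<le> (\<Sum>j\<le>N. Zc)"
  proof (rule sum_mono)
    fix j assume j: "j \<in> {..N}"
    let ?g = "real j / real N"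
    have g: "0 \<le> ?g" "?g \<le> 1" using j pos by auto
    have "real (N choose j) / (2 ^ b) ^ j * (\<Sum>X\<in>?G. \<Prod>i\<in>active X. 1 + ?g ^ 4 * (1 / law i (val X i) - 1)) \<le>
        real (N choose j) / (2 ^ b) ^ j * (Zc * (2 powr (?g\<^sup>2 * \<kappa>) * (1 + ?g ^ 4 * (1 - ?g\<^sup>2) * real (card T)) ^ m))"
      by (intro mult_left_mono inner g) auto
    also have "\<dots> = Zc * (real (N choose j) / (2 ^ b) ^ j * (2 powr (?g\<^sup>2 * \<kappa>) * (1 + ?g ^ 4 * (1 - ?g\<^sup>2) * real (card T)) ^ m))"
      by simp
    also have "\<dots> \<le> Zc * 1"
      using csp_term_le_1[of N j b \<kappa> "real (card T)" m] pos j N4 words classes Zc0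
      by (intro mult_left_mono) (auto simp: \<kappa>_def)
    finally show "real (N choose j) / (2 ^ b) ^ j * (\<Sum>X\<in>?G. \<Prod>i\<in>active X. 1 + ?g ^ 4 * (1 / law i (val X i) - 1)) \<le> Zc"
      by simp
  qed
  also have "\<dots> = real (N + 1) * Zc" by simp
  also have "Zc \<le> 3 * (real (m * Y + 1) * real (m * Y choose n))"
  proof -
    have "\<Lambda> ^ m \<le> 3 * (1 + x) ^ (m * Y)" by (rule \<Lambda>_le)
    also have "\<dots> \<le> 3 * (real (m * Y + 1) * (real (m * Y choose n) * x ^ n))"
      using binomial_max_term[OF n x_def] by simp
    finally show ?thesis unfolding Zc_def using x_pos by (simp add: divide_simps mult_ac)
  qed
  also have "real (N + 1) * (3 * (real (m * Y + 1) * real (m * Y choose n))) =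
      3 * real (m * Y + 1) * real (N + 1) * real (m * Y choose n)" by (simp only: mult_ac)
  finally show ?thesis by simp
qed

section \<open>From the average ratio to a covering of all key sets\<close>

text \<open>With \<open>Q\<close> the product in the denominator, this is three quarters of
  \<open>1 / (12 * Q)\<close>: the tangent estimate below yields \<open>1 / (12 * Q)\<close> and
  loses a quarter of it.\<close>

definition \<delta> :: real where "\<delta> = 1 / (16 * (real (m * Y + 1) * real (N + 1)))"

lemma ratio_pos: "good X \<Longrightarrow> 0 < ratio X"
proof -
  assume X: "good X"
  have nn: "0 \<le> (\<Prod>i\<in>active X. 1 + g ^ 4 * (1 / law i (val X i) - 1))" if "0 \<le> g" for g :: real
    unfolding prod_active[OF X]
  proof (intro prod_nonneg mult_nonneg_nonneg)
    fix i assume "i \<in> {..<m}"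
    then have "1 \<le> 1 / p (cls X i)" using p_pos p_le_1[OF cls_in[OF X]] by simp
    then show "0 \<le> 1 + g ^ 4 * (1 / p (cls X i) - 1)" using that by (intro add_nonneg_nonneg mult_nonneg_nonneg) auto
  qed (use that in auto)
  have "(0::real) < (\<Sum>j\<in>{0}. real (N choose j) / (2 ^ b) ^ j *
            (\<Prod>i\<in>active X. 1 + (real j / real N) ^ 4 * (1 / law i (val X i) - 1)))" by simp
  also have "\<dots> \<le> ratio X"
    unfolding ratio_def using nn by (intro sum_mono2) (auto intro!: mult_nonneg_nonneg)
  finally show ?thesis .
qed

text \<open>The permutation turns the fixed \<open>S\<close> into a uniform \<open>n\<close>-set, so
  the average bound on \<open>ratio\<close> applies to every \<open>S\<close>.\<close>

lemma success_weight:
  assumes S: "S \<subseteq> {..<m * Y}" "card S = n"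
  shows "\<delta> \<le> (\<Sum>\<sigma>\<in>{\<sigma>. \<sigma> permutes {..<m * Y}} \<times> systems. wt (snd \<sigma>) / fact (m * Y) *
     of_bool (good (fst \<sigma> ` S) \<and> (\<exists>mem\<in>mems. sat (fst \<sigma> ` S) (snd \<sigma>) mem)))"
proof -
  let ?U = "m * Y"
  define H where "H X = (\<Sum>\<omega>\<in>systems. wt \<omega> * of_bool (good X \<and> (\<exists>mem\<in>mems. sat X \<omega> mem)))" for X
  define C where "C = real (?U choose n)"
  define a where "a = 12 * (real (?U + 1) * real (N + 1))"
  have C: "0 < C" unfolding C_def using n by (simp add: zero_less_binomial)
  have a: "0 < a" unfolding a_def by (simp del: of_nat_add of_nat_mult)
  have wt0: "0 \<le> wt \<omega>" for \<omega> unfolding csp_wt_def by (intro prod_nonneg) (auto intro: loc_wt_nonneg law_nonneg)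
  have fin: "finite nsets" by (rule finite_subset[of _ "Pow {..<?U}"]) auto
  have H0: "0 \<le> H X" for X unfolding H_def using wt0 by (intro sum_nonneg) auto
  have Hg: "1 / ratio X \<le> H X" if "good X" for X
    using sat_weight[OF that] that unfolding H_def by simp
  have cardg: "C / 2 \<le> real (card {X. X \<in> nsets \<and> good X})"
  proof -
    let ?B = "{X. X \<subseteq> {..<?U} \<and> card X = n \<and> \<not> (\<forall>i<m. Gd (part Y i X))}"
    have "nsets = {X. X \<in> nsets \<and> good X} \<union> ?B" by (auto simp: good_def)
    then have "card nsets \<le> card {X. X \<in> nsets \<and> good X} + card ?B" 
      using card_Un_le[of "{X. X \<in> nsets \<and> good X}" ?B] by (rule ord_eq_le_trans[OF arg_cong[where f = card]])
    moreover have "card nsets = ?U choose n" using n_subsets[of "{..<?U}" n] by simp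
    ultimately have "real (?U choose n) \<le> real (card {X. X \<in> nsets \<and> good X}) + real (card ?B)" by linarith
    moreover have "2 * real (card ?B) \<le> real (?U choose n)" using few_bad by linarith
    ultimately show ?thesis unfolding C_def by linarith
  qed
  \<comment> \<open>The convex function \<open>1 / r\<close> lies above its tangent at
    \<open>a\<close>, so an upper bound on the mean of \<open>ratio\<close> bounds the mean of the
    reciprocal from below. The point \<open>a\<close> is four times the bound of
    \<open>sum_ratio\<close> per key set.\<close>
  have "(\<Sum>X | X \<in> nsets \<and> good X. 2 / a - ratio X / a\<^sup>2) \<le> (\<Sum>X | X \<in> nsets \<and> good X. H X)"
  proof (rule sum_mono)
    fix X assume "X \<in> {X. X \<in> nsets \<and> good X}"
    then have g: "good X" by simp
    let ?r = "ratio X"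
    have r: "0 < ?r" by (rule ratio_pos[OF g])
    have "0 \<le> (a - ?r)\<^sup>2 / (a\<^sup>2 * ?r)" using r by simp
    also have "\<dots> = 1 / ?r - (2 / a - ?r / a\<^sup>2)" using r a by (simp add: field_simps power2_eq_square)
    finally show "2 / a - ?r / a\<^sup>2 \<le> H X" using Hg[OF g] by linarith
  qed
  also have "(\<Sum>X | X \<in> nsets \<and> good X. 2 / a - ratio X / a\<^sup>2) =
      real (card {X. X \<in> nsets \<and> good X}) * (2 / a) - (\<Sum>X | X \<in> nsets \<and> good X. ratio X) / a\<^sup>2"
    by (simp only: sum_subtractf sum_constant sum_divide_distrib)
  also have "(\<Sum>X | X \<in> nsets \<and> good X. H X) \<le> (\<Sum>X\<in>nsets. H X)"
    using fin H0 by (intro sum_mono2) auto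
  finally have "real (card {X. X \<in> nsets \<and> good X}) * (2 / a) - (\<Sum>X | X \<in> nsets \<and> good X. ratio X) / a\<^sup>2 \<le> (\<Sum>X\<in>nsets. H X)" .
  moreover have "C / 2 * (2 / a) \<le> real (card {X. X \<in> nsets \<and> good X}) * (2 / a)"
    using cardg a by (intro mult_right_mono) auto
  moreover have "(\<Sum>X | X \<in> nsets \<and> good X. ratio X) / a\<^sup>2 \<le> (a / 4 * C) / a\<^sup>2"
  proof (rule divide_right_mono)
    have "a / 4 * C = 3 * real (?U + 1) * real (N + 1) * real (?U choose n)"
      unfolding a_def C_def by (simp del: of_nat_add of_nat_mult)
    then show "(\<Sum>X | X \<in> nsets \<and> good X. ratio X) \<le> a / 4 * C" using sum_ratio by (simp only:)
  qed simp
  ultimately have "C / 2 * (2 / a) - (a / 4 * C) / a\<^sup>2 \<le> (\<Sum>X\<in>nsets. H X)" by linarith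
  moreover have "C / 2 * (2 / a) - (a / 4 * C) / a\<^sup>2 = C * \<delta>"
  proof -
    define Q where "Q = real (?U + 1) * real (N + 1)"
    have "0 < Q" unfolding Q_def by (simp del: of_nat_add of_nat_mult)
    then show ?thesis unfolding \<delta>_def a_def Q_def[symmetric] by (simp add: field_simps power2_eq_square)
  qed
  ultimately have main: "\<delta> * C \<le> (\<Sum>X\<in>nsets. H X)" by (simp add: mult.commute)
  have perm: "(\<Sum>\<sigma> | \<sigma> permutes {..<?U}. H (\<sigma> ` S)) * C = fact ?U * (\<Sum>X\<in>nsets. H X)"
    using sum_permutes_image[of "{..<?U}" S n H] S unfolding C_def by simp
  have "\<delta> * C \<le> (\<Sum>\<sigma> | \<sigma> permutes {..<?U}. H (\<sigma> ` S)) / fact ?U * C"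
    using main perm by (simp add: field_simps)
  then have "\<delta> \<le> (\<Sum>\<sigma> | \<sigma> permutes {..<?U}. H (\<sigma> ` S)) / fact ?U"
    by (rule mult_right_le_imp_le) (rule C)
  also have "\<dots> = (\<Sum>\<sigma> | \<sigma> permutes {..<?U}. \<Sum>\<omega>\<in>systems. wt \<omega> / fact ?U * of_bool (good (\<sigma> ` S) \<and> (\<exists>mem\<in>mems. sat (\<sigma> ` S) \<omega> mem)))"
    unfolding H_def sum_divide_distrib by simp
  also have "\<dots> = (\<Sum>\<sigma>\<in>{\<sigma>. \<sigma> permutes {..<?U}} \<times> systems. wt (snd \<sigma>) / fact ?U *
     of_bool (good (fst \<sigma> ` S) \<and> (\<exists>mem\<in>mems. sat (fst \<sigma> ` S) (snd \<sigma>) mem)))"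
    unfolding sum.cartesian_product by (simp add: case_prod_beta)
  finally show ?thesis .
qed

text \<open>There are at most \<open>2 ^ U\<close> key sets and \<open>J\<close> is at least
  \<open>U / \<delta>\<close>, so greedy covering leaves at most \<open>exp (- U) * 2 ^ U\<close> of
  them, a number below 1.\<close>

lemma cover:
  assumes U: "U \<le> m * Y" and J: "real U * (16 * (real (m * Y + 1) * real (N + 1))) \<le> real J"
  shows "\<exists>f. \<forall>S\<in>key_sets U n. \<exists>i<J. fst (f i) permutes {..<m * Y} \<and> snd (f i) \<in> systems \<and>
     good (fst (f i) ` S) \<and> (\<exists>mem\<in>mems. sat (fst (f i) ` S) (snd (f i)) mem)"
proof -
  let ?P = "{\<sigma>. \<sigma> permutes {..<m * Y}}"
  let ?c = "\<lambda>\<sigma> S. good (fst \<sigma> ` S) \<and> (\<exists>mem\<in>mems. sat (fst \<sigma> ` S) (snd \<sigma>) mem)"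
  have finF: "finite (loc_funs N words_set Lab)"
    unfolding loc_funs_def using finT by (intro finite_cartesian_product finite_PiE) (auto simp: Lab_def)
  have finS: "finite systems" unfolding csp_systems_def items_def using finF by (intro finite_PiE) auto
  have finP: "finite ?P" by (rule finite_permutations) simp
  have sumw: "(\<Sum>\<omega>\<in>systems. wt \<omega>) = 1"
  proof -
    have "(\<Prod>i\<in>items. \<Sum>\<phi>\<in>loc_funs N words_set Lab. loc_wt N words_set (law i) \<phi>) = (\<Sum>\<omega>\<in>systems. wt \<omega>)"
      unfolding csp_systems_def csp_wt_def by (rule prod_sum_PiE) (use finF in \<open>auto simp: items_def\<close>)
    moreover have "(\<Sum>\<phi>\<in>loc_funs N words_set Lab. loc_wt N words_set (law i) \<phi>) = 1" for i
      by (rule sum_loc_wt) (use pos finT sum_law in \<open>auto simp: Lab_def\<close>)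
    ultimately show ?thesis by simp
  qed
  have keys: "S \<subseteq> {..<m * Y}" "card S = n" "S \<in> Pow {..<U}" if "S \<in> key_sets U n" for S
    using that U unfolding key_sets_def by fastforce+
  have "\<exists>f. (\<forall>i. f i \<in> ?P \<times> systems) \<and> real (card {S \<in> key_sets U n. \<forall>i<J. \<not> ?c (f i) S}) \<le> (1 - \<delta>) ^ J * real (card (key_sets U n))"
  proof (rule weighted_cover[where wt = "\<lambda>\<sigma>. wt (snd \<sigma>) / fact (m * Y)"])
    show "finite (?P \<times> systems)" using finP finS by simp
    show "(\<Sum>\<sigma>\<in>?P \<times> systems. wt (snd \<sigma>) / fact (m * Y)) = 1"
    proof -
      have "(\<Sum>\<sigma>\<in>?P \<times> systems. wt (snd \<sigma>) / fact (m * Y)) = (\<Sum>\<sigma>\<in>?P. \<Sum>\<omega>\<in>systems. wt \<omega> / fact (m * Y))"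
        unfolding sum.cartesian_product by (simp add: case_prod_beta)
      also have "\<dots> = real (card ?P) / fact (m * Y)" using sumw by (simp add: sum_divide_distrib[symmetric])
      also have "card ?P = fact (m * Y)" by (rule card_permutations) auto
      finally show ?thesis by simp
    qed
    show "0 \<le> wt (snd \<sigma>) / fact (m * Y)" for \<sigma> :: "(nat \<Rightarrow> nat) \<times> _"
      unfolding csp_wt_def by (intro divide_nonneg_nonneg prod_nonneg) (auto intro: loc_wt_nonneg law_nonneg)
    show "finite (key_sets U n)" by (rule finite_subset[of _ "Pow {..<U}"]) (use keys in auto)
    show "\<delta> \<le> 1"
    proof -
      have "1 * 1 \<le> real (m * Y + 1) * real (N + 1)" by (intro mult_mono) auto
      then show ?thesis unfolding \<delta>_def by simp
    qed
    show "\<delta> \<le> (\<Sum>\<sigma>\<in>?P \<times> systems. wt (snd \<sigma>) / fact (m * Y) * of_bool (?c \<sigma> S))" if "S \<in> key_sets U n" for S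
      using success_weight[OF keys(1,2)[OF that]] .
  qed
  then obtain f where f: "\<And>i. f i \<in> ?P \<times> systems"
    "real (card {S \<in> key_sets U n. \<forall>i<J. \<not> ?c (f i) S}) \<le> (1 - \<delta>) ^ J * real (card (key_sets U n))" by blast
  have \<delta>0: "0 < \<delta>" "\<delta> \<le> 1"
  proof -
    have "1 * 1 \<le> real (m * Y + 1) * real (N + 1)" by (intro mult_mono) auto
    then show "0 < \<delta>" "\<delta> \<le> 1" unfolding \<delta>_def by (auto simp: divide_simps)
  qed
  have "(1 - \<delta>) ^ J * real (card (key_sets U n)) < 1"
  proof (cases "U = 0")
    case True
    then have "key_sets U n = {}" using n unfolding key_sets_def by auto
    then show ?thesis by simp
  next
    case False
    have "card (key_sets U n) \<le> card (Pow {..<U})" by (rule card_mono) (use keys in auto)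
    then have "real (card (key_sets U n)) \<le> real (2 ^ U)" by (simp add: card_Pow)
    then have k: "real (card (key_sets U n)) \<le> 2 ^ U" by simp
    have "(1 - \<delta>) ^ J \<le> exp (- \<delta>) ^ J" using \<delta>0 exp_ge_add_one_self[of "- \<delta>"] by (intro power_mono) auto
    also have "\<dots> = exp (- (\<delta> * real J))" by (simp add: exp_of_nat_mult[symmetric] mult.commute)
    also have "\<dots> \<le> exp (- real U)"
    proof -
      define Q where "Q = real (m * Y + 1) * real (N + 1)"
      have Q: "Q \<noteq> 0" unfolding Q_def by (simp del: of_nat_add of_nat_mult)
      have "real U = \<delta> * (real U * (16 * Q))" unfolding \<delta>_def Q_def[symmetric] using Q by simp
      then have "real U = \<delta> * (real U * (16 * (real (m * Y + 1) * real (N + 1))))" unfolding Q_def .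
      also have "\<dots> \<le> \<delta> * real J" using J \<delta>0 by (intro mult_left_mono) auto
      finally show ?thesis by simp
    qed
    finally have "(1 - \<delta>) ^ J * real (card (key_sets U n)) \<le> exp (- real U) * 2 ^ U"
      using k by (intro mult_mono) auto
    also have "\<dots> < exp (- real U) * exp 1 ^ U"
    proof (intro mult_strict_left_mono power_strict_mono)
      show "(2::real) < exp 1" using e_approx_32 by (simp add: abs_if split: if_splits)
    qed (use False in auto)
    also have "\<dots> = 1" by (simp add: exp_of_nat_mult[symmetric] exp_minus)
    finally show ?thesis .
  qed
  then have "card {S \<in> key_sets U n. \<forall>i<J. \<not> ?c (f i) S} = 0" using f(2) by linarith
  moreover have "finite {S \<in> key_sets U n. \<forall>i<J. \<not> ?c (f i) S}"
    by (rule finite_subset[of _ "Pow {..<U}"]) (use keys in auto)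
  ultimately have "\<forall>S\<in>key_sets U n. \<exists>i<J. ?c (f i) S" by auto
  then show ?thesis using f(1) by (intro exI[of _ f]) (auto simp: mem_Times_iff)
qed

end

subsection \<open>Memory layout\<close>

text \<open>A payload of \<open>b * E + r\<close> bits with \<open>r \<le> E\<close> keeps \<open>b * E\<close> bits at a fixed place. Its positions
  \<open>0, b + 1, \<dots>, (r - 1) * (b + 1)\<close> are stored elsewhere, so that a window of \<open>b\<close> bits meets at
  most one of them.\<close>

definition is_var :: "nat \<Rightarrow> nat \<Rightarrow> nat \<Rightarrow> bool" where
  "is_var b r a \<longleftrightarrow> (b + 1) dvd a \<and> a div (b + 1) < r"

text \<open>The rank of a non-variable \<open>a\<close> among such positions:
  \<open>min r (a div (b + 1) + 1)\<close> counts the variable positions up to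
  \<open>a\<close>.\<close>

definition fixed_pos :: "nat \<Rightarrow> nat \<Rightarrow> nat \<Rightarrow> nat" where
  "fixed_pos b r a = a - min r (a div (b + 1) + 1)"

lemma fixed_pos_strict_mono:
  assumes "a < a'" "\<not> is_var b r a'" 
  shows "fixed_pos b r a < fixed_pos b r a' \<or> is_var b r a"
proof (cases "is_var b r a")
  case False
  define q q' o1 o2 where defs: "q = a div (b + 1)" "q' = a' div (b + 1)" "o1 = a mod (b + 1)" "o2 = a' mod (b + 1)"
  have a: "a = q * (b + 1) + o1" "o1 \<le> b" and a': "a' = q' * (b + 1) + o2" "o2 \<le> b"
    unfolding defs by (auto simp: less_Suc_eq_le[symmetric] simp del: mult_Suc_right)
  have qq: "q \<le> q'" unfolding defs using assms(1) by (intro div_le_mono) simp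
  have nv: "r \<le> q \<or> 1 \<le> o1" using False unfolding is_var_def defs by (auto simp: dvd_eq_mod_eq_0)
  have nv': "r \<le> q' \<or> 1 \<le> o2" using assms(2) unfolding is_var_def defs by (auto simp: dvd_eq_mod_eq_0)
  have mn: "min r (q + 1) \<le> a"
  proof (cases "r \<le> q")
    case True
    then have "r \<le> q * (b + 1)" by (simp add: trans_le_add1)
    then show ?thesis using a by simp
  next
    case False
    then have "q + 1 \<le> q * (b + 1) + o1" using nv by simp
    then show ?thesis using a by simp
  qed
  have "a - min r (q + 1) < a' - min r (q' + 1)"
  proof (cases "q = q'")
    case True
    then show ?thesis using assms(1) mn by simp
  next
    case False
    then obtain d where d: "q' = q + Suc d" using qq by (metis less_iff_Suc_add add_Suc_right le_neq_implies_less)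
    have e: "q' * (b + 1) = q * (b + 1) + (b + 1) + (d * b + d)" unfolding d by (simp add: algebra_simps)
    have "a + Suc d + o2 \<le> a'" unfolding a a' e using a(2) by simp
    moreover have "min r (q' + 1) + 1 \<le> min r (q + 1) + Suc d + o2"
      using nv' d by (auto simp: min_def)
    ultimately show ?thesis using mn by linarith
  qed
  then show ?thesis unfolding fixed_pos_def defs by simp
qed simp

lemma fixed_pos_inj:
  assumes "\<not> is_var b r a" "\<not> is_var b r a'" "fixed_pos b r a = fixed_pos b r a'"
  shows "a = a'"
  using fixed_pos_strict_mono[of a a' b r] fixed_pos_strict_mono[of a' a b r] assms
  by (metis less_irrefl linorder_neqE_nat)

lemma fixed_pos_less:
  assumes "\<not> is_var b r a" "a < b * E + r" "r \<le> E" "0 < b" "0 < E"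
  shows "fixed_pos b r a < b * E"
proof -
  define q o1 where defs: "q = a div (b + 1)" "o1 = a mod (b + 1)"
  have a: "a = q * (b + 1) + o1" "o1 \<le> b"
    unfolding defs by (auto simp: less_Suc_eq_le[symmetric] simp del: mult_Suc_right)
  show ?thesis
  proof (cases "r \<le> q")
    case True
    then have "fixed_pos b r a = a - r" unfolding fixed_pos_def defs by simp
    moreover have "0 < b * E" using assms by simp
    ultimately show ?thesis using assms(2) by linarith
  next
    case False
    then have "fixed_pos b r a = a - (q + 1)" unfolding fixed_pos_def defs by simp
    moreover have "1 \<le> o1" using False assms(1) unfolding is_var_def defs by (auto simp: dvd_eq_mod_eq_0)
    ultimately have "fixed_pos b r a < b * (q + 1)" using a assms(4) by (simp add: algebra_simps)
    also have "\<dots> \<le> b * E" using False assms(3) by (intro mult_le_mono2) simp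
    finally show ?thesis .
  qed
qed

text \<open>The fixed bits of a window of \<open>b\<close> payload bits lie in one window of
  \<open>b\<close> memory bits, so one read is enough.\<close>

lemma fixed_pos_window:
  assumes i: "i < b"
  shows "fixed_pos b r a \<le> fixed_pos b r (a + i)" "fixed_pos b r (a + i) < fixed_pos b r a + b"
proof -
  have d1: "a div (b + 1) \<le> (a + i) div (b + 1)" by (intro div_le_mono) simp
  have "(a + i) div (b + 1) \<le> (a + (b + 1)) div (b + 1)" using i by (intro div_le_mono) simp
  then have d2: "(a + i) div (b + 1) \<le> a div (b + 1) + 1"
    by (subst (asm) div_add_self2) auto
  show "fixed_pos b r a \<le> fixed_pos b r (a + i)"
  proof (cases "i = 0")
    case False
    then show ?thesis unfolding fixed_pos_def using d1 d2 by linarith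
  qed simp
  show "fixed_pos b r (a + i) < fixed_pos b r a + b"
    unfolding fixed_pos_def using d1 i by linarith
qed

text \<open>The only multiple of \<open>b + 1\<close> that a window can contain has a quotient
  computable from the address of the window, so the item to evaluate is known in advance.\<close>

lemma var_in_window:
  fixes a b i :: nat
  assumes i: "i < b" and v: "(b + 1) dvd (a + i)"
  shows "(a + i) div (b + 1) = (a + b) div (b + 1)"
proof -
  obtain q where q: "a + i = (b + 1) * q" using v by (auto elim: dvdE)
  have "(a + b) div (b + 1) = q"
  proof (rule div_nat_eqI)
    show "(b + 1) * q \<le> a + b" using q i by linarith
    show "a + b < (b + 1) * Suc q" using q i by simp
  qed
  moreover have "(a + i) div (b + 1) = q" unfolding q by (rule nonzero_mult_div_cancel_left) simp
  ultimately show ?thesis by simp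
qed

section \<open>The bits of the memory and the query algorithm\<close>

context block_array
begin

text \<open>Word 0 is the header; the shared memory starts at word 1.\<close>

definition mem_of :: "nat set \<Rightarrow> nat \<Rightarrow> nat set" where
  "mem_of f = (\<lambda>a. window b ((a + 1) * b) f)"

definition fixed_base :: "nat \<Rightarrow> nat" where
  "fixed_base i = (N + 1) * b + i * (b * E)"

definition block_payload where
  "block_payload \<omega> i c f = {a. if is_var b (extra c) a
     then loc_eval (\<omega> (i, Suc (a div (b + 1)))) (mem_of f) = Some (0, 0)
     else fixed_base i + fixed_pos b (extra c) a \<in> f}"

definition block_query where
  "block_query sys x' f = (let y = fst sys x'; i = y div Y in
     case loc_eval (snd sys (i, 0)) (mem_of f) of None \<Rightarrow> False
     | Some c \<Rightarrow> qr c (y mod Y) (block_payload (snd sys) i c f))"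

lemma qlocal_ev: "qlocal b 4 (\<lambda>f. loc_eval \<phi> (mem_of f))"
proof -
  obtain a1 a2 a3 a4 g where phi: "\<phi> = ((a1, a2, a3, a4), g)" by (metis prod.exhaust)
  have w: "qlocal b 1 (\<lambda>f. mem_of f a)" for a
    using qlocal_win[of b b "\<lambda>v. v"] by (simp add: mem_of_def)
  have 4: "qlocal b 1 (\<lambda>f. g (v1, v2, v3, mem_of f a4))" for v1 v2 v3
    by (rule qlocal_map[OF w])
  have 3: "qlocal b (1 + 1) (\<lambda>f. (\<lambda>v f. g (v1, v2, v, mem_of f a4)) (mem_of f a3) f)" for v1 v2
    by (rule qlocal_bind[OF w 4])
  have 2: "qlocal b (1 + (1 + 1)) (\<lambda>f. (\<lambda>v f. g (v1, v, mem_of f a3, mem_of f a4)) (mem_of f a2) f)" for v1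
    by (rule qlocal_bind[OF w 3])
  have "qlocal b (1 + (1 + (1 + 1))) (\<lambda>f. (\<lambda>v f. g (v, mem_of f a2, mem_of f a3, mem_of f a4)) (mem_of f a1) f)"
    by (rule qlocal_bind[OF w 2])
  then show ?thesis unfolding phi loc_eval_def by (simp add: eval_nat_numeral)
qed

text \<open>A window of the virtual payload costs four reads for the single extra bit that it may
  contain and one for its fixed bits.\<close>

lemma qlocal_block_payload:
  assumes Q: "qlocal b s Q"
  shows "qlocal b (s * 5) (\<lambda>f. Q (block_payload \<omega> i c f))"
proof (rule qlocal_subst[OF _ Q])
  fix a
  let ?r = "extra c"
  let ?u = "(a + b) div (b + 1)"
  let ?H = "\<lambda>l v. {k. k < b \<and> (if is_var b ?r (a + k) then l = Some (0, 0)
      else fixed_pos b ?r (a + k) - fixed_pos b ?r a \<in> v)}"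
  have "window b a (block_payload \<omega> i c f) =
      ?H (loc_eval (\<omega> (i, Suc ?u)) (mem_of f)) (window b (fixed_base i + fixed_pos b ?r a) f)" for f
  proof (rule set_eqI)
    fix k
    show "k \<in> window b a (block_payload \<omega> i c f) \<longleftrightarrow>
        k \<in> ?H (loc_eval (\<omega> (i, Suc ?u)) (mem_of f)) (window b (fixed_base i + fixed_pos b ?r a) f)"
    proof (cases "k < b")
      case k: True
      show ?thesis
      proof (cases "is_var b ?r (a + k)")
        case True
        then have "(a + k) div (b + 1) = ?u" by (intro var_in_window k) (simp add: is_var_def)
        then show ?thesis using k True by (simp add: window_def block_payload_def)
      next
        case False
        have "fixed_base i + fixed_pos b ?r a + (fixed_pos b ?r (a + k) - fixed_pos b ?r a) = fixed_base i + fixed_pos b ?r (a + k)"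
          "fixed_pos b ?r (a + k) - fixed_pos b ?r a < b"
          using fixed_pos_window[OF k, of ?r a] by auto
        then show ?thesis using k False by (simp add: window_def block_payload_def)
      qed
    qed (simp add: window_def)
  qed
  moreover have "qlocal b (4 + 1) (\<lambda>f. (\<lambda>l f. ?H l (window b (fixed_base i + fixed_pos b ?r a) f)) (loc_eval (\<omega> (i, Suc ?u)) (mem_of f)) f)"
    by (rule qlocal_bind[OF qlocal_ev]) (use qlocal_win[of b b] in simp)
  ultimately show "qlocal b 5 (\<lambda>f. window b a (block_payload \<omega> i c f))" by simp
qed

lemma qlocal_block_query: "qlocal b (4 + t * 5) (block_query sys x')"
proof -
  let ?y = "fst sys x'"
  let ?i = "?y div Y"
  have "qlocal b (4 + t * 5) (\<lambda>f. (\<lambda>l f. case l of None \<Rightarrow> False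
      | Some c \<Rightarrow> qr c (?y mod Y) (block_payload (snd sys) ?i c f)) (loc_eval (snd sys (?i, 0)) (mem_of f)) f)"
  proof (rule qlocal_bind[OF qlocal_ev])
    fix l :: "(nat \<times> nat) option"
    show "qlocal b (t * 5) (\<lambda>f. case l of None \<Rightarrow> False
      | Some c \<Rightarrow> qr c (?y mod Y) (block_payload (snd sys) ?i c f))"
    proof (cases l)
      case None
      then show ?thesis by (simp add: qlocal.const)
    next
      case (Some c)
      have "qlocal b t (qr c (?y mod Y))" using scheme unfolding desc_scheme_def by blast
      from qlocal_block_payload[OF this] show ?thesis using Some by simp
    qed
  qed
  then show ?thesis unfolding block_query_def[abs_def] Let_def by simp
qed

lemma block_query_correct:
  assumes perm: "\<sigma> permutes {..<m * Y}" and S: "S \<subseteq> {..<m * Y}" and g: "good (\<sigma> ` S)"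
    and mem: "mem \<in> mems" and sat: "sat (\<sigma> ` S) \<omega> mem" and H: "H \<subseteq> {..<b}"
    and om: "\<omega> \<in> systems"
  shows "\<exists>f \<subseteq> {..<(N + 1) * b + m * (b * E)}. window b 0 f = H \<and> (\<forall>x'<m * Y. block_query (\<sigma>, \<omega>) x' f \<longleftrightarrow> x' \<in> S)"
proof -
  define X where "X = \<sigma> ` S"
  define F where "F = b * E"
  have F: "0 < F" using pos by (simp add: F_def)
  define r where "r i = extra (cls X i)" for i
  define fx where "fx i = {fixed_pos b (r i) a | a. a \<in> payload (part Y i X) \<and> a < M (cls X i) \<and> \<not> is_var b (r i) a}" for i
  define base where "base = (N + 1) * b"
  \<comment> \<open>Three regions: the header, the \<open>N\<close> shared words, and
    \<open>F\<close> fixed bits for each block.\<close>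
  define f where "f = {z. z < base + m * F \<and> (if z < b then z \<in> H
     else if z < base then z mod b \<in> mem (z div b - 1) else (z - base) mod F \<in> fx ((z - base) div F))}"
  have b_base: "b \<le> base" by (simp add: base_def)
  have win0: "window b 0 f = H" using H b_base pos by (auto simp: window_def f_def)
  have memf: "mem_of f a = mem a" if a: "a < N" for a
  proof -
    have sub: "mem a \<subseteq> {..<b}" using mem a by (auto simp: PiE_def Pi_def)
    have "(a + 1) * b + k \<in> f \<longleftrightarrow> k \<in> mem a" if k: "k < b" for k
    proof -
      have "(a + 1) * b + k < base" unfolding base_def using a k by (intro mult_add_less) auto
      moreover have "\<not> (a + 1) * b + k < b" by simp
      moreover have "((a + 1) * b + k) mod b = k" using k by (simp only: mod_mult_self3 mod_less)
      moreover have "((a + 1) * b + k) div b - 1 = a" using k pos by (subst div_mult_self3) auto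
      ultimately show ?thesis unfolding f_def by auto
    qed
    then show ?thesis using sub unfolding mem_of_def window_def by auto
  qed
  have Act: "loc_eval (\<omega> i) mem = val X i" if "i \<in> active X" for i
    using sat that unfolding sat_def X_def by blast
  have addr: "loc_eval \<phi> (mem_of f) = loc_eval \<phi> mem" if "\<phi> \<in> loc_funs N words_set Lab" for \<phi>
    using that memf unfolding loc_funs_def loc_eval_def by auto
  have ev_item: "loc_eval (\<omega> j) (mem_of f) = val X j" if j: "j \<in> active X" for j
  proof -
    have "j \<in> items" using j extra_le[OF cls_in[OF g]] unfolding X_def by (fastforce simp: active_def items_def)
    then have "\<omega> j \<in> loc_funs N words_set Lab" using om unfolding csp_systems_def by (rule PiE_mem[rotated])
    then show ?thesis using addr Act[OF j] by simp
  qed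
  have fixed: "fixed_base i + k \<in> f \<longleftrightarrow> k \<in> fx i" if "i < m" "k < F" for i k
  proof -
    have e: "fixed_base i + k = base + (i * F + k)" by (simp add: fixed_base_def base_def F_def)
    have "i * F + k < m * F" using that by (rule mult_add_less)
    moreover have "(i * F + k) mod F = k" "(i * F + k) div F = i" using that by auto
    ultimately show ?thesis unfolding e f_def using b_base by auto
  qed
  have "block_query (\<sigma>, \<omega>) x' f \<longleftrightarrow> x' \<in> S" if x': "x' < m * Y" for x'
  proof -
    define y where "y = \<sigma> x'"
    define i where "i = y div Y"
    define c where "c = cls X i"
    have y: "y < m * Y" using permutes_in_image[OF perm, of x'] x' by (simp add: y_def)
    have i: "i < m" using y pos by (simp add: i_def div_less_iff_less_mult)
    have c: "c \<in> T" using cls_in[OF g i] by (simp add: c_def X_def)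
    have rE: "r i \<le> E" using extra_le[OF c] by (simp add: r_def c_def)
    have Mc: "M c = b * E + r i" using M_range(1)[OF c] by (simp add: r_def extra_def c_def)
    have "(i, 0) \<in> active X" using i by (simp add: active_def)
    from ev_item[OF this] have ev0: "loc_eval (\<omega> (i, 0)) (mem_of f) = Some c" by (simp add: val_def c_def)
    have "qr (de (part Y i X)) (y mod Y) (block_payload \<omega> i c f) \<longleftrightarrow> y mod Y \<in> part Y i X"
    proof (rule payload)
      show "part Y i X \<subseteq> {..<Y}" by (rule part_subset)
      show "Gd (part Y i X)" using g i by (simp add: good_def X_def)
      show "y mod Y < Y" using pos by simp
      fix a assume a: "a < M (de (part Y i X))"
      then have aM: "a < M c" by (simp add: c_def cls_def)
      show "a \<in> block_payload \<omega> i c f \<longleftrightarrow> a \<in> payload (part Y i X)"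
      proof (cases "is_var b (r i) a")
        case True
        define u where "u = a div (b + 1)"
        have u: "u < r i" "u * (b + 1) = a"
          using True unfolding is_var_def u_def by (blast, metis dvd_div_mult_self)
        have "(i, Suc u) \<in> active X" using i u by (simp add: active_def r_def)
        from ev_item[OF this] have "loc_eval (\<omega> (i, Suc u)) (mem_of f) = Some (0, 0) \<longleftrightarrow> u * (b + 1) \<in> payload (part Y i X)"
          by (simp add: val_def)
        then show ?thesis using True u(2) unfolding block_payload_def u_def[symmetric]
          by (simp add: r_def c_def u_def)
      next
        case False
        have "fixed_pos b (r i) a < F"
          unfolding F_def using fixed_pos_less[OF False _ rE] aM pos Mc by simp
        then have "a \<in> block_payload \<omega> i c f \<longleftrightarrow> fixed_pos b (r i) a \<in> fx i"
          using False fixed[OF i] unfolding block_payload_def by (simp add: r_def c_def)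
        also have "\<dots> \<longleftrightarrow> a \<in> payload (part Y i X)"
          unfolding fx_def using False aM fixed_pos_inj[OF False] by (auto simp: c_def)
        finally show ?thesis .
      qed
    qed
    then have "block_query (\<sigma>, \<omega>) x' f \<longleftrightarrow> y mod Y \<in> part Y i X"
      unfolding block_query_def by (simp add: y_def[symmetric] i_def[symmetric] ev0) (simp add: c_def cls_def)
    also have "\<dots> \<longleftrightarrow> y \<in> X" using mem_part[OF pos(2)] by (simp add: i_def)
    also have "\<dots> \<longleftrightarrow> x' \<in> S" unfolding X_def y_def by (rule inj_image_mem_iff[OF permutes_inj[OF perm]])
    finally show ?thesis .
  qed
  moreover have "f \<subseteq> {..<(N + 1) * b + m * (b * E)}" by (auto simp: f_def base_def F_def)
  ultimately show ?thesis using win0 by blast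
qed

text \<open>The header can name \<open>2 ^ b\<close> random objects, enough for the greedy covering.
  Its read and the four reads for the class make 5, and each of the \<open>t\<close> payload windows
  costs 5 more.\<close>

lemma block_array_encoding:
  assumes U: "U \<le> m * Y" and J: "real U * (16 * (real (m * Y + 1) * real (N + 1))) \<le> 2 ^ b"
  shows "\<exists>Q. (\<forall>x'. qlocal b (5 + t * 5) (Q x')) \<and>
     (\<forall>S \<in> key_sets U n. \<exists>f \<subseteq> {..<(N + 1) * b + m * (b * E)}. \<forall>x'<U. Q x' f \<longleftrightarrow> x' \<in> S)"
proof -
  obtain sys where sys: "\<And>S. S \<in> key_sets U n \<Longrightarrow> \<exists>i<(2::nat) ^ b. fst (sys i) permutes {..<m * Y} \<and> snd (sys i) \<in> systems \<and>
     good (fst (sys i) ` S) \<and> (\<exists>mem\<in>mems. sat (fst (sys i) ` S) (snd (sys i)) mem)"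
    using cover[OF U, of "2 ^ b"] J by auto
  define Q where "Q x' f = block_query (sys (set_encode (window b 0 f))) x' f" for x' f
  have "qlocal b (Suc 0 + (4 + t * 5)) (\<lambda>f. (\<lambda>v f. block_query (sys (set_encode v)) x' f) (window b 0 f) f)" for x'
    by (rule qlocal_bind[OF qlocal_win[of b b "\<lambda>v. v"] qlocal_block_query]) simp
  then have "qlocal b (5 + t * 5) (Q x')" for x' unfolding Q_def[abs_def] by simp
  moreover have "\<exists>f \<subseteq> {..<(N + 1) * b + m * (b * E)}. \<forall>x'<U. Q x' f \<longleftrightarrow> x' \<in> S" if S: "S \<in> key_sets U n" for S
  proof -
    obtain i mem where i: "i < 2 ^ b" "fst (sys i) permutes {..<m * Y}" "snd (sys i) \<in> systems"
      "good (fst (sys i) ` S)" "mem \<in> mems" "sat (fst (sys i) ` S) (snd (sys i)) mem"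
      using sys[OF S] by blast
    have sub: "S \<subseteq> {..<m * Y}" using S U unfolding key_sets_def by fastforce
    have "set_decode i \<subseteq> {..<b}" using set_decode_mod_subset[of i b] i(1) by simp
    from block_query_correct[OF i(2) sub i(4,5,6) this i(3)]
    obtain f where f: "f \<subseteq> {..<(N + 1) * b + m * (b * E)}" "window b 0 f = set_decode i"
      "\<forall>x'<m * Y. block_query (sys i) x' f \<longleftrightarrow> x' \<in> S" by auto
    then show ?thesis using U unfolding Q_def by (intro exI[of _ f]) auto
  qed
  ultimately show ?thesis by blast
qed

end

subsection \<open>Typical sets\<close>

lemma sum_UN_le:
  fixes g :: "'a \<Rightarrow> real"
  assumes "finite I" "\<And>i. finite (A i)" "\<And>a. 0 \<le> g a"
  shows "sum g (\<Union>i\<in>I. A i) \<le> (\<Sum>i\<in>I. sum g (A i))"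
  using assms(1)
proof (induction I rule: finite_induct)
  case (insert i I)
  have "sum g (A i \<union> (\<Union>j\<in>I. A j)) + sum g (A i \<inter> (\<Union>j\<in>I. A j)) = sum g (A i) + sum g (\<Union>j\<in>I. A j)"
    by (rule sum.union_inter) (use assms insert in auto)
  moreover have "0 \<le> sum g (A i \<inter> (\<Union>j\<in>I. A j))" using assms(3) by (intro sum_nonneg) auto
  ultimately show ?case using insert by simp
qed simp

text \<open>A union bound in the product measure over two kinds of failure: a block whose number of
  keys deviates by more than \<open>D\<close>, and a cell whose trie has more than \<open>h\<close>
  nodes. Returning to \<open>n\<close>-sets costs the factor \<open>m * Y + 1\<close>, which
  \<open>t1\<close> and \<open>t2\<close> absorb.\<close>

lemma few_bad_sets:
  fixes x B D :: real
  assumes Y: "Y = 2 ^ v * c" and c: "0 < c" and n: "0 < n" "n < m * Y"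
    and x: "x = real n / real (m * Y - n)" and B: "B = real n / real m"
    and D: "0 < D" "D \<le> 2 * B" and smax: "B + D \<le> real smax"
    and lam: "2 ^ v * x \<le> 2"
    and t1: "real (m * Y + 1) * (real m * (2 * exp (- D\<^sup>2 / (4 * B)))) \<le> 1/4"
    and t2: "real (m * Y + 1) * (real (m * c) * ((2/3) ^ h * exp 6)) \<le> 1/4"
  shows "2 * card {X. X \<subseteq> {..<m * Y} \<and> card X = n \<and>
     \<not> (\<forall>i<m. (cells_good v h (part Y i X) \<and> card (part Y i X) \<le> smax) \<and> \<bar>real (card (part Y i X)) - B\<bar> \<le> D)}
     \<le> m * Y choose n"
proof -
  let ?U = "m * Y"
  have m: "0 < m" using n by (cases m) auto
  have Ypos: "0 < Y" using n by (cases Y) auto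
  have x0: "0 < x"
  proof -
    have "0 < real (?U - n)" using n by (simp only: of_nat_0_less_iff zero_less_diff)
    then show ?thesis unfolding x using n by (intro divide_pos_pos) auto
  qed
  define Z where "Z = (1 + x) ^ ?U"
  have Z0: "0 < Z" using x0 by (simp add: Z_def)
  let ?bad1 = "\<lambda>i. {X. X \<subseteq> {..<?U} \<and> D < \<bar>real (card (part Y i X)) - B\<bar>}"
  let ?bad2 = "\<lambda>i. {X. X \<subseteq> {..<?U} \<and> h < nodes (shape_of v (part (2 ^ v) i X))}"
  let ?bad = "{X. X \<subseteq> {..<?U} \<and> card X = n \<and>
     \<not> (\<forall>i<m. (cells_good v h (part Y i X) \<and> card (part Y i X) \<le> smax) \<and> \<bar>real (card (part Y i X)) - B\<bar> \<le> D)}"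
  have sub: "?bad \<subseteq> (\<Union>i<m. ?bad1 i) \<union> (\<Union>i<m * c. ?bad2 i)"
  proof
    fix X assume X: "X \<in> ?bad"
    then obtain i where i: "i < m" and
      b: "\<not> ((cells_good v h (part Y i X) \<and> card (part Y i X) \<le> smax) \<and> \<bar>real (card (part Y i X)) - B\<bar> \<le> D)" by auto
    show "X \<in> (\<Union>i<m. ?bad1 i) \<union> (\<Union>i<m * c. ?bad2 i)"
    proof (cases "\<bar>real (card (part Y i X)) - B\<bar> \<le> D")
      case True
      then have "card (part Y i X) \<le> smax" using smax by linarith
      then have "\<not> cells_good v h (part Y i X)" using b True by blast
      then obtain i' where i': "h < nodes (shape_of v (part (2 ^ v) i' (part Y i X)))"
        unfolding cells_good_def by (auto simp: not_le)
      then have "i' < c" unfolding Y part_part[OF c] by (auto simp: nodes_shape_of_empty split: if_splits)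
      moreover from this have "h < nodes (shape_of v (part (2 ^ v) (i * c + i') X))"
        using i' unfolding Y part_part[OF c] by simp
      moreover have "i * c + i' < m * c" using i \<open>i' < c\<close> by (rule mult_add_less)
      ultimately show ?thesis using X by blast
    next
      case False
      then have "X \<in> ?bad1 i" using X by (simp add: not_le)
      then show ?thesis using i by blast
    qed
  qed
  have fin: "finite (Pow {..<?U})" by simp
  have fin1: "finite (?bad1 i)" and fin2: "finite (?bad2 i)" for i
    by (rule finite_subset[OF _ fin]; auto)+
  have w1: "(\<Sum>X\<in>?bad1 i. x ^ card X) \<le> Z * (2 * exp (- D\<^sup>2 / (4 * B)))" if i: "i < m" for i
  proof -
    have BY: "B = real Y * (x / (1 + x))"
    proof -
      define u where "u = real ?U"
      have "real n < u" unfolding u_def using n(2) by (simp only: of_nat_less_iff)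
      moreover have "x = real n / (u - real n)" unfolding x u_def using n by (simp only: of_nat_diff less_imp_le)
      ultimately have "x / (1 + x) = real n / u" using x0 by (simp add: field_simps)
      then have "x / (1 + x) = real n / (real m * real Y)" by (simp add: u_def)
      then show ?thesis unfolding B using Ypos by simp
    qed
    have "(\<Sum>X\<in>?bad1 i. x ^ card X) * (1 + x) ^ Y = Z * (\<Sum>A | A \<subseteq> {..<Y} \<and> D < \<bar>real (card A) - B\<bar>. x ^ card A)"
      unfolding Z_def by (rule sum_Pow_one_part_le) (use Ypos x0 i in auto)
    also have "\<dots> \<le> Z * (2 * exp (- D\<^sup>2 / (4 * B)) * (1 + x) ^ Y)"
      using Z0 by (intro mult_left_mono card_tail_sets x0 BY D) auto
    finally have "(\<Sum>X\<in>?bad1 i. x ^ card X) * (1 + x) ^ Y \<le> Z * (2 * exp (- D\<^sup>2 / (4 * B))) * (1 + x) ^ Y"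
      by (simp only: mult.assoc)
    then show ?thesis by (rule mult_right_le_imp_le) (use x0 in auto)
  qed
  have w2: "(\<Sum>X\<in>?bad2 i. x ^ card X) \<le> Z * ((2/3) ^ h * exp 6)" if i: "i < m * c" for i
  proof -
    have e: "m * Y = m * c * 2 ^ v" by (simp add: Y)
    have "(\<Sum>X\<in>?bad2 i. x ^ card X) * 1 \<le> (\<Sum>X\<in>?bad2 i. x ^ card X) * (1 + x) ^ 2 ^ v"
      using x0 by (intro mult_left_mono one_le_power sum_nonneg) auto
    also have "\<dots> = Z * (\<Sum>A | A \<subseteq> {..<2 ^ v} \<and> h < nodes (shape_of v A). x ^ card A)"
      unfolding Z_def e by (rule sum_Pow_one_part_le) (use x0 i in auto)
    also have "\<dots> \<le> Z * ((2/3) ^ h * exp (2 ^ v * x + (2 ^ v * x)\<^sup>2))"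
      using Z0 x0 by (intro mult_left_mono shape_tail_sets) auto
    also have "\<dots> \<le> Z * ((2/3) ^ h * exp 6)"
    proof -
      have "(2 ^ v * x)\<^sup>2 \<le> 2\<^sup>2" using lam x0 by (intro power_mono) auto
      then have "2 ^ v * x + (2 ^ v * x)\<^sup>2 \<le> 6" using lam by simp
      then show ?thesis using Z0 by (intro mult_left_mono) auto
    qed
    finally show ?thesis by simp
  qed
  have "real (card ?bad) * x ^ n = (\<Sum>X\<in>?bad. x ^ card X)" by simp
  also have "\<dots> \<le> (\<Sum>X\<in>(\<Union>i<m. ?bad1 i) \<union> (\<Union>i<m * c. ?bad2 i). x ^ card X)"
    using sub x0 fin1 fin2 by (intro sum_mono2) auto
  also have "\<dots> \<le> (\<Sum>X\<in>(\<Union>i<m. ?bad1 i). x ^ card X) + (\<Sum>X\<in>(\<Union>i<m * c. ?bad2 i). x ^ card X)"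
  proof -
    have "(\<Sum>X\<in>(\<Union>i<m. ?bad1 i) \<union> (\<Union>i<m * c. ?bad2 i). x ^ card X) + (\<Sum>X\<in>(\<Union>i<m. ?bad1 i) \<inter> (\<Union>i<m * c. ?bad2 i). x ^ card X) =
      (\<Sum>X\<in>(\<Union>i<m. ?bad1 i). x ^ card X) + (\<Sum>X\<in>(\<Union>i<m * c. ?bad2 i). x ^ card X)"
      by (rule sum.union_inter) (use fin1 fin2 in auto)
    moreover have "0 \<le> (\<Sum>X\<in>(\<Union>i<m. ?bad1 i) \<inter> (\<Union>i<m * c. ?bad2 i). x ^ card X)"
      using x0 by (intro sum_nonneg) auto
    ultimately show ?thesis by linarith
  qed
  also have "(\<Sum>X\<in>(\<Union>i<m. ?bad1 i). x ^ card X) \<le> (\<Sum>i<m. \<Sum>X\<in>?bad1 i. x ^ card X)"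
    by (rule sum_UN_le) (use fin1 x0 in auto)
  also have "(\<Sum>X\<in>(\<Union>i<m * c. ?bad2 i). x ^ card X) \<le> (\<Sum>i<m * c. \<Sum>X\<in>?bad2 i. x ^ card X)"
    by (rule sum_UN_le) (use fin2 x0 in auto)
  also have "(\<Sum>i<m. \<Sum>X\<in>?bad1 i. x ^ card X) \<le> (\<Sum>i<m. Z * (2 * exp (- D\<^sup>2 / (4 * B))))"
    by (intro sum_mono w1) auto
  also have "(\<Sum>i<m * c. \<Sum>X\<in>?bad2 i. x ^ card X) \<le> (\<Sum>i<m * c. Z * ((2/3) ^ h * exp 6))"
    by (intro sum_mono w2) auto
  also have "(\<Sum>i<m. Z * (2 * exp (- D\<^sup>2 / (4 * B)))) + (\<Sum>i<m * c. Z * ((2/3) ^ h * exp 6)) =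
      Z * (real m * (2 * exp (- D\<^sup>2 / (4 * B))) + real (m * c) * ((2/3) ^ h * exp 6))"
    by (simp add: algebra_simps)
  also have "\<dots> \<le> real (?U + 1) * (real (?U choose n) * x ^ n) *
      (real m * (2 * exp (- D\<^sup>2 / (4 * B))) + real (m * c) * ((2/3) ^ h * exp 6))"
    unfolding Z_def by (intro mult_right_mono binomial_max_term[OF n x]) auto
  also have "\<dots> = (real (?U choose n) * x ^ n) * (real (?U + 1) * (real m * (2 * exp (- D\<^sup>2 / (4 * B)))) +
      real (?U + 1) * (real (m * c) * ((2/3) ^ h * exp 6)))"
    by (simp only: distrib_left mult_ac)
  also have "\<dots> \<le> (real (?U choose n) * x ^ n) * (1/4 + 1/4)"
    using x0 t1 t2 by (intro mult_left_mono add_mono) auto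
  finally have "real (card ?bad) * x ^ n \<le> real (?U choose n) / 2 * x ^ n" by (simp add: mult_ac)
  then have "real (card ?bad) \<le> real (?U choose n) / 2" by (rule mult_right_le_imp_le) (use x0 in auto)
  then have "real (2 * card ?bad) \<le> real (?U choose n)" by simp
  then show ?thesis by (simp only: of_nat_le_iff)
qed

subsection \<open>Choice of parameters\<close>

lemma merge_count_le: "0 < g \<Longrightarrow> merge_count g j \<le> (2 * g) ^ j"
proof (induction j)
  case (Suc j)
  have "merge_count g (Suc j) \<le> g * (2 * g) ^ j + 1" using Suc by simp
  also have "1 \<le> g * (2 * g) ^ j" using Suc.prems by simp
  finally show ?case by simp
qed simp

lemma ex_power_of_two_between:
  assumes "0 < n" "n \<le> U"
  shows "\<exists>v. 2 ^ v * n \<le> U \<and> U < 2 ^ Suc v * (n::nat)"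
proof -
  have "\<exists>v. U < 2 ^ Suc v * n"
  proof
    have "U < 2 ^ U" by (rule less_exp)
    also have "\<dots> \<le> 2 ^ Suc U * n" using assms by (simp add: trans_le_add1)
    finally show "U < 2 ^ Suc U * n" .
  qed
  define v where "v = (LEAST v. U < 2 ^ Suc v * n)"
  have v: "U < 2 ^ Suc v * n" unfolding v_def using \<open>\<exists>v. U < 2 ^ Suc v * n\<close> by (rule LeastI_ex)
  have "2 ^ v * n \<le> U"
  proof (cases v)
    case 0 then show ?thesis using assms by simp
  next
    case (Suc w)
    have "\<not> U < 2 ^ Suc w * n" using not_less_Least[of w "\<lambda>v. U < 2 ^ Suc v * n"] Suc unfolding v_def by simp
    then show ?thesis using Suc by simp
  qed
  with v show ?thesis by blast
qed

lemma desc_scheme_restrict: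
  assumes "desc_scheme b t Y Gd T M cn de qr"
  shows "desc_scheme b t Y (\<lambda>A. Gd A \<and> q (card A)) {c \<in> T. q (cn c)} M cn de qr"
  using assms unfolding desc_scheme_def by auto

text \<open>At most \<open>2 * D + 2\<close> key counts lie near the mean. This brings the number of
  classes from order \<open>c * b\<close> down to order \<open>D * b\<close>, small enough to be
  charged to each block.\<close>

lemma card_near_le:
  fixes B :: real and D K :: nat
  assumes B: "0 \<le> B" and T: "T \<subseteq> UNIV \<times> {..K}" "\<And>c. c \<in> T \<Longrightarrow> \<bar>real (fst c) - B\<bar> \<le> real D"
  shows "card T \<le> (2 * D + 2) * (K + 1)"
proof -
  define s0 where "s0 = nat \<lfloor>B\<rfloor>"
  have s0: "real s0 \<le> B" "B < real s0 + 1" using B unfolding s0_def by linarith+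
  have "T \<subseteq> {s0 - D..s0 + 1 + D} \<times> {..K}"
  proof
    fix c assume c: "c \<in> T"
    have "real (fst c) \<le> B + real D" "B \<le> real (fst c) + real D" using T(2)[OF c] by linarith+
    then have "real (fst c) \<le> real (s0 + 1 + D)" "real s0 \<le> real (fst c + D)" using s0 by auto
    then have "fst c \<le> s0 + 1 + D" "s0 \<le> fst c + D" by (simp_all only: of_nat_le_iff)
    then show "c \<in> {s0 - D..s0 + 1 + D} \<times> {..K}" using T(1) c by (cases c) auto
  qed
  then have "card T \<le> card ({s0 - D..s0 + 1 + D} \<times> {..K})" by (intro card_mono) auto
  also have "\<dots> = (Suc (s0 + 1 + D) - (s0 - D)) * (K + 1)" by (simp add: card_cartesian_product)
  also have "\<dots> \<le> (2 * D + 2) * (K + 1)" by (intro mult_le_mono1) simp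
  finally show ?thesis .
qed

text \<open>Here \<open>2 ^ l\<close> is \<open>n\<close> up to a factor 2, and \<open>g\<close>
  plays the part of \<open>sqrt l\<close>. By \<open>small\<close> a class takes \<open>g\<close>
  bits, so a \<open>g\<close>-tuple takes \<open>g * g \<le> l\<close> bits and fits into a word;
  \<open>room\<close> says, in terms of the abbreviations below, that a block is large against its
  guard \<open>G\<close>.\<close>

locale parameters =
  fixes k g l n U :: nat
  assumes n_le: "n \<le> 2 ^ l" and le_n: "2 ^ l \<le> 2 * n" and g2: "g * g \<le> l" and l_ge: "4 * (k + 8) \<le> l"
    and small: "(2 * g ^ 14 + 1) * (40 * (k + 1) * l + 1) \<le> 2 ^ g"
    and l_g: "4 * l \<le> g ^ 7"
    and room: "4 * (40 * (k + 1) * l * (2 * (6 * (2 * (g ^ 7 * l) + 2) * (40 * (k + 1) * l + 1) + g ^ 7 * l * (k * l + 2) + 40 * (k + 1) * l) +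
        40 * (k + 1) * l + 1) + (6 * (2 * (g ^ 7 * l) + 2) * (40 * (k + 1) * l + 1) + g ^ 7 * l * (k * l + 2) + 40 * (k + 1) * l)) \<le> g ^ 14"
    and U_ge: "2 * n \<le> U" and U_le: "U \<le> n ^ k"
begin

text \<open>The factor 40 leaves room for the header and for the index of a trie shape, about
  \<open>26 * (k + 1) * l + 3 * l\<close> bits because \<open>9 ^ 8 \<le> 2 ^ 26\<close>.\<close>

definition b where "b = 40 * (k + 1) * l"
text \<open>The mean number of keys per block up to a factor 4. The guard \<open>G\<close> is of
  order \<open>sqrt c * l ^ 2\<close> and must stay well below \<open>c / b\<close>, so
  \<open>sqrt c\<close> has to exceed the order of \<open>l ^ 3\<close>; for \<open>g\<close> near
  \<open>sqrt l\<close> the first power of \<open>g\<close> to do so is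
  \<open>g ^ 7\<close>.\<close>

definition c where "c = g ^ 14"
text \<open>This is \<open>sqrt c * l\<close>, so that Chernoff's exponent is at least
  \<open>l ^ 2 / 4\<close>.\<close>

definition D where "D = g ^ 7 * l"
text \<open>Since \<open>(2/3)^2 < 1/2\<close>, the tail \<open>(2/3) ^ h\<close> is at most
  \<open>1 / 2 ^ (4 * (k + 1) * l)\<close>, enough for a union bound over all cells.\<close>

definition h where "h = 8 * (k + 1) * l"
text \<open>Bits that each block is sure to place in the shared memory: six per class for the
  hypothesis \<open>classes\<close>, \<open>D * (k * l + 2)\<close> for the variation of the cost
  with the key count, and \<open>b\<close> for the shortfall of a payload against its cost.\<close>

definition G where "G = 6 * (2 * D + 2) * (b + 1) + D * (k * l + 2) + b"
definition v where "v = (SOME v. 2 ^ v * n \<le> U \<and> U < 2 ^ Suc v * n)"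
definition Y where "Y = 2 ^ v * c"
definition m where "m = U div Y + 1"
definition x where "x = real n / real (m * Y - n)"
definition B where "B = real n / real m"
text \<open>At least the number \<open>m * merge_count g 14\<close> of all regroupings, which
  together therefore inflate the weight by at most \<open>exp 1\<close>, a factor below 3.\<close>

definition L :: real where "L = 2 ^ (2 * l)"
definition \<Lambda> where "\<Lambda> = (1 + x) ^ Y * (1 + 1 / L) ^ merge_count g 14"
text \<open>The cost of a block with the mean number of keys; \<open>m * cbar\<close> is the total
  cost of every key set.\<close>

definition cbar where "cbar = log 2 \<Lambda> + B * log 2 (1 / x)"
text \<open>Rounded down after removing the guard, so that \<open>b * E\<close> stays below every
  typical payload length.\<close>

definition E where "E = nat \<lfloor>(cbar - real G) / real b\<rfloor>"
text \<open>What the fixed parts leave over, rounded up only once for all blocks together.\<close>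

definition N where "N = nat \<lceil>real m * (cbar - real (b * E)) / real b\<rceil>"

section \<open>Bounds on the parameters\<close>

lemma l32: "32 \<le> l" using l_ge by simp

lemma l_pos: "0 < l" using l32 by simp

lemma b_ge: "40 * l \<le> b" "40 * k * l \<le> b" "0 < b" unfolding b_def using l_pos by (auto simp: algebra_simps)

lemma b_split: "b = 40 * ((k + 1) * l)" "l \<le> (k + 1) * l" "k * l \<le> (k + 1) * l"
  unfolding b_def by (simp_all add: algebra_simps)

lemma g_pos: "0 < g"
proof (rule ccontr)
  assume "\<not> 0 < g" then have "g = 0" by simp
  then show False using l_g l_pos by simp
qed

lemma g_le: "g \<le> l"
proof -
  have "g * 1 \<le> g * g" using g_pos by (intro mult_le_mono2) simp
  then show ?thesis using g2 by linarith
qed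

lemma c_pos: "0 < c" by (simp add: c_def g_pos)

lemma n_pos: "0 < n"
proof (rule ccontr)
  assume "\<not> 0 < n" then show False using le_n by simp
qed

lemma room': "4 * (b * (2 * G + b + 1) + G) \<le> c"
  using room unfolding b_def G_def D_def c_def by simp

lemma smallc: "(2 * c + 1) * (b + 1) \<le> 2 ^ g"
  using small unfolding b_def c_def by simp

lemma c_less: "2 * c + 1 \<le> 2 ^ l" "c \<le> n" "b \<le> 2 ^ l"
proof -
  have "(2::nat) ^ g \<le> 2 ^ l" using g_le by simp
  then have z: "(2 * c + 1) * (b + 1) \<le> 2 ^ l" using smallc by (rule le_trans[rotated])
  show 1: "2 * c + 1 \<le> 2 ^ l" using z by (rule le_trans[rotated]) simp
  show "b \<le> 2 ^ l" using z by (rule le_trans[rotated]) simp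
  show "c \<le> n" using 1 le_n by linarith
qed

lemma v: "2 ^ v * n \<le> U" "U < 2 ^ Suc v * n"
proof -
  have "n \<le> U" using U_ge by simp
  from someI_ex[OF ex_power_of_two_between[OF n_pos this]]
  show "2 ^ v * n \<le> U" "U < 2 ^ Suc v * n" unfolding v_def by blast+
qed

lemma U_pow: "U \<le> 2 ^ (k * l)"
proof -
  have "U \<le> (2 ^ l) ^ k" using U_le power_mono[OF n_le, of k] by simp
  then show ?thesis by (simp add: power_mult[symmetric] mult.commute)
qed

lemma v_le: "v \<le> b"
proof -
  have "2 ^ v * 1 \<le> 2 ^ v * n" using n_pos by (intro mult_le_mono2) simp
  then have "(2::nat) ^ v \<le> 2 ^ (k * l)" using v(1) U_pow by linarith
  then have "v \<le> k * l" by simp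
  then show ?thesis using b_ge(2) by (simp add: algebra_simps)
qed

lemma Y_pos: "0 < Y" by (simp add: Y_def c_pos)

lemma Y_le: "n * Y \<le> U * c" "U * c < 2 * n * Y" "Y \<le> U"
proof -
  have "n * Y = (2 ^ v * n) * c" by (simp add: Y_def)
  also have "\<dots> \<le> U * c" using v by (intro mult_le_mono1)
  finally show 1: "n * Y \<le> U * c" .
  have "U * c < (2 ^ Suc v * n) * c" using v c_pos by (intro mult_strict_right_mono)
  then show "U * c < 2 * n * Y" by (simp add: Y_def mult_ac)
  have "n * Y \<le> U * n" using 1 c_less(2) by (meson le_trans mult_le_mono2)
  then show "Y \<le> U" using n_pos by (simp add: mult.commute)
qed

lemma mY: "U < m * Y" "m * Y \<le> U + Y" "m * Y \<le> 2 * U"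
proof -
  show "U < m * Y" unfolding m_def using dividend_less_div_times[OF Y_pos, of U] by (simp add: algebra_simps)
  show "m * Y \<le> U + Y" unfolding m_def by (simp add: algebra_simps)
  then show "m * Y \<le> 2 * U" using Y_le(3) by simp
qed

lemma n_less: "n < m * Y" "2 * n < m * Y" using mY(1) U_ge by linarith+

lemma m_pos: "0 < m" by (simp add: m_def)

lemma mY_pow: "real (m * Y + 1) \<le> 2 ^ (k * l + 2)"
proof -
  have "m * Y + 1 \<le> 2 * 2 ^ (k * l) + 1" using mY(3) U_pow by linarith
  also have "\<dots> \<le> 2 ^ (k * l + 2)" by simp
  finally have "real (m * Y + 1) \<le> real (2 ^ (k * l + 2))" by (rule of_nat_mono)
  then show ?thesis by simp
qed

lemma m_c: "m * c \<le> 4 * n"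
proof -
  have "m * c * Y \<le> 2 * (U * c)" using mY(3) by (simp add: mult_ac)
  also have "\<dots> \<le> 4 * n * Y" using Y_le(2) by simp
  finally show ?thesis using Y_pos by simp
qed

lemma x_alt: "x = real n / (real (m * Y) - real n)"
  unfolding x_def using n_less by (simp only: of_nat_diff less_imp_le)

lemma n_less_real: "2 * real n < real (m * Y)"
  using n_less(2) by (metis of_nat_less_iff of_nat_mult of_nat_numeral)

lemma x_pos: "0 < x" and x_le: "x \<le> 1" and x_eq: "x / (1 + x) = real n / real (m * Y)"
proof -
  define u where "u = real (m * Y)"
  have r: "2 * real n < u" unfolding u_def by (rule n_less_real)
  have n0: "0 < real n" using n_pos by simp
  show "0 < x" "x \<le> 1" unfolding x_alt u_def[symmetric] using r n0 by auto
  show "x / (1 + x) = real n / real (m * Y)" unfolding x_alt u_def[symmetric] using r n0 by (simp add: field_simps)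
qed

lemma lam: "2 ^ v * x \<le> 2"
proof -
  define u where "u = real (m * Y)"
  have r: "2 * real n < u" "real U < u"
    unfolding u_def using n_less_real mY(1) by (simp, simp only: of_nat_less_iff)
  have "real (2 ^ v * n) \<le> real U" using v(1) by (simp only: of_nat_le_iff)
  then have "2 ^ v * real n \<le> real U" by simp
  also have "real U \<le> 2 * (u - real n)" using r by argo
  finally show ?thesis unfolding x_alt u_def[symmetric] using r n_pos by (simp add: field_simps)
qed

lemma log_x: "0 \<le> log 2 (1 / x)" "log 2 (1 / x) \<le> real (k * l + 2)"
proof -
  show "0 \<le> log 2 (1 / x)" using x_pos x_le by simp
  have "1 / x \<le> real (m * Y + 1)"
  proof -
    have "1 / x = real (m * Y - n) / real n" by (simp add: x_def)
    also have "\<dots> \<le> real (m * Y - n) / 1" using n_pos by (intro divide_left_mono) auto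
    also have "\<dots> \<le> real (m * Y + 1)" by (simp only: div_by_1 of_nat_le_iff)
    finally show ?thesis .
  qed
  also note mY_pow
  finally have "log 2 (1 / x) \<le> log 2 (2 ^ (k * l + 2))" using x_pos by (intro log_mono) auto
  moreover have "log 2 (2 ^ j) = real j" for j by (simp add: log_nat_power)
  ultimately show "log 2 (1 / x) \<le> real (k * l + 2)" by (simp only:)
qed

lemma B_bounds: "real c \<le> 4 * B" "B \<le> real c" "0 < B" "real m * B = real n"
proof -
  show nB: "real m * B = real n" using m_pos by (simp add: B_def)
  have "real (m * c) \<le> real (4 * n)" using m_c by (simp only: of_nat_le_iff)
  then have "real m * real c \<le> real m * (4 * B)" using nB by simp
  then show "real c \<le> 4 * B" using m_pos by simp
  show "0 < B" using n_pos m_pos by (simp add: B_def)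
  have "n * Y \<le> (m * Y) * c" using Y_le(1) mY(1) by (meson le_trans less_imp_le mult_le_mono1)
  then have "n \<le> m * c" using Y_pos by (simp add: mult.commute mult.left_commute)
  then have "real n \<le> real m * real c" by (metis of_nat_le_iff of_nat_mult)
  then show "B \<le> real c" using m_pos by (simp add: B_def divide_le_eq mult.commute)
qed

lemma D_bounds: "0 < D" "real D \<le> 2 * B" "B + real D \<le> real (2 * c)"
proof -
  show "0 < D" by (simp add: D_def g_pos l_pos)
  have "4 * D = g ^ 7 * (4 * l)" by (simp add: D_def)
  also have "\<dots> \<le> g ^ 7 * g ^ 7" using l_g by (intro mult_le_mono2)
  also have "\<dots> = c" by (simp add: c_def flip: power_add)
  finally have "4 * real D \<le> real c" by (metis of_nat_le_iff of_nat_mult of_nat_numeral)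
  then show "real D \<le> 2 * B" "B + real D \<le> real (2 * c)" using B_bounds by (auto simp: of_nat_mult)
qed

lemma few_bad: "2 * card {X. X \<subseteq> {..<m * Y} \<and> card X = n \<and>
     \<not> (\<forall>i<m. (cells_good v h (part Y i X) \<and> card (part Y i X) \<le> 2 * c) \<and> \<bar>real (card (part Y i X)) - B\<bar> \<le> real D)}
     \<le> m * Y choose n"
proof (rule few_bad_sets)
  show "Y = 2 ^ v * c" by (rule Y_def)
  have m4: "real m \<le> 2 ^ (l + 2)" "real (m * c) \<le> 2 ^ (l + 2)"
  proof -
    have mc: "m * c \<le> 2 ^ (l + 2)" using m_c n_le by simp
    moreover have "m * 1 \<le> m * c" using c_pos by (intro mult_le_mono2) simp
    ultimately have "m \<le> 2 ^ (l + 2)" by linarith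
    then have "real m \<le> real (2 ^ (l + 2))" by (rule of_nat_mono)
    then show "real m \<le> 2 ^ (l + 2)" by simp
    have "real (m * c) \<le> real (2 ^ (l + 2))" using mc by (rule of_nat_mono)
    then show "real (m * c) \<le> 2 ^ (l + 2)" by simp
  qed
  show "real (m * Y + 1) * (real m * (2 * exp (- (real D)\<^sup>2 / (4 * B)))) \<le> 1 / 4"
  proof -
    have "real l * real l / 4 \<le> (real D)\<^sup>2 / (4 * B)"
    proof -
      have "(real D)\<^sup>2 = real c * (real l * real l)"
        by (simp add: D_def c_def power2_eq_square power_mult_distrib flip: power_add)
      then have "B * (real l * real l) \<le> (real D)\<^sup>2" using B_bounds(2) by (simp add: mult_right_mono)
      then show ?thesis using B_bounds(3) by (simp add: field_simps)
    qed
    then have "exp (- (real D)\<^sup>2 / (4 * B)) \<le> exp (- (real l * real l / 4))" by simp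
    also have "\<dots> \<le> exp (- real ((k + 8) * l) * ln 2)"
    proof -
      have "real (4 * (k + 8)) * real l \<le> real l * real l"
        using l_ge by (intro mult_right_mono of_nat_mono) auto
      moreover have "real ((k + 8) * l) * ln 2 \<le> real ((k + 8) * l) * 1"
        using ln_2_less_1 by (intro mult_left_mono) auto
      ultimately show ?thesis by (simp add: algebra_simps)
    qed
    also have "\<dots> = 1 / 2 ^ ((k + 8) * l)"
    proof -
      have "exp (- real j * ln 2) = 1 / 2 ^ j" for j by (simp add: exp_minus exp_of_nat_mult divide_inverse)
      then show ?thesis by blast
    qed
    finally have e: "exp (- (real D)\<^sup>2 / (4 * B)) \<le> 1 / 2 ^ ((k + 8) * l)" .
    have "real (m * Y + 1) * (real m * (2 * exp (- (real D)\<^sup>2 / (4 * B)))) \<le>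
        2 ^ (k * l + 2) * (2 ^ (l + 2) * (2 * (1 / 2 ^ ((k + 8) * l))))"
      using e mY_pow m4 by (intro mult_mono) auto
    also have "\<dots> = 2 ^ (k * l + 2 + (l + 2) + 1) / 2 ^ ((k + 8) * l)" by (simp add: power_add)
    also have "\<dots> \<le> 1 / 4"
    proof -
      have "k * l + 2 + (l + 2) + 1 + 2 \<le> (k + 8) * l" using l32 by (simp add: algebra_simps)
      then have "(2::real) ^ (k * l + 2 + (l + 2) + 1 + 2) \<le> 2 ^ ((k + 8) * l)" by (intro power_increasing) auto
      then show ?thesis by (simp add: field_simps power_add)
    qed
    finally show ?thesis .
  qed
  show "real (m * Y + 1) * (real (m * c) * ((2 / 3) ^ h * exp 6)) \<le> 1 / 4"
  proof -
    have "h = 2 * (4 * (k + 1) * l)" by (simp add: h_def algebra_simps)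
    then have "(2/3::real) ^ h = ((2/3)\<^sup>2) ^ (4 * (k + 1) * l)" by (simp only: power_mult)
    also have "\<dots> \<le> (1/2) ^ (4 * (k + 1) * l)" by (intro power_mono) (auto simp: power2_eq_square)
    finally have h: "(2/3::real) ^ h \<le> 1 / 2 ^ (4 * (k + 1) * l)" by (simp add: power_one_over)
    have "exp (6::real) = exp 1 ^ 6" by (simp flip: exp_of_nat_mult)
    also have "\<dots> \<le> 3 ^ 6" using exp_le by (intro power_mono) auto
    also have "\<dots> \<le> 2 ^ 10" by simp
    finally have e: "exp (6::real) \<le> 2 ^ 10" .
    have "real (m * Y + 1) * (real (m * c) * ((2 / 3) ^ h * exp 6)) \<le>
        2 ^ (k * l + 2) * (2 ^ (l + 2) * ((1 / 2 ^ (4 * (k + 1) * l)) * 2 ^ 10))"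
      using h e mY_pow m4 by (intro mult_mono) auto
    also have "\<dots> = 2 ^ (k * l + 2 + (l + 2) + 10) / 2 ^ (4 * (k + 1) * l)" by (simp add: power_add)
    also have "\<dots> \<le> 1 / 4"
    proof -
      have "k * l + 2 + (l + 2) + 10 + 2 \<le> 4 * (k + 1) * l" using l32 by (simp add: algebra_simps)
      then have "(2::real) ^ (k * l + 2 + (l + 2) + 10 + 2) \<le> 2 ^ (4 * (k + 1) * l)" by (intro power_increasing) auto
      then show ?thesis by (simp add: field_simps power_add)
    qed
    finally show ?thesis .
  qed
qed (use c_pos n_pos n_less D_bounds lam in \<open>auto simp: x_def B_def\<close>)


lemma L_ge: "1 \<le> L" by (simp add: L_def)

lemma \<Lambda>_ge: "(1 + x) ^ Y \<le> \<Lambda>" "0 < \<Lambda>"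
proof -
  have "(1 + x) ^ Y * 1 \<le> (1 + x) ^ Y * (1 + 1 / L) ^ merge_count g 14"
    using x_pos L_ge by (intro mult_left_mono one_le_power) auto
  then show 1: "(1 + x) ^ Y \<le> \<Lambda>" by (simp add: \<Lambda>_def)
  show "0 < \<Lambda>" using 1 x_pos by (meson add_pos_pos less_le_trans zero_less_one zero_less_power)
qed

lemma \<Lambda>_le: "\<Lambda> ^ m \<le> 3 * (1 + x) ^ (m * Y)"
proof -
  have "m * merge_count g 14 \<le> m * (2 * g) ^ 14" using merge_count_le[OF g_pos] by (intro mult_le_mono2)
  also have "\<dots> = 2 ^ 14 * (m * c)" by (simp add: c_def power_mult_distrib)
  also have "\<dots> \<le> 2 ^ 14 * (4 * 2 ^ l)" using m_c n_le by (intro mult_le_mono2) simp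
  also have "\<dots> = 2 ^ (16 + l)" by (simp add: power_add)
  also have "\<dots> \<le> 2 ^ (2 * l)" using l32 by (intro power_increasing) auto
  finally have "real (m * merge_count g 14) \<le> real (2 ^ (2 * l))" by (rule of_nat_mono)
  then have mL: "real (m * merge_count g 14) / L \<le> 1" by (simp add: L_def)
  have "(1 + 1 / L) ^ (m * merge_count g 14) \<le> exp (1 / L) ^ (m * merge_count g 14)"
    using L_ge by (intro power_mono exp_ge_add_one_self) auto
  also have "\<dots> = exp (real (m * merge_count g 14) / L)" by (simp flip: exp_of_nat_mult)
  also have "\<dots> \<le> exp 1" using mL by simp
  also have "\<dots> \<le> 3" by (rule exp_le)
  finally have "(1 + 1 / L) ^ (m * merge_count g 14) \<le> 3" .
  then have "(1 + x) ^ (m * Y) * (1 + 1 / L) ^ (m * merge_count g 14) \<le> (1 + x) ^ (m * Y) * 3"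
    using x_pos by (intro mult_left_mono) auto
  moreover have "\<Lambda> ^ m = (1 + x) ^ (m * Y) * (1 + 1 / L) ^ (m * merge_count g 14)"
    unfolding \<Lambda>_def by (simp add: power_mult_distrib power_mult[symmetric] mult.commute)
  ultimately show ?thesis by (simp add: mult.commute)
qed

text \<open>Each expected key costs at least one bit, because \<open>log 2 (1 + x)\<close> is at
  least \<open>x / (1 + x)\<close>. With \<open>c \<le> 4 * B\<close> this makes \<open>E\<close>
  large against \<open>G\<close>.\<close>

lemma cbar_ge: "B \<le> cbar"
proof -
  have "B = real Y * (x / (1 + x))" unfolding x_eq B_def using Y_pos by simp
  also have "x / (1 + x) \<le> ln (1 + x)"
  proof -
    have "ln (1 / (1 + x)) \<le> 1 / (1 + x) - 1" using x_pos by (intro ln_le_minus_one) auto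
    also have "\<dots> = - (x / (1 + x))" using x_pos by (simp add: field_simps)
    finally show ?thesis using x_pos by (simp add: ln_div)
  qed
  also have "ln (1 + x) \<le> log 2 (1 + x)"
  proof -
    have "ln (1 + x) * ln 2 \<le> ln (1 + x) * 1" using x_pos ln_2_less_1 by (intro mult_left_mono) auto
    then show ?thesis by (simp add: log_def pos_le_divide_eq)
  qed
  also have "real Y * log 2 (1 + x) = log 2 ((1 + x) ^ Y)" using x_pos by (simp add: log_nat_power)
  also have "\<dots> \<le> log 2 \<Lambda>" using \<Lambda>_ge x_pos by (intro log_mono) auto
  also have "\<dots> \<le> cbar" unfolding cbar_def using B_bounds(3) log_x(1) by simp
  finally show ?thesis by (simp add: mult_left_mono)
qed

lemma E_bounds: "real (b * E) \<le> cbar - real G" "cbar - real G < real (b * E) + real b"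
  "real (2 * G + b + 1) \<le> real E"
proof -
  have b0: "0 < real b" using b_ge by simp
  have "real (4 * (b * (2 * G + b + 1) + G)) \<le> real c" using room' by (simp only: of_nat_le_iff)
  then have "real b * real (2 * G + b + 1) + real G \<le> real c / 4" by (simp add: algebra_simps)
  also have "\<dots> \<le> cbar" using B_bounds(1) cbar_ge by linarith
  finally have "real (2 * G + b + 1) * real b \<le> cbar - real G" by (simp add: mult.commute)
  then have q: "real (2 * G + b + 1) \<le> (cbar - real G) / real b" using b0 by (simp only: pos_le_divide_eq)
  have fl: "real E = real_of_int \<lfloor>(cbar - real G) / real b\<rfloor>"
    unfolding E_def using q by (intro of_nat_nat) linarith
  show "real (2 * G + b + 1) \<le> real E" unfolding fl using q
    by (metis le_floor_iff of_int_le_iff of_int_of_nat_eq)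
  have "real E \<le> (cbar - real G) / real b" unfolding fl by linarith
  then show "real (b * E) \<le> cbar - real G" using b0 by (simp add: pos_le_divide_eq mult.commute)
  have "(cbar - real G) / real b < real E + 1" unfolding fl by linarith
  then show "cbar - real G < real (b * E) + real b" using b0 by (simp add: pos_divide_less_eq algebra_simps)
qed

lemma N_bounds: "real m * (cbar - real (b * E)) \<le> real b * real N"
  "real b * real N \<le> real m * (cbar - real (b * E)) + real b" "0 < N" "N \<le> 4 * n + 1"
proof -
  define q where "q = real m * (cbar - real (b * E)) / real b"
  have b0: "0 < real b" using b_ge by simp
  have Gm: "real m * real G \<le> real m * (cbar - real (b * E))"
    using E_bounds(1) by (intro mult_left_mono) auto
  have "0 < G" unfolding G_def using b_ge by simp
  then have G0: "0 < real G" by simp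
  have q0: "0 < q"
  proof -
    have "0 < real m * real G" using m_pos G0 by simp
    then show ?thesis unfolding q_def using Gm b0 by (intro divide_pos_pos) auto
  qed
  have N: "real N = real_of_int \<lceil>q\<rceil>" unfolding N_def q_def[symmetric] using q0 by (intro of_nat_nat) linarith
  have qb: "q * real b = real m * (cbar - real (b * E))" using b0 by (simp add: q_def)
  have "q \<le> real N" unfolding N by linarith
  then have "q * real b \<le> real N * real b" using b0 by (intro mult_right_mono) auto
  then show "real m * (cbar - real (b * E)) \<le> real b * real N" using qb by (simp add: mult.commute)
  have Nq: "real N \<le> q + 1" unfolding N by linarith
  then have "real N * real b \<le> (q + 1) * real b" using b0 by (intro mult_right_mono) auto
  then show "real b * real N \<le> real m * (cbar - real (b * E)) + real b" using qb by (simp add: algebra_simps)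
  have "0 < real N" using q0 unfolding N by linarith
  then show "0 < N" by simp
  have "q \<le> real m * (real G + real b) / real b"
    unfolding q_def using E_bounds(2) b0 by (intro divide_right_mono mult_left_mono) auto
  also have "\<dots> \<le> real m * (real G + real b) / 1"
    using b_ge by (intro divide_left_mono) auto
  also have "\<dots> \<le> real m * real c"
  proof -
    have "1 * G \<le> 4 * G" "b * 1 \<le> b * (2 * G + b + 1)" by (simp, intro mult_le_mono2, simp)
    then have "G + b \<le> c" using room' by (simp add: distrib_left)
    then have "real (G + b) \<le> real c" by (rule of_nat_mono)
    then show ?thesis by (simp add: mult_left_mono)
  qed
  also have "\<dots> = real (m * c)" by simp
  also have "\<dots> \<le> real (4 * n)" using m_c by (rule of_nat_mono)
  finally have "real N \<le> real (4 * n + 1)" using Nq by simp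
  then show "N \<le> 4 * n + 1" by (simp only: of_nat_le_iff)
qed

lemma N_pow: "real (N + 1) \<le> 2 ^ (l + 3)"
proof -
  have "4 \<le> (2::nat) ^ l" using l32 power_increasing[of 2 l "2::nat"] by simp
  then have "N + 1 \<le> 2 ^ (l + 3)" using N_bounds(4) n_le by (simp add: power_add)
  then have "real (N + 1) \<le> real (2 ^ (l + 3))" by (rule of_nat_mono)
  then show ?thesis by simp
qed

section \<open>Instantiating the construction\<close>

lemma scheme:
  "\<exists>T M de qr. desc_scheme b 16 Y (\<lambda>A. cells_good v h A \<and> card A \<le> 2 * c) T M fst de qr \<and>
     T \<subseteq> {..2 * c} \<times> {..b} \<and> (\<Sum>c\<in>T. 2 ^ M c * x ^ fst c) \<le> \<Lambda> \<and> (\<forall>c\<in>T. \<Lambda> \<le> 2 ^ b * 2 ^ M c * x ^ fst c)"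
proof -
  have "(2 * c + 1) * 1 \<le> 2 ^ l" using c_less(1) by simp
  then have "real (2 * c + 1) \<le> real (2 ^ l)" by (intro of_nat_mono) simp
  then have s: "real (2 * c + 1) \<le> 2 ^ l" by simp
  have "\<exists>T M de qr. desc_scheme b (14 + 2) (2 ^ v * g ^ 14) (\<lambda>A. cells_good v h A \<and> card A \<le> 2 * c) T M fst de qr \<and>
     T \<subseteq> {..2 * c} \<times> {..b} \<and>
     (\<Sum>c\<in>T. 2 ^ M c * x ^ fst c) \<le> (1 + x) ^ (2 ^ v * g ^ 14) * (1 + 1 / L) ^ merge_count g 14 \<and>
     (\<forall>c\<in>T. (1 + x) ^ (2 ^ v * g ^ 14) * (1 + 1 / L) ^ merge_count g 14 \<le> 2 ^ b * 2 ^ M c * x ^ fst c)"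
  proof (rule block_scheme)
    show "4 * ((3 * 9 ^ h + 1) * real (2 * c + 1) * L) \<le> 2 ^ b"
    proof -
      have "h = 8 * ((k + 1) * l)" by (simp add: h_def algebra_simps)
      then have "(9::real) ^ h = (9 ^ 8) ^ ((k + 1) * l)" by (simp only: power_mult)
      also have "\<dots> \<le> (2 ^ 26) ^ ((k + 1) * l)" by (intro power_mono) auto
      also have "\<dots> = 2 ^ (26 * ((k + 1) * l))" by (simp only: power_mult)
      finally have n9: "(9::real) ^ h \<le> 2 ^ (26 * ((k + 1) * l))" .
      have "(3::real) * 9 ^ h + 1 \<le> 4 * 2 ^ (26 * ((k + 1) * l))"
        using n9 one_le_power[of "2::real" "26 * ((k + 1) * l)"] by linarith
      then have "4 * ((3 * 9 ^ h + 1) * real (2 * c + 1) * L) \<le> 4 * (4 * 2 ^ (26 * ((k + 1) * l)) * 2 ^ l * 2 ^ (2 * l))"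
        using s unfolding L_def by (intro mult_left_mono mult_mono) auto
      also have "\<dots> = 2 ^ (4 + 26 * ((k + 1) * l) + l + 2 * l)"
        by (simp only: power_add) simp
      also have "\<dots> \<le> 2 ^ b"
        using l32 b_split by (intro power_increasing) linarith+
      finally show ?thesis .
    qed
    show "4 * ((real ((2 * c + 1) * (b + 1)) ^ g + 1) * real (2 * c + 1) * L) \<le> 2 ^ b"
    proof -
      \<comment> \<open>By \<open>smallc\<close> one class takes \<open>g\<close> bits, hence a
        \<open>g\<close>-tuple takes \<open>g * g \<le> l\<close> bits.\<close>
      have "((2 * c + 1) * (b + 1)) ^ g \<le> (2 ^ g) ^ g" using smallc by (intro power_mono) auto
      also have "\<dots> = 2 ^ (g * g)" by (simp add: power_mult)
      also have "\<dots> \<le> 2 ^ l" using g2 by (intro power_increasing) auto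
      finally have "real (((2 * c + 1) * (b + 1)) ^ g) \<le> real (2 ^ l)" by (rule of_nat_mono)
      then have "real ((2 * c + 1) * (b + 1)) ^ g \<le> 2 ^ l" by (simp only: of_nat_power of_nat_numeral)
      then have "real ((2 * c + 1) * (b + 1)) ^ g + 1 \<le> 2 * 2 ^ l" using one_le_power[of "2::real" l] by linarith
      then have "4 * ((real ((2 * c + 1) * (b + 1)) ^ g + 1) * real (2 * c + 1) * L) \<le> 4 * (2 * 2 ^ l * 2 ^ l * 2 ^ (2 * l))"
        using s unfolding L_def by (intro mult_left_mono mult_mono) auto
      also have "\<dots> = 2 ^ (3 + l + l + 2 * l)" by (simp only: power_add) simp
      also have "\<dots> \<le> 2 ^ b"
        using l32 b_ge(1) by (intro power_increasing) auto
      finally show ?thesis .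
    qed
  qed (use x_pos L_ge g_pos v_le in auto)
  then show ?thesis unfolding \<Lambda>_def Y_def c_def[symmetric] by simp
qed

lemma encoding:
  "\<exists>Q. (\<forall>x'. qlocal b 85 (Q x')) \<and>
     (\<forall>S \<in> key_sets U n. \<exists>f \<subseteq> {..<(N + 1) * b + m * (b * E)}. \<forall>x'<U. Q x' f \<longleftrightarrow> x' \<in> S)"
proof -
  obtain T0 M de qr where
    D0: "desc_scheme b 16 Y (\<lambda>A. cells_good v h A \<and> card A \<le> 2 * c) T0 M fst de qr" and
    T0: "T0 \<subseteq> {..2 * c} \<times> {..b}" and S0: "(\<Sum>c\<in>T0. 2 ^ M c * x ^ fst c) \<le> \<Lambda>" and
    low: "\<And>c. c \<in> T0 \<Longrightarrow> \<Lambda> \<le> 2 ^ b * 2 ^ M c * x ^ fst c"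
    using scheme by blast
  \<comment> \<open>Typical key counts only: this keeps the number of classes and the spread of the
    costs within the guard.\<close>
  define q where "q s \<longleftrightarrow> \<bar>real s - B\<bar> \<le> real D" for s :: nat
  define T where "T = {c \<in> T0. q (fst c)}"
  have fin: "finite T0" using D0 by (simp add: desc_scheme_def)
  have cardT: "card T \<le> (2 * D + 2) * (b + 1)"
    using T0 B_bounds(3) by (intro card_near_le[where B = B]) (auto simp: T_def q_def)
  \<comment> \<open>A payload is never longer than the cost of its sets, by \<open>S0\<close>, and
    at most \<open>b\<close> bits shorter, by \<open>low\<close>.\<close>
  have logs: "real (M c) \<le> log 2 \<Lambda> + real (fst c) * log 2 (1 / x)" "log 2 \<Lambda> + real (fst c) * log 2 (1 / x) \<le> real (M c) + real b"
    if c: "c \<in> T0" for c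
  proof -
    have e: "log 2 (2 ^ j * x ^ s) = real j - real s * log 2 (1 / x)" for j s
      using x_pos by (simp add: log_mult log_nat_power log_divide)
    have "2 ^ M c * x ^ fst c \<le> (\<Sum>c\<in>T0. 2 ^ M c * x ^ fst c)"
      using c fin x_pos by (intro member_le_sum) auto
    then have "2 ^ M c * x ^ fst c \<le> \<Lambda>" using S0 by linarith
    then have "log 2 (2 ^ M c * x ^ fst c) \<le> log 2 \<Lambda>" using x_pos by (intro log_mono) auto
    then show "real (M c) \<le> log 2 \<Lambda> + real (fst c) * log 2 (1 / x)" unfolding e by linarith
    have "\<Lambda> \<le> 2 ^ (b + M c) * x ^ fst c" using low[OF c] by (simp add: power_add)
    then have "log 2 \<Lambda> \<le> log 2 (2 ^ (b + M c) * x ^ fst c)" using \<Lambda>_ge by (intro log_mono) auto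
    then show "log 2 \<Lambda> + real (fst c) * log 2 (1 / x) \<le> real (M c) + real b" unfolding e by simp
  qed
  have GD: "6 * real (card T) + real D * log 2 (1 / x) + real b \<le> real G"
  proof -
    have "6 * card T \<le> 6 * ((2 * D + 2) * (b + 1))" using cardT by simp
    then have "6 * real (card T) \<le> real (6 * ((2 * D + 2) * (b + 1)))"
      by (metis of_nat_le_iff of_nat_mult of_nat_numeral)
    moreover have "real D * log 2 (1 / x) \<le> real D * real (k * l + 2)" using log_x(2) by (intro mult_left_mono) auto
    moreover have "real G = real (6 * ((2 * D + 2) * (b + 1))) + real D * real (k * l + 2) + real b"
      unfolding G_def by (simp only: of_nat_add of_nat_mult mult.assoc)
    ultimately show ?thesis by linarith
  qed
  have near: "cbar - real D * log 2 (1 / x) \<le> log 2 \<Lambda> + real s * log 2 (1 / x)"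
    "log 2 \<Lambda> + real s * log 2 (1 / x) \<le> cbar + real D * log 2 (1 / x)" if "q s" for s
  proof -
    have "(B - real D) * log 2 (1 / x) \<le> real s * log 2 (1 / x)" "real s * log 2 (1 / x) \<le> (B + real D) * log 2 (1 / x)"
      using that log_x(1) unfolding q_def by (intro mult_right_mono; linarith)+
    then show "cbar - real D * log 2 (1 / x) \<le> log 2 \<Lambda> + real s * log 2 (1 / x)"
      "log 2 \<Lambda> + real s * log 2 (1 / x) \<le> cbar + real D * log 2 (1 / x)"
      unfolding cbar_def by (simp_all add: algebra_simps)
  qed
  have mcbar: "real m * log 2 \<Lambda> + real n * log 2 (1 / x) = real m * cbar"
    unfolding cbar_def B_bounds(4)[symmetric] by (simp add: algebra_simps)
  interpret A: block_array b 16 Y m n N E x \<Lambda> "\<lambda>A. (cells_good v h A \<and> card A \<le> 2 * c) \<and> q (card A)" T M de qr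
  proof
    show "desc_scheme b 16 Y (\<lambda>A. (cells_good v h A \<and> card A \<le> 2 * c) \<and> q (card A)) T M fst de qr"
      unfolding T_def by (rule desc_scheme_restrict[OF D0])
    show "0 < b" "0 < Y" "0 < N" "0 < \<Lambda>" "0 < n" "n < m * Y" "x = real n / real (m * Y - n)"
      using b_ge Y_pos N_bounds \<Lambda>_ge n_pos n_less by (auto simp: x_def)
    show "0 < E" using E_bounds(3) by (metis gr0I of_nat_0 of_nat_le_0_iff add_eq_0_iff_both_eq_0 zero_neq_one)
    have "(\<Sum>c\<in>T. 2 ^ M c * x ^ fst c) \<le> (\<Sum>c\<in>T0. 2 ^ M c * x ^ fst c)"
      unfolding T_def using fin x_pos by (intro sum_mono2) auto
    then show "(\<Sum>c\<in>T. 2 ^ M c * x ^ fst c) \<le> \<Lambda>" using S0 by linarith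
    show "b * E \<le> M c" if "c \<in> T" for c
    proof -
      have c: "c \<in> T0" "q (fst c)" using that by (auto simp: T_def)
      have "real (b * E) \<le> real (M c)" using E_bounds(1) GD near(1)[OF c(2)] logs(2)[OF c(1)] by linarith
      then show ?thesis by (simp only: of_nat_le_iff)
    qed
    \<comment> \<open>A payload exceeds \<open>b * E\<close> by less than \<open>2 * G + b\<close>,
      and \<open>E\<close> is at least that large.\<close>
    show "M c \<le> b * E + E" if "c \<in> T" for c
    proof -
      have c: "c \<in> T0" "q (fst c)" using that by (auto simp: T_def)
      have "real (2 * G + b + 1) = 2 * real G + real b + 1" by simp
      then have "real (M c) \<le> real (b * E + E)"
        using E_bounds(2,3) GD near(2)[OF c(2)] logs(1)[OF c(1)] unfolding of_nat_add[of "b * E"] by linarith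
      then show ?thesis by (simp only: of_nat_le_iff)
    qed
    show "real N ^ 4 \<le> 2 ^ b"
    proof -
      have "real N ^ 4 \<le> (2 ^ (l + 3)) ^ 4" 
      proof (rule power_mono)
        show "real N \<le> 2 ^ (l + 3)" using N_pow by linarith
      qed simp
      also have "\<dots> = 2 ^ ((l + 3) * 4)" by (simp only: power_mult)
      also have "\<dots> \<le> 2 ^ b" using b_ge(1) l32 by (intro power_increasing) auto
      finally show ?thesis .
    qed
    show "real m * log 2 \<Lambda> + real n * log 2 (1 / x) - real m * real (b * E) \<le> real b * real N"
      unfolding mcbar using N_bounds(1) by (simp only: right_diff_distrib)
    have "real m * (6 * real (card T)) \<le> real m * (cbar - real (b * E))"
    proof (rule mult_left_mono)
      have "0 \<le> real D * log 2 (1 / x)" using log_x(1) by simp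
      then show "6 * real (card T) \<le> cbar - real (b * E)" using GD E_bounds(1) by linarith
    qed simp
    also note N_bounds(1)
    finally show "6 * real m * real (card T) \<le> real b * real N" by (simp only: mult_ac)
    show "\<Lambda> ^ m \<le> 3 * (1 + x) ^ (m * Y)" by (rule \<Lambda>_le)
    show "2 * card {X. X \<subseteq> {..<m * Y} \<and> card X = n \<and> \<not> (\<forall>i<m. (cells_good v h (part Y i X) \<and> card (part Y i X) \<le> 2 * c) \<and> q (card (part Y i X)))} \<le> m * Y choose n"
      using few_bad unfolding q_def .
  qed
  have "\<exists>Q. (\<forall>x'. qlocal b (5 + 16 * 5) (Q x')) \<and>
     (\<forall>S \<in> key_sets U n. \<exists>f \<subseteq> {..<(N + 1) * b + m * (b * E)}. \<forall>x'<U. Q x' f \<longleftrightarrow> x' \<in> S)"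
  proof (rule A.block_array_encoding)
    show "U \<le> m * Y" using mY(1) by simp
    have "real U \<le> real (2 ^ (k * l))" using U_pow by (rule of_nat_mono)
    then have "real U \<le> 2 ^ (k * l)" by simp
    then have "real U * (16 * (real (m * Y + 1) * real (N + 1))) \<le> 2 ^ (k * l) * (2 ^ 4 * (2 ^ (k * l + 2) * 2 ^ (l + 3)))"
      using mY_pow N_pow by (intro mult_mono) auto
    also have "\<dots> = 2 ^ (k * l + (4 + ((k * l + 2) + (l + 3))))" by (simp only: power_add)
    also have "\<dots> \<le> 2 ^ b" using l32 b_split by (intro power_increasing) linarith+
    finally show "real U * (16 * (real (m * Y + 1) * real (N + 1))) \<le> 2 ^ b" .
  qed
  then show ?thesis by simp
qed

text \<open>Fixed parts and shared words add up to the total cost \<open>m * cbar\<close>, apart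
  from rounding \<open>N\<close> and the header. That cost exceeds
  \<open>log 2 (m * Y choose n)\<close> by at most the logarithms of 3 and \<open>m * Y + 1\<close>,
  and padding the universe to \<open>m * Y\<close> adds at most
  \<open>2 * c / ln 2 \<le> 3 * c\<close>.\<close>

lemma space:
  "real ((N + 1) * b + m * (b * E)) \<le> log 2 (real (U choose n)) + real (3 * c + 2 * b + k * l + 4)"
proof -
  have "real ((N + 1) * b + m * (b * E)) = real b * real N + real b + real m * real (b * E)"
    by (simp add: algebra_simps)
  also have "\<dots> \<le> real m * cbar + 2 * real b" using N_bounds(2) by (simp add: right_diff_distrib)
  also have "real m * cbar = log 2 (\<Lambda> ^ m) + real n * log 2 (1 / x)"
  proof -
    have "real m * cbar = real m * log 2 \<Lambda> + (real m * B) * log 2 (1 / x)" unfolding cbar_def by (simp add: algebra_simps)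
    then show ?thesis using \<Lambda>_ge by (simp add: B_bounds(4) log_nat_power)
  qed
  also have "log 2 (\<Lambda> ^ m) \<le> log 2 (3 * (real (m * Y + 1) * (real (m * Y choose n) * x ^ n)))"
  proof (rule log_mono)
    have "\<Lambda> ^ m \<le> 3 * (1 + x) ^ (m * Y)" by (rule \<Lambda>_le)
    also have "\<dots> \<le> 3 * (real (m * Y + 1) * (real (m * Y choose n) * x ^ n))"
      using binomial_max_term[OF n_pos n_less(1) x_def] by simp
    finally show "\<Lambda> ^ m \<le> 3 * (real (m * Y + 1) * (real (m * Y choose n) * x ^ n))" .
  qed (use \<Lambda>_ge in auto)
  also have "\<dots> = log 2 3 + log 2 (real (m * Y + 1)) + log 2 (real (m * Y choose n)) - real n * log 2 (1 / x)"
  proof -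
    have "0 < real (m * Y choose n)" using n_less by simp
    moreover have "0 < real (m * Y + 1)" by (simp only: of_nat_0_less_iff)
    ultimately show ?thesis using x_pos by (simp add: log_mult log_nat_power log_divide del: of_nat_add of_nat_mult)
  qed
  finally have 1: "real ((N + 1) * b + m * (b * E)) \<le> log 2 3 + log 2 (real (m * Y + 1)) + log 2 (real (m * Y choose n)) + 2 * real b"
    by linarith
  have l3: "log 2 3 \<le> (2::real)" by (simp add: log_le_iff)
  have "log 2 (real (m * Y + 1)) \<le> log 2 (2 ^ (k * l + 2))"
    by (intro log_mono mY_pow) (simp_all del: of_nat_add of_nat_mult)
  moreover have "log 2 (2 ^ j) = real j" for j by (simp add: log_nat_power)
  ultimately have l2: "log 2 (real (m * Y + 1)) \<le> real (k * l + 2)" by (simp only:)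
  have nU: "n < U" using U_ge n_pos by linarith
  have lb: "log 2 (real (m * Y choose n)) \<le> log 2 (real (U choose n)) + 3 * real c"
  proof -
    have Upos: "0 < real (U choose n)" using nU by simp
    have "real n * real (m * Y - U) / real (U - n) \<le> 2 * real c"
    proof -
      have "n * (m * Y - U) \<le> n * Y" using mY(2) by (intro mult_le_mono2) simp
      also have "\<dots> \<le> U * c" by (rule Y_le(1))
      also have "\<dots> \<le> (2 * (U - n)) * c" using U_ge by (intro mult_le_mono1) simp
      finally have "real (n * (m * Y - U)) \<le> real (2 * (U - n) * c)" by (rule of_nat_mono)
      then have "real n * real (m * Y - U) \<le> 2 * real c * real (U - n)" by (simp only: of_nat_mult of_nat_numeral mult_ac)
      moreover have "0 < real (U - n)" using nU by (simp only: of_nat_0_less_iff zero_less_diff)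
      ultimately show ?thesis by (simp only: pos_divide_le_eq)
    qed
    then have "real (m * Y choose n) \<le> real (U choose n) * exp (2 * real c)"
      using binomial_ratio_le[OF nU less_imp_le[OF mY(1)]]
      by (meson exp_le_cancel_iff mult_left_mono of_nat_0_le_iff order_trans)
    moreover have "0 < real (m * Y choose n)" using n_less by simp
    ultimately have "log 2 (real (m * Y choose n)) \<le> log 2 (real (U choose n) * exp (2 * real c))" by (intro log_mono) auto
    also have "\<dots> = log 2 (real (U choose n)) + 2 * real c / ln 2"
    proof -
      have "ln (real (U choose n) * exp (2 * real c)) = ln (real (U choose n)) + 2 * real c"
        using Upos by (subst ln_mult_pos) auto
      then show ?thesis by (simp add: log_def add_divide_distrib)
    qed
    also have "2 * real c / ln 2 \<le> 3 * real c"
    proof -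
      have "2 * real c = 3 * real c * (2/3)" by simp
      also have "\<dots> \<le> 3 * real c * ln 2" using ln2_ge_two_thirds by (intro mult_left_mono) auto
      finally show ?thesis by (simp add: pos_divide_le_eq)
    qed
    finally show ?thesis by simp
  qed
  have "real (3 * c + 2 * b + k * l + 4) = 2 + real (k * l + 2) + 3 * real c + 2 * real b" by simp
  then show ?thesis using 1 l3 l2 lb by linarith
qed

end

subsection \<open>The data structure\<close>

text \<open>Everything is expressed in powers of \<open>g\<close> through
  \<open>l \<le> 4 * g ^ 2\<close>. \<open>room\<close> weighs \<open>g ^ 14\<close> against a
  multiple of \<open>(k + 1)^2 * g ^ 13\<close>, whence the constant 20000000; \<open>small\<close>
  is of order \<open>(k + 1) * g ^ 16\<close> and follows from
  \<open>g ^ 17 \<le> 2 ^ g\<close>.\<close>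

lemma parameters_large:
  fixes k g l :: nat
  assumes g: "20000000 * (k + 1)\<^sup>2 \<le> g" and pw: "g ^ 17 \<le> 2 ^ g"
    and l: "g * g \<le> l" "l < (g + 1) * (g + 1)"
    and n: "n \<le> 2 ^ l" "2 ^ l \<le> 2 * n" and U: "2 * n \<le> U" "U \<le> n ^ k"
  shows "parameters k g l n U"
proof -
  define q where "q = k + 1"
  have q: "1 \<le> q" by (simp add: q_def)
  have g': "20000000 * (q * q) \<le> g" using g by (simp add: q_def power2_eq_square)
  have "20000000 * (1 * 1) \<le> 20000000 * (q * q)" using q by (intro mult_le_mono2 mult_le_mono) auto
  then have g1: "20000000 \<le> g" using g' by linarith
  have "20000000 * (1 * q) \<le> 20000000 * (q * q)" using q by (intro mult_le_mono2 mult_le_mono1)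
  then have gq: "20000000 * q \<le> g" using g' by linarith
  have "l \<le> (2 * g) * (2 * g)"
    using l(2) g1 mult_le_mono[of "g + 1" "2 * g" "g + 1" "2 * g"] by linarith
  then have l4: "l \<le> 4 * g ^ 2" by (simp add: power2_eq_square)
  have lg: "g \<le> l" using l(1) g1 by (metis le_trans mult_le_mono2 nat_mult_1_right one_le_numeral le_square)
  have b: "40 * q * l \<le> 160 * (q * g ^ 2)"
  proof -
    have "40 * q * l \<le> 40 * q * (4 * g ^ 2)" using l4 by (rule mult_le_mono2)
    then show ?thesis by simp
  qed
  have gp: "1 \<le> g ^ j" for j using g1 by simp
  have mono: "g ^ i \<le> g ^ j" if "i \<le> j" for i j using that g1 by (intro power_increasing) auto
  have qg: "1 \<le> q * g ^ j" for j using q gp[of j] by (metis mult_le_mono nat_mult_1)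
  have D: "g ^ 7 * l \<le> 4 * g ^ 9"
  proof -
    have "g ^ 7 * l \<le> g ^ 7 * (4 * g ^ 2)" using l4 by (rule mult_le_mono2)
    also have "\<dots> = 4 * g ^ 9" by (simp flip: power_add)
    finally show ?thesis .
  qed
  define b0 D0 G0 where "b0 = 40 * q * l" and "D0 = g ^ 7 * l" and "G0 = 6 * (2 * D0 + 2) * (b0 + 1) + D0 * (k * l + 2) + b0"
  have b0: "b0 + 1 \<le> 161 * (q * g ^ 2)" "b0 \<le> 160 * (q * g ^ 2)" using b qg[of 2] unfolding b0_def by linarith+
  have D0: "2 * D0 + 2 \<le> 10 * g ^ 9" "D0 \<le> 4 * g ^ 9" using D gp[of 9] unfolding D0_def by linarith+
  have kl: "k * l + 2 \<le> 6 * (q * g ^ 2)"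
  proof -
    have "k * l \<le> q * (4 * g ^ 2)" using l4 by (intro mult_le_mono) (auto simp: q_def)
    moreover have "q * (4 * g ^ 2) = 4 * (q * g ^ 2)" by simp
    ultimately show ?thesis using qg[of 2] by linarith
  qed
  have q211: "q * g ^ 2 \<le> q * g ^ 11" by (intro mult_le_mono2 mono) simp
  have G0: "G0 \<le> 10000 * (q * g ^ 11)"
  proof -
    have "6 * (2 * D0 + 2) * (b0 + 1) \<le> 6 * (10 * g ^ 9) * (161 * (q * g ^ 2))"
      using D0 b0 by (intro mult_le_mono) auto
    moreover have "D0 * (k * l + 2) \<le> (4 * g ^ 9) * (6 * (q * g ^ 2))" using D0 kl by (intro mult_le_mono)
    moreover have "b0 \<le> 160 * (q * g ^ 11)" using b0(2) q211 by linarith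
    moreover have "6 * (10 * g ^ 9) * (161 * (q * g ^ 2)) = 9660 * (q * g ^ 11)" by (simp add: mult_ac flip: power_add)
    moreover have "(4 * g ^ 9) * (6 * (q * g ^ 2)) = 24 * (q * g ^ 11)" by (simp add: mult_ac flip: power_add)
    ultimately show ?thesis unfolding G0_def by linarith
  qed
  have room: "4 * (b0 * (2 * G0 + b0 + 1) + G0) \<le> g ^ 14"
  proof -
    have "b0 + 1 \<le> 161 * (q * g ^ 11)" using b0(1) q211 by linarith
    then have "2 * G0 + b0 + 1 \<le> 20161 * (q * g ^ 11)" using G0 by linarith
    then have "b0 * (2 * G0 + b0 + 1) \<le> (160 * (q * g ^ 2)) * (20161 * (q * g ^ 11))" using b0 by (intro mult_le_mono) auto
    also have "\<dots> = 3225760 * (q * q * g ^ 13)" by (simp add: mult_ac flip: power_add)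
    finally have 1: "b0 * (2 * G0 + b0 + 1) \<le> 3225760 * (q * q * g ^ 13)" .
    have 2: "q * g ^ 11 \<le> q * q * g ^ 13" using q mono[of 11 13] by (intro mult_le_mono) auto
    have "4 * (b0 * (2 * G0 + b0 + 1) + G0) \<le> 4 * (3225760 * (q * q * g ^ 13) + 10000 * (q * q * g ^ 13))"
      using 1 le_trans[OF G0 mult_le_mono2[OF 2]] by (intro mult_le_mono2 add_mono)
    also have "\<dots> \<le> 20000000 * (q * q * g ^ 13)" by simp
    also have "\<dots> = 20000000 * (q * q) * g ^ 13" by simp
    also have "\<dots> \<le> g * g ^ 13" using g' by (intro mult_le_mono1)
    also have "\<dots> = g ^ 14" by (simp flip: power_Suc)
    finally show ?thesis .
  qed
  have small: "(2 * g ^ 14 + 1) * (b0 + 1) \<le> 2 ^ g"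
  proof -
    have "(2 * g ^ 14 + 1) * (b0 + 1) \<le> (3 * g ^ 14) * (161 * (q * g ^ 2))" using b0 gp[of 14] by (intro mult_le_mono) auto
    also have "\<dots> = 483 * q * g ^ 16" by (simp add: mult_ac flip: power_add)
    also have "\<dots> \<le> g * g ^ 16" using gq by (intro mult_le_mono1) simp
    also have "\<dots> = g ^ 17" by (simp flip: power_Suc)
    also note pw
    finally show ?thesis .
  qed
  show ?thesis
  proof
    have "4 * (k + 8) \<le> 20000000 * (k + 1)" by simp
    then show "4 * (k + 8) \<le> l" using gq lg unfolding q_def by (meson le_trans)
    show "4 * l \<le> g ^ 7"
    proof -
      have "4 * l \<le> 16 * g ^ 2" using l4 by simp
      also have "\<dots> \<le> g * g ^ 2" using g1 by (intro mult_le_mono1) simp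
      also have "\<dots> = g ^ 3" by (simp add: power3_eq_cube power2_eq_square)
      also have "\<dots> \<le> g ^ 7" by (rule mono) simp
      finally show ?thesis .
    qed
  qed (use n U l room small in \<open>auto simp: b0_def D0_def G0_def q_def\<close>)
qed

lemma ex_nat_sqrt: "\<exists>g. g * g \<le> l \<and> l < (g + 1) * (g + 1 :: nat)"
proof (induction l)
  case (Suc l)
  then obtain g where "g * g \<le> l" "l < (g + 1) * (g + 1)" by blast
  then show ?case
    by (cases "Suc l < (g + 1) * (g + 1)") (auto intro: exI[of _ g] exI[of _ "g + 1"])
qed auto

text \<open>One cell per element. It serves the finitely many small \<open>n\<close>, for which
  \<open>U \<le> n ^ k\<close> is bounded.\<close>

lemma trivial_ds:
  assumes w: "0 < w"
  shows "\<exists>D. correct_membership_ds w U n D \<and> query_time_le U n D 1 \<and> space_bits w D = w * U"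
proof -
  define D where "D = \<lparr>cells = U, store = (\<lambda>S. map (\<lambda>i. if i \<in> S then 1 else 0) [0..<U]),
    qry = (\<lambda>x. Probe x (\<lambda>v. Return (v = 1)))\<rparr>"
  have "(1::nat) < 2 ^ w" using w by (intro one_less_power) auto
  then have "correct_membership_ds w U n D"
    unfolding correct_membership_ds_def D_def memories_def by auto
  moreover have "query_time_le U n D 1" unfolding query_time_le_def D_def by simp
  moreover have "space_bits w D = w * U" unfolding space_bits_def D_def by simp
  ultimately show ?thesis by blast
qed

lemma large_n_ds:
  fixes k :: nat
  shows "\<exists>n0. \<forall>n\<ge>n0. \<forall>U w. 2 * n \<le> U \<and> U \<le> n ^ k \<and> 0 < w \<longrightarrow>
     (\<exists>D b l. real l \<le> 2 * log 2 (real n) \<and> b = 40 * (k + 1) * l \<and>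
        correct_membership_ds w U n D \<and> query_time_le U n D (85 * (b div w + 2)) \<and>
        real (space_bits w D) \<le> log 2 (real (U choose n)) + real (3 * l ^ 7 + 2 * b + k * l + 4) + real w)"
proof -
  have "eventually (\<lambda>g::nat. real g ^ 17 \<le> 2 ^ g) at_top" by real_asymp
  then obtain g0 where g0: "\<And>g. g0 \<le> g \<Longrightarrow> real g ^ 17 \<le> 2 ^ g" by (auto simp: eventually_at_top_linorder)
  define g1 where "g1 = max g0 (20000000 * (k + 1)\<^sup>2)"
  define n0 :: nat where "n0 = 2 ^ ((g1 + 1) * (g1 + 1))"
  show ?thesis
  proof (intro exI[of _ n0] allI impI)
    fix n U w :: nat assume n: "n0 \<le> n" and "2 * n \<le> U \<and> U \<le> n ^ k \<and> 0 < w"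
    then have U: "2 * n \<le> U" "U \<le> n ^ k" and w: "0 < w" by auto
    have "2 ^ 1 \<le> n0" unfolding n0_def by (intro power_increasing) auto
    then have n2: "2 \<le> n" using n by simp
    obtain u where u: "2 ^ u \<le> n" "n < 2 ^ Suc u" using ex_power_of_two_between[of 1 n] n2 by auto
    \<comment> \<open>With \<open>2 ^ u \<le> n < 2 ^ Suc u\<close>, the successor gives
      \<open>n \<le> 2 ^ l \<le> 2 * n\<close>.\<close>
    define l where "l = Suc u"
    have "(2::nat) ^ ((g1 + 1) * (g1 + 1)) < 2 ^ l" using n u unfolding n0_def l_def by linarith
    then have gl: "(g1 + 1) * (g1 + 1) < l" by (rule power_less_imp_less_exp[rotated]) simp
    obtain g where g: "g * g \<le> l" "l < (g + 1) * (g + 1)" using ex_nat_sqrt by blast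
    have "g1 \<le> g"
    proof (rule ccontr)
      assume "\<not> g1 \<le> g"
      then have "(g + 1) * (g + 1) \<le> (g1 + 1) * (g1 + 1)" by (intro mult_le_mono) auto
      then show False using gl g by linarith
    qed
    then have gg: "g0 \<le> g" "20000000 * (k + 1)\<^sup>2 \<le> g" by (auto simp: g1_def)
    have "real (g ^ 17) \<le> real (2 ^ g)" using g0[OF gg(1)] by simp
    then have pw: "g ^ 17 \<le> 2 ^ g" by (simp only: of_nat_le_iff)
    interpret P: parameters k g l n U
      by (rule parameters_large[OF gg(2) pw g]) (use u U in \<open>auto simp: l_def\<close>)
    obtain Q where Q: "\<And>x. qlocal P.b 85 (Q x)"
      "\<And>S. S \<in> key_sets U n \<Longrightarrow> \<exists>f \<subseteq> {..<(P.N + 1) * P.b + P.m * (P.b * P.E)}. \<forall>x<U. Q x f \<longleftrightarrow> x \<in> S"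
      using P.encoding by blast
    obtain D where D: "correct_membership_ds w U n D" "query_time_le U n D (85 * (P.b div w + 2))"
      "space_bits w D \<le> (P.N + 1) * P.b + P.m * (P.b * P.E) + w"
      using membership_ds_of_qlocal[OF w Q] by blast
    have "P.c = (g * g) ^ 7" by (simp add: P.c_def power_mult_distrib flip: power_add)
    also have "\<dots> \<le> l ^ 7" using g by (intro power_mono) auto
    finally have c: "P.c \<le> l ^ 7" .
    have "real (space_bits w D) \<le> real ((P.N + 1) * P.b + P.m * (P.b * P.E)) + real w"
      using D(3) by (metis of_nat_add of_nat_mono)
    also have "\<dots> \<le> log 2 (real (U choose n)) + real (3 * P.c + 2 * P.b + k * l + 4) + real w" using P.space by simp
    also have "real (3 * P.c + 2 * P.b + k * l + 4) \<le> real (3 * l ^ 7 + 2 * P.b + k * l + 4)"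
      using c by (intro of_nat_mono) simp
    finally have sp: "real (space_bits w D) \<le> log 2 (real (U choose n)) + real (3 * l ^ 7 + 2 * P.b + k * l + 4) + real w" by simp
    have "real l \<le> 2 * log 2 (real n)"
    proof -
      have "real (2 ^ u) \<le> real n" using u(1) by (rule of_nat_mono)
      then have "log 2 (2 ^ u) \<le> log 2 (real n)" by (intro log_mono) auto
      then have "real u \<le> log 2 (real n)" by (simp add: log_nat_power)
      moreover have "1 \<le> log 2 (real n)" using n2 by simp
      ultimately show ?thesis by (simp add: l_def)
    qed
    then show "\<exists>D b l. real l \<le> 2 * log 2 (real n) \<and> b = 40 * (k + 1) * l \<and>
        correct_membership_ds w U n D \<and> query_time_le U n D (85 * (b div w + 2)) \<and>
        real (space_bits w D) \<le> log 2 (real (U choose n)) + real (3 * l ^ 7 + 2 * b + k * l + 4) + real w"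
      using D(1,2) sp P.b_def by blast
  qed
qed

theorem theorem4p1:
  fixes w :: "nat \<Rightarrow> nat" and k :: nat
  assumes word_pos: "\<And>n. n \<ge> 2 \<Longrightarrow> w n > 0"
    and word_size: "(\<lambda>n. real (w n)) \<in> \<Theta>(\<lambda>n. log 2 (real n))"
  shows "\<exists>(t::nat) (d::nat) (C::real). \<forall>n\<ge>2. \<forall>U. 2 * n \<le> U \<and> U \<le> n ^ k \<longrightarrow>
           (\<exists>D. correct_membership_ds (w n) U n D \<and>
                query_time_le U n D t \<and>
                real (space_bits (w n) D) \<le> log 2 (real (U choose n)) + C * log 2 (real n) ^ d)"
proof -
  obtain n0 where n0: "\<And>n U w. n0 \<le> n \<Longrightarrow> 2 * n \<le> U \<Longrightarrow> U \<le> n ^ k \<Longrightarrow> 0 < w \<Longrightarrow>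
     \<exists>D b l. real l \<le> 2 * log 2 (real n) \<and> b = 40 * (k + 1) * l \<and>
        correct_membership_ds w U n D \<and> query_time_le U n D (85 * (b div w + 2)) \<and>
        real (space_bits w D) \<le> log 2 (real (U choose n)) + real (3 * l ^ 7 + 2 * b + k * l + 4) + real w"
    using large_n_ds[of k] by blast
  obtain c1 where c1: "0 < c1" "eventually (\<lambda>n. c1 * norm (log 2 (real n)) \<le> norm (real (w n))) at_top"
    using bigthetaD2[OF word_size] by (elim landau_omega.bigE) auto
  obtain c2 where c2: "0 < c2" "eventually (\<lambda>n. norm (real (w n)) \<le> c2 * norm (log 2 (real n))) at_top"
    using bigthetaD1[OF word_size] by (elim landau_o.bigE) auto
  obtain n1 where n1: "\<And>n. n1 \<le> n \<Longrightarrow> c1 * norm (log 2 (real n)) \<le> norm (real (w n)) \<and> norm (real (w n)) \<le> c2 * norm (log 2 (real n))"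
    using eventually_conj[OF c1(2) c2(2)] by (auto simp: eventually_at_top_linorder)
  define n2 where "n2 = max n0 n1"
  \<comment> \<open>A window of \<open>b\<close> bits is at most \<open>r\<close> words long, so the
    number of probes is bounded in terms of \<open>k\<close> and the lower constant
    \<open>c1\<close> of the word size.\<close>
  define r where "r = nat \<lceil>80 * real (k + 1) / c1\<rceil>"
  define t where "t = 85 * (r + 2)"
  \<comment> \<open>128 is \<open>2 ^ 7\<close>, from \<open>l \<le> 2 * log 2 n\<close> raised to
    the seventh power; \<open>c2\<close> pays for the word lost in rounding.\<close>
  define C1 where "C1 = real (3 + 80 * (k + 1) + k + 4) * 128 + c2"
  \<comment> \<open>A single constant for all small \<open>n\<close>: the trivial structure takes at
    most \<open>w n * n ^ k\<close> bits.\<close>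
  define C2 where "C2 = (\<Sum>n<n2. real (w n * n ^ k))"
  have C1: "0 \<le> C1" using c2 by (simp add: C1_def)
  have C2: "0 \<le> C2" unfolding C2_def by (intro sum_nonneg) auto
  show ?thesis
  proof (rule exI[of _ t], rule exI[of _ 7], rule exI[of _ "C1 + C2"], intro allI impI)
    fix n U :: nat assume n: "2 \<le> n" and "2 * n \<le> U \<and> U \<le> n ^ k"
    then have U: "2 * n \<le> U" "U \<le> n ^ k" by auto
    define lg where "lg = log 2 (real n)"
    have lg: "1 \<le> lg" using n by (simp add: lg_def)
    have lg7: "1 \<le> lg ^ 7" "lg \<le> lg ^ 7"
      using lg power_increasing[of 1 7 lg] by (auto simp: one_le_power)
    have w: "0 < w n" by (rule word_pos[OF n])
    have bin: "0 \<le> log 2 (real (U choose n))"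
    proof -
      have "1 \<le> U choose n" using U by (simp add: Suc_le_eq)
      then have "1 \<le> real (U choose n)" by (metis of_nat_1 of_nat_mono)
      then have "log 2 1 \<le> log 2 (real (U choose n))" by (intro log_mono) auto
      then show ?thesis by (simp only: log_one)
    qed
    show "\<exists>D. correct_membership_ds (w n) U n D \<and> query_time_le U n D t \<and>
        real (space_bits (w n) D) \<le> log 2 (real (U choose n)) + (C1 + C2) * log 2 (real n) ^ 7"
    proof (cases "n < n2")
      case True
      obtain D where D: "correct_membership_ds (w n) U n D" "query_time_le U n D 1" "space_bits (w n) D = w n * U"
        using trivial_ds[OF w] by blast
      have "query_time_le U n D t" using D(2) unfolding query_time_le_def t_def by fastforce
      moreover have "real (space_bits (w n) D) \<le> log 2 (real (U choose n)) + (C1 + C2) * lg ^ 7"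
      proof -
        have "real (w n * U) \<le> real (w n * n ^ k)" using U by (intro of_nat_mono mult_le_mono2)
        also have "\<dots> \<le> C2" unfolding C2_def using True by (intro member_le_sum) auto
        also have "\<dots> \<le> (C1 + C2) * 1" using C1 by simp
        also have "\<dots> \<le> (C1 + C2) * lg ^ 7" using C1 C2 lg7 by (intro mult_left_mono) auto
        finally show ?thesis using bin D(3) by simp
      qed
      ultimately show ?thesis using D(1) unfolding lg_def by blast
    next
      case False
      then have nn: "n0 \<le> n" "n1 \<le> n" by (auto simp: n2_def)
      obtain D b l where l: "real l \<le> 2 * lg" and b: "b = 40 * (k + 1) * l" and
        D: "correct_membership_ds (w n) U n D" "query_time_le U n D (85 * (b div w n + 2))"
        "real (space_bits (w n) D) \<le> log 2 (real (U choose n)) + real (3 * l ^ 7 + 2 * b + k * l + 4) + real (w n)"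
        using n0[OF nn(1) U w] unfolding lg_def by blast
      have wl: "c1 * lg \<le> real (w n)" "real (w n) \<le> c2 * lg" using n1[OF nn(2)] lg unfolding lg_def by auto
      have "real b \<le> 80 * real (k + 1) * lg"
      proof -
        have "real b = 40 * real (k + 1) * real l" by (simp add: b)
        also have "\<dots> \<le> 40 * real (k + 1) * (2 * lg)" using l by (intro mult_left_mono) auto
        finally show ?thesis by (simp add: algebra_simps)
      qed
      also have "\<dots> = (80 * real (k + 1) / c1) * (c1 * lg)" using c1 by simp
      also have "\<dots> \<le> (80 * real (k + 1) / c1) * real (w n)" using wl c1 by (intro mult_left_mono) auto
      also have "\<dots> \<le> real r * real (w n)" unfolding r_def by (intro mult_right_mono) linarith+
      finally have "real b \<le> real (r * w n)" by simp
      then have "b \<le> r * w n" by (simp only: of_nat_le_iff)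
      then have "b div w n \<le> r" using w by (metis div_le_mono nonzero_mult_div_cancel_right neq0_conv)
      then have "85 * (b div w n + 2) \<le> t" by (simp add: t_def)
      then have "query_time_le U n D t" using D(2) unfolding query_time_le_def by (meson le_trans)
      moreover have cw: "real (w n) \<le> c2 * lg ^ 7"
        using wl(2) mult_left_mono[OF lg7(2), of c2] c2(1) by linarith
      moreover have "real (3 * l ^ 7 + 2 * b + k * l + 4) + real (w n) \<le> (C1 + C2) * lg ^ 7"
      \<comment> \<open>For \<open>l = 0\<close> the power \<open>l ^ 7\<close> does not dominate
        the constant 4, so \<open>lg ^ 7\<close> has to.\<close>
      proof (cases "l = 0")
        case True
        then have "real (3 * l ^ 7 + 2 * b + k * l + 4) = 4" by (simp add: b)
        then have "real (3 * l ^ 7 + 2 * b + k * l + 4) + real (w n) \<le> 4 * lg ^ 7 + c2 * lg ^ 7"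
          using cw lg7(1) by linarith
        also have "\<dots> \<le> (C1 + C2) * lg ^ 7"
          using C2 lg7 unfolding C1_def by (simp only: distrib_right[symmetric]) (intro mult_right_mono, use lg in auto)
        finally show ?thesis .
      next
        case False
        then have ll: "1 \<le> l ^ 7" "l \<le> l ^ 7" using power_increasing[of 1 7 l] by (auto simp: one_le_power)
        have "3 * l ^ 7 + 2 * b + k * l + 4 \<le> (3 + 80 * (k + 1) + k + 4) * l ^ 7"
        proof -
          have "2 * b = (80 * (k + 1)) * l" by (simp add: b)
          also have "\<dots> \<le> (80 * (k + 1)) * l ^ 7" using ll by (intro mult_le_mono2)
          finally have "2 * b \<le> (80 * (k + 1)) * l ^ 7" .
          moreover have "k * l \<le> k * l ^ 7" using ll by (intro mult_le_mono2)
          ultimately show ?thesis using ll unfolding add_mult_distrib by linarith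
        qed
        then have "real (3 * l ^ 7 + 2 * b + k * l + 4) \<le> real ((3 + 80 * (k + 1) + k + 4) * l ^ 7)" by (rule of_nat_mono)
        also have "\<dots> = real (3 + 80 * (k + 1) + k + 4) * real l ^ 7" by (simp only: of_nat_mult of_nat_power)
        also have "\<dots> \<le> real (3 + 80 * (k + 1) + k + 4) * (2 * lg) ^ 7" using l by (intro mult_left_mono power_mono) auto
        also have "\<dots> = real (3 + 80 * (k + 1) + k + 4) * 128 * lg ^ 7" by (simp add: power_mult_distrib)
        finally have "real (3 * l ^ 7 + 2 * b + k * l + 4) \<le> real (3 + 80 * (k + 1) + k + 4) * 128 * lg ^ 7" .
        moreover have "0 \<le> C2 * lg ^ 7" using C2 lg by (intro mult_nonneg_nonneg) auto
        ultimately show ?thesis using cw unfolding C1_def distrib_right by linarith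
      qed
      ultimately show ?thesis using D(1,3) unfolding lg_def by (intro exI[of _ D]) auto
    qed
  qed
qed

end
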